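(* Suppose that $A$ is a cellular $R$-algebra with a family of JM-elements which separate $T(\Lambda)$, and let $A_K=A\otimes_RK$. Then $A_K$ is (split) semisimple.
   Context: Let $R$ be a commutative ring with $1$ having a field of fractions $K$ (so $R$ is an integral domain; $R=K$ is allowed), and let $A$ be a unital $R$-algebra. A cell datum for $A$ is a triple $(\Lambda,T,C)$ where $\Lambda=(\Lambda,>)$ is a finite poset, $T(\lambda)$ is a finite set for each $\lambda\in\Lambda$, and $C:\coprod_{\lambda\in\Lambda}T(\lambda)\times T(\lambda)\to A$, $(\mathfrak s,\mathfrak t)\mapsto a^\lambda_{\mathfrak s\mathfrak t}$, is an injective map such that: (a) $\{a^\lambda_{\mathfrak s\mathfrak t}\}$ is an $R$-free basis of $A$; (b) for any $x\in A$ and $\mathfrak t\in T(\lambda)$ there exist $r_{\mathfrak t\mathfrak v x}\in R$ such that, for all $\mathfrak s\in T(\lambda)$, $a^\lambda_{\mathfrak s\mathfrak t}x\equiv\sum_{\mathfrak v\in T(\lambda)}r_{\mathfrak t\mathfrak v x}a^\lambda_{\mathfrak s\mathfrak v}\pmod{A^\lambda}$, where $A^\lambda$ is the $R$-submodule with basis $\{a^\mu_{\mathfrak y\mathfrak z}:\mu>\lambda,\ \mathfrak y,\mathfrak z\in T(\mu)\}$; (c) the $R$-linear map $*:A\to A$ with $(a^\lambda_{\mathfrak s\mathfrak t})^*=a^\lambda_{\mathfrak t\mathfrak s}$ is an anti-isomorphism of $A$. Then $A$ is called cellular. Each $T(\lambda)$ carries a partial order $\triangleright_\lambda$. Put $T(\Lambda)=\coprod_\lambda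 T(\lambda)$, ordered by: $\mathfrak s\triangleright\mathfrak t$ if either $\mathfrak s,\mathfrak t\in T(\lambda)$ for some $\lambda$ and $\mathfrak s\triangleright_\lambda\mathfrak t$, or $\mathfrak s\in T(\lambda)$, $\mathfrak t\in T(\mu)$ and $\lambda>\mu$. A family of JM-elements for $A$ is a set $\{L_1,\dots,L_M\}$ of commuting elements of $A$ with $L_i^*=L_i$, together with scalars $c_{\mathfrak t}(i)\in R$ ($\mathfrak t\in T(\Lambda)$, $1\le i\le M$), such that for all $i$, $\lambda\in\Lambda$ and $\mathfrak s,\mathfrak t\in T(\lambda)$ we have $a^\lambda_{\mathfrak s\mathfrak t}L_i\equiv c_{\mathfrak t}(i)a^\lambda_{\mathfrak s\mathfrak t}+\sum_{\mathfrak v\in T(\lambda),\,\mathfrak v\triangleright\mathfrak t}r_{\mathfrak t\mathfrak v}a^\lambda_{\mathfrak s\mathfrak v}\pmod{A^\lambda}$ for some $r_{\mathfrak t\mathfrak v}\in R$ (depending on $i$). The JM-elements separate $T(\Lambda)$ if whenever $\mathfrak s,\mathfrak t\in T(\Lambda)$ and $\mathfrak s\triangleright\mathfrak t$ then $c_{\mathfrak s}(i)\ne c_{\mathfrak t}(i)$ for some $i$ with $1\le i\le M$. *)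

theory Defs
  imports "HOL-Algebra.Algebra"
begin

section \<open>Algebras, free bases and fields of fractions\<close>

text \<open>The locale \<open>algebra\<close> of HOL-Algebra requires the algebra to be commutative; this one does not.\<close>

locale unital_algebra = module R A + A?: ring A for R (structure) and A (structure) +
  assumes smult_mult_left:
      "\<lbrakk>r \<in> carrier R; x \<in> carrier A; y \<in> carrier A\<rbrakk>
        \<Longrightarrow> (r \<odot>\<^bsub>A\<^esub> x) \<otimes>\<^bsub>A\<^esub> y = r \<odot>\<^bsub>A\<^esub> (x \<otimes>\<^bsub>A\<^esub> y)"
    and smult_mult_right:
      "\<lbrakk>r \<in> carrier R; x \<in> carrier A; y \<in> carrier A\<rbrakk>
        \<Longrightarrow> x \<otimes>\<^bsub>A\<^esub> (r \<odot>\<^bsub>A\<^esub> y) = r \<odot>\<^bsub>A\<^esub> (x \<otimes>\<^bsub>A\<^esub> y)"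

text \<open>The span of a finite set only: for infinite \<open>S\<close> the \<open>finsum\<close> is zero.\<close>

definition lin_span ::
  "('r, 'x) ring_scheme \<Rightarrow> ('r, 'a, 'y) module_scheme \<Rightarrow> 'a set \<Rightarrow> 'a set"
  where "lin_span R A S = {\<Oplus>\<^bsub>A\<^esub>b\<in>S. f b \<odot>\<^bsub>A\<^esub> b | f. f \<in> S \<rightarrow> carrier R}"

definition finite_free_basis ::
  "('r, 'x) ring_scheme \<Rightarrow> ('r, 'a, 'y) module_scheme \<Rightarrow> 'a set \<Rightarrow> bool"
  where "finite_free_basis R A S \<longleftrightarrow>
    finite S \<and> S \<subseteq> carrier A \<and>
    (\<forall>x\<in>carrier A. \<exists>!f. f \<in> S \<rightarrow>\<^sub>E carrier R \<and> x = (\<Oplus>\<^bsub>A\<^esub>b\<in>S. f b \<odot>\<^bsub>A\<^esub> b))"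

definition field_of_fractions ::
  "('r, 'x) ring_scheme \<Rightarrow> ('k, 'y) ring_scheme \<Rightarrow> ('r \<Rightarrow> 'k) \<Rightarrow> bool"
  where "field_of_fractions R K \<iota> \<longleftrightarrow>
    domain R \<and> field K \<and> \<iota> \<in> ring_hom R K \<and> inj_on \<iota> (carrier R) \<and>
    (\<forall>x\<in>carrier K. \<exists>p\<in>carrier R. \<exists>q\<in>carrier R - {\<zero>\<^bsub>R\<^esub>}. x = \<iota> p \<otimes>\<^bsub>K\<^esub> inv\<^bsub>K\<^esub> (\<iota> q))"


section \<open>Cellular algebras and Jucys--Murphy elements\<close>

text \<open>
  \<open>gt \<lambda> \<mu>\<close> means \<open>\<lambda> > \<mu>\<close>, and \<open>a \<lambda> s t\<close> is the basis element indexed by \<open>(s, t) \<in> T \<lambda> \<times> T \<lambda>\<close>.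
  The sets \<open>T \<lambda>\<close> live in one type but need not be disjoint: an element of the coproduct of
  the \<open>T \<lambda>\<close> is a pair \<open>(\<lambda>, t)\<close>.  The map \<open>star\<close> is determined on \<open>carrier A\<close> by
  its linearity and its values on the basis.
\<close>

definition cell_index :: "'l set \<Rightarrow> ('l \<Rightarrow> 't set) \<Rightarrow> ('l \<times> 't \<times> 't) set"
  where "cell_index \<Lambda> T = (SIGMA l:\<Lambda>. T l \<times> T l)"

definition cell_basis :: "'l set \<Rightarrow> ('l \<Rightarrow> 't set) \<Rightarrow> ('l \<Rightarrow> 't \<Rightarrow> 't \<Rightarrow> 'a) \<Rightarrow> 'a set"
  where "cell_basis \<Lambda> T a = (\<lambda>(l, s, t). a l s t) ` cell_index \<Lambda> T"

definition higher_cells ::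
  "('r, 'x) ring_scheme \<Rightarrow> ('r, 'a, 'y) module_scheme \<Rightarrow> 'l set \<Rightarrow> ('l \<Rightarrow> 'l \<Rightarrow> bool)
    \<Rightarrow> ('l \<Rightarrow> 't set) \<Rightarrow> ('l \<Rightarrow> 't \<Rightarrow> 't \<Rightarrow> 'a) \<Rightarrow> 'l \<Rightarrow> 'a set"
  where "higher_cells R A \<Lambda> gt T a l = lin_span R A (cell_basis {m \<in> \<Lambda>. gt m l} T a)"

locale cellular_algebra = unital_algebra R A
  for R :: "('r, 'x) ring_scheme" (structure) and A :: "('r, 'a, 'y) module_scheme" (structure) +
  fixes \<Lambda> :: "'l set" and gt :: "'l \<Rightarrow> 'l \<Rightarrow> bool" and T :: "'l \<Rightarrow> 't set"
    and a :: "'l \<Rightarrow> 't \<Rightarrow> 't \<Rightarrow> 'a" and star :: "'a \<Rightarrow> 'a"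
  assumes finite_poset: "finite \<Lambda>" "irreflp_on \<Lambda> gt" "transp_on \<Lambda> gt"
    and finite_T: "l \<in> \<Lambda> \<Longrightarrow> finite (T l)"
    and inj_cell: "inj_on (\<lambda>(l, s, t). a l s t) (cell_index \<Lambda> T)"
    and basis: "finite_free_basis R A (cell_basis \<Lambda> T a)"
    and cell_mult:
      "\<lbrakk>x \<in> carrier A; l \<in> \<Lambda>; t \<in> T l\<rbrakk> \<Longrightarrow>
        \<exists>r \<in> T l \<rightarrow> carrier R. \<forall>s\<in>T l.
          (a l s t \<otimes>\<^bsub>A\<^esub> x) \<ominus>\<^bsub>A\<^esub> (\<Oplus>\<^bsub>A\<^esub>v\<in>T l. r v \<odot>\<^bsub>A\<^esub> a l s v)
            \<in> higher_cells R A \<Lambda> gt T a l"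
    and star_add: "\<lbrakk>x \<in> carrier A; y \<in> carrier A\<rbrakk> \<Longrightarrow> star (x \<oplus>\<^bsub>A\<^esub> y) = star x \<oplus>\<^bsub>A\<^esub> star y"
    and star_smult: "\<lbrakk>r \<in> carrier R; x \<in> carrier A\<rbrakk> \<Longrightarrow> star (r \<odot>\<^bsub>A\<^esub> x) = r \<odot>\<^bsub>A\<^esub> star x"
    and star_cell: "\<lbrakk>l \<in> \<Lambda>; s \<in> T l; t \<in> T l\<rbrakk> \<Longrightarrow> star (a l s t) = a l t s"
    and star_bij: "bij_betw star (carrier A) (carrier A)"
    and star_mult: "\<lbrakk>x \<in> carrier A; y \<in> carrier A\<rbrakk> \<Longrightarrow> star (x \<otimes>\<^bsub>A\<^esub> y) = star y \<otimes>\<^bsub>A\<^esub> star x"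

text \<open>\<open>sdom l s t\<close> means that \<open>s\<close> strictly dominates \<open>t\<close> in the partial order carried by \<open>T l\<close>.\<close>

definition tableau_gt ::
  "('l \<Rightarrow> 'l \<Rightarrow> bool) \<Rightarrow> ('l \<Rightarrow> 't \<Rightarrow> 't \<Rightarrow> bool) \<Rightarrow> 'l \<times> 't \<Rightarrow> 'l \<times> 't \<Rightarrow> bool"
  where "tableau_gt gt sdom = (\<lambda>(l, s) (m, t). (l = m \<and> sdom l s t) \<or> gt l m)"

locale jm_family = cellular_algebra R A \<Lambda> gt T a star
  for R :: "('r, 'x) ring_scheme" (structure) and A :: "('r, 'a, 'y) module_scheme" (structure)
    and \<Lambda> :: "'l set" and gt and T :: "'l \<Rightarrow> 't set" and a and star +
  fixes sdom :: "'l \<Rightarrow> 't \<Rightarrow> 't \<Rightarrow> bool"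
    and M :: nat and L :: "nat \<Rightarrow> 'a" and c :: "'l \<times> 't \<Rightarrow> nat \<Rightarrow> 'r"
  assumes dom_order: "l \<in> \<Lambda> \<Longrightarrow> irreflp_on (T l) (sdom l)" "l \<in> \<Lambda> \<Longrightarrow> transp_on (T l) (sdom l)"
    and L_closed: "i \<in> {1..M} \<Longrightarrow> L i \<in> carrier A"
    and L_commute: "\<lbrakk>i \<in> {1..M}; j \<in> {1..M}\<rbrakk> \<Longrightarrow> L i \<otimes>\<^bsub>A\<^esub> L j = L j \<otimes>\<^bsub>A\<^esub> L i"
    and L_star: "i \<in> {1..M} \<Longrightarrow> star (L i) = L i"
    and c_closed: "\<lbrakk>p \<in> Sigma \<Lambda> T; i \<in> {1..M}\<rbrakk> \<Longrightarrow> c p i \<in> carrier R"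
    and L_triangular:
      "\<lbrakk>i \<in> {1..M}; l \<in> \<Lambda>; t \<in> T l\<rbrakk> \<Longrightarrow>
        \<exists>r \<in> T l \<rightarrow> carrier R. \<forall>s\<in>T l.
          (a l s t \<otimes>\<^bsub>A\<^esub> L i) \<ominus>\<^bsub>A\<^esub>
            (c (l, t) i \<odot>\<^bsub>A\<^esub> a l s t \<oplus>\<^bsub>A\<^esub>
              (\<Oplus>\<^bsub>A\<^esub>v\<in>{v \<in> T l. sdom l v t}. r v \<odot>\<^bsub>A\<^esub> a l s v))
            \<in> higher_cells R A \<Lambda> gt T a l"

definition jm_separates ::
  "'l set \<Rightarrow> ('l \<Rightarrow> 'l \<Rightarrow> bool) \<Rightarrow> ('l \<Rightarrow> 't set) \<Rightarrow> ('l \<Rightarrow> 't \<Rightarrow> 't \<Rightarrow> bool)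
    \<Rightarrow> nat \<Rightarrow> ('l \<times> 't \<Rightarrow> nat \<Rightarrow> 'r) \<Rightarrow> bool"
  where "jm_separates \<Lambda> gt T sdom M c \<longleftrightarrow>
    (\<forall>p\<in>Sigma \<Lambda> T. \<forall>q\<in>Sigma \<Lambda> T. tableau_gt gt sdom p q \<longrightarrow> (\<exists>i\<in>{1..M}. c p i \<noteq> c q i))"


section \<open>Extension of scalars\<close>

text \<open>
  The tensor product of \<open>A\<close> and \<open>K\<close> over \<open>R\<close>, where \<open>K\<close> is an \<open>R\<close>-algebra via \<open>\<iota>\<close>, is the
  free abelian group on \<open>carrier A \<times> carrier K\<close> modulo the subgroup generated by the
  bilinearity relations.  The product \<open>(a, k) (b, l) = (a b, k l)\<close> makes this free group a ring
  in which that subgroup is a two-sided ideal, so the quotient is formed as a quotient ring.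
\<close>

definition tensor_free ::
  "('r, 'a, 'x) module_scheme \<Rightarrow> ('k, 'y) ring_scheme \<Rightarrow> (('a \<times> 'k) \<Rightarrow>\<^sub>0 int) ring"
  where "tensor_free A K =
    \<lparr>carrier = {x. Poly_Mapping.keys x \<subseteq> carrier A \<times> carrier K},
     monoid.mult = (\<lambda>x y. frag_extend
       (\<lambda>(a, k). frag_extend (\<lambda>(b, l). frag_of (a \<otimes>\<^bsub>A\<^esub> b, k \<otimes>\<^bsub>K\<^esub> l)) y) x),
     one = frag_of (\<one>\<^bsub>A\<^esub>, \<one>\<^bsub>K\<^esub>),
     ring.zero = 0,
     ring.add = (+)\<rparr>"

definition tensor_relations ::
  "('r, 'z) ring_scheme \<Rightarrow> ('r \<Rightarrow> 'k) \<Rightarrow> ('k, 'y) ring_scheme \<Rightarrow> ('r, 'a, 'x) module_scheme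
    \<Rightarrow> (('a \<times> 'k) \<Rightarrow>\<^sub>0 int) set"
  where "tensor_relations R \<iota> K A =
    {frag_of (a \<oplus>\<^bsub>A\<^esub> b, k) - frag_of (a, k) - frag_of (b, k) | a b k.
       a \<in> carrier A \<and> b \<in> carrier A \<and> k \<in> carrier K} \<union>
    {frag_of (a, k \<oplus>\<^bsub>K\<^esub> l) - frag_of (a, k) - frag_of (a, l) | a k l.
       a \<in> carrier A \<and> k \<in> carrier K \<and> l \<in> carrier K} \<union>
    {frag_of (r \<odot>\<^bsub>A\<^esub> a, k) - frag_of (a, \<iota> r \<otimes>\<^bsub>K\<^esub> k) | r a k.
       r \<in> carrier R \<and> a \<in> carrier A \<and> k \<in> carrier K}"

definition tensor_kernel ::
  "('r, 'z) ring_scheme \<Rightarrow> ('r \<Rightarrow> 'k) \<Rightarrow> ('k, 'y) ring_scheme \<Rightarrow> ('r, 'a, 'x) module_scheme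
    \<Rightarrow> (('a \<times> 'k) \<Rightarrow>\<^sub>0 int) set"
  where "tensor_kernel R \<iota> K A =
    generate (add_monoid (tensor_free A K)) (tensor_relations R \<iota> K A)"

text \<open>Scalars act by \<open>c (a \<otimes> k) = a \<otimes> (c k)\<close>.\<close>

definition base_change ::
  "('r, 'z) ring_scheme \<Rightarrow> ('r \<Rightarrow> 'k) \<Rightarrow> ('k, 'y) ring_scheme \<Rightarrow> ('r, 'a, 'x) module_scheme
    \<Rightarrow> ('k, (('a \<times> 'k) \<Rightarrow>\<^sub>0 int) set) module"
  where "base_change R \<iota> K A =
    ring.extend (tensor_free A K Quot tensor_kernel R \<iota> K A)
      (module.fields
        (\<lambda>c Z. \<Union>x\<in>Z. tensor_kernel R \<iota> K A +>\<^bsub>tensor_free A K\<^esub>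
                 frag_extend (\<lambda>(a, k). frag_of (a, c \<otimes>\<^bsub>K\<^esub> k)) x))"


section \<open>Split semisimple algebras\<close>

text \<open>
  Right modules over a possibly noncommutative ring \<open>B\<close>.  Only the additive structure of the
  record \<open>V\<close> is used, so that in particular \<open>B\<close> itself can be taken for \<open>V\<close>.
\<close>

locale right_module = B?: ring B + V?: abelian_group V
  for B :: "('b, 'x) ring_scheme" (structure) and V :: "('v, 'y) ring_scheme" (structure) +
  fixes act :: "'v \<Rightarrow> 'b \<Rightarrow> 'v"
  assumes act_closed: "\<lbrakk>v \<in> carrier V; x \<in> carrier B\<rbrakk> \<Longrightarrow> act v x \<in> carrier V"
    and act_add_left:
      "\<lbrakk>v \<in> carrier V; w \<in> carrier V; x \<in> carrier B\<rbrakk> \<Longrightarrow> act (v \<oplus>\<^bsub>V\<^esub> w) x = act v x \<oplus>\<^bsub>V\<^esub> act w x"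
    and act_add_right:
      "\<lbrakk>v \<in> carrier V; x \<in> carrier B; y \<in> carrier B\<rbrakk>
        \<Longrightarrow> act v (x \<oplus>\<^bsub>B\<^esub> y) = act v x \<oplus>\<^bsub>V\<^esub> act v y"
    and act_mult:
      "\<lbrakk>v \<in> carrier V; x \<in> carrier B; y \<in> carrier B\<rbrakk> \<Longrightarrow> act v (x \<otimes>\<^bsub>B\<^esub> y) = act (act v x) y"
    and act_one: "v \<in> carrier V \<Longrightarrow> act v \<one>\<^bsub>B\<^esub> = v"

definition right_submodule ::
  "('b, 'x) ring_scheme \<Rightarrow> ('v, 'y) ring_scheme \<Rightarrow> ('v \<Rightarrow> 'b \<Rightarrow> 'v) \<Rightarrow> 'v set \<Rightarrow> bool"
  where "right_submodule B V act N \<longleftrightarrow>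
    additive_subgroup N V \<and> (\<forall>v\<in>N. \<forall>x\<in>carrier B. act v x \<in> N)"

definition simple_right_module ::
  "('b, 'x) ring_scheme \<Rightarrow> ('v, 'y) ring_scheme \<Rightarrow> ('v \<Rightarrow> 'b \<Rightarrow> 'v) \<Rightarrow> bool"
  where "simple_right_module B V act \<longleftrightarrow>
    right_module B V act \<and> carrier V \<noteq> {\<zero>\<^bsub>V\<^esub>} \<and>
    (\<forall>N. right_submodule B V act N \<longrightarrow> N = {\<zero>\<^bsub>V\<^esub>} \<or> N = carrier V)"

definition semisimple_right_module ::
  "('b, 'x) ring_scheme \<Rightarrow> ('v, 'y) ring_scheme \<Rightarrow> ('v \<Rightarrow> 'b \<Rightarrow> 'v) \<Rightarrow> bool"
  where "semisimple_right_module B V act \<longleftrightarrow>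
    right_module B V act \<and>
    (\<forall>N. right_submodule B V act N \<longrightarrow>
      (\<exists>N'. right_submodule B V act N' \<and> N \<inter> N' = {\<zero>\<^bsub>V\<^esub>} \<and> N <+>\<^bsub>V\<^esub> N' = carrier V))"

definition semisimple_ring :: "('b, 'x) ring_scheme \<Rightarrow> bool"
  where "semisimple_ring B \<longleftrightarrow> semisimple_right_module B B (monoid.mult B)"

definition module_endomorphisms ::
  "('b, 'x) ring_scheme \<Rightarrow> ('v, 'y) ring_scheme \<Rightarrow> ('v \<Rightarrow> 'b \<Rightarrow> 'v) \<Rightarrow> ('v \<Rightarrow> 'v) set"
  where "module_endomorphisms B V act =
    {f \<in> carrier V \<rightarrow> carrier V.
      (\<forall>v\<in>carrier V. \<forall>w\<in>carrier V. f (v \<oplus>\<^bsub>V\<^esub> w) = f v \<oplus>\<^bsub>V\<^esub> f w) \<and>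
      (\<forall>v\<in>carrier V. \<forall>x\<in>carrier B. f (act v x) = act (f v) x)}"

text \<open>
  A \<open>K\<close>-algebra is split if the endomorphisms of every simple module are the scalars from
  \<open>K\<close>, which act through \<open>c \<odot> \<one>\<close>. HOL cannot quantify over all types inside a formula, so the
  type \<open>'v\<close> carrying the modules is a parameter; results are to be stated for arbitrary \<open>'v\<close>.
\<close>

definition split_algebra ::
  "('k, 'x) ring_scheme \<Rightarrow> ('k, 'b, 'y) module_scheme \<Rightarrow> 'v itself \<Rightarrow> bool"
  where "split_algebra K B _ \<longleftrightarrow>
    (\<forall>(V :: 'v ring) act. simple_right_module B V act \<longrightarrow>
      (\<forall>f\<in>module_endomorphisms B V act.
        \<exists>c\<in>carrier K. \<forall>v\<in>carrier V. f v = act v (c \<odot>\<^bsub>B\<^esub> \<one>\<^bsub>B\<^esub>)))"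

definition split_semisimple_algebra ::
  "('k, 'x) ring_scheme \<Rightarrow> ('k, 'b, 'y) module_scheme \<Rightarrow> 'v itself \<Rightarrow> bool"
  where "split_semisimple_algebra K B ty \<longleftrightarrow>
    unital_algebra K B \<and> semisimple_ring B \<and> split_algebra K B ty"

end

theory Submission
  imports Defs
begin

text \<open>
  Write \<open>C l\<close> for the cell module with basis \<open>T l\<close>.  Modulo higher cells,
  \<open>a l s t \<otimes> a l u v = form l t u \<odot> a l s v\<close> (\<open>coeff_product\<close>), so \<open>form l\<close> is the matrix of the
  bilinear form of \<open>C l\<close>.  The whole proof rests on the fact that every \<open>form l\<close> is nondegenerate.

  Here is why (\<open>form_nondegenerate\<close>, over the domain \<open>R\<close> itself).  A vector \<open>w\<close> in the radical of
  \<open>form l\<close> is annihilated by the elements \<open>a l u v\<close>, and any vector of \<open>C l\<close> is annihilated by \<open>a m u v\<close>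
  unless \<open>l > m\<close> or \<open>m = l\<close>.  So only the cells below \<open>l\<close> act on the radical.  On those cells the
  \<open>L\<^sub>i\<close> act triangularly with the eigenvalues \<open>c (m, t) i\<close>, hence a product \<open>y\<close> of factors
  \<open>L\<^sub>i - c (m, t) i\<close>, one for every \<open>(m, t)\<close> with \<open>l > m\<close>, has no component in them and kills
  the radical.  But \<open>y\<close> acts triangularly on \<open>C l\<close> too: if \<open>s\<close> lies in the
  support of \<open>w\<close> and nothing in the support is strictly dominated by \<open>s\<close>, then the
  coefficient of \<open>s\<close> is multiplied by the product of the
  \<open>c (l, s) i - c (m, t) i\<close>.  By separation \<open>i\<close> can be chosen for each \<open>(m, t)\<close> so that this is
  not zero, and \<open>w\<close> must vanish.

  Gaussian elimination without division turns nondegeneracy into elements of \<open>A\<close> that act on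
  the cell \<open>l\<close>, modulo higher cells, as a nonzero scalar \<open>d\<close> (\<open>scaled_left_identity\<close>; applying
  \<open>star\<close> gives the right-handed version).  Over \<open>K\<close> one can divide by \<open>d\<close>.  By induction along the
  poset, each two-sided ideal spanned by the cells in an upward closed set then has an identity
  element, which is central (\<open>identity_exists\<close>).  With \<open>e\<close> the identity of the ideal above \<open>l\<close>, the
  elements \<open>b l s t = a l s t \<otimes> (\<one> - e)\<close> multiply exactly by \<open>form l\<close>, products from different cells
  vanish, and they still span (\<open>orthogonal\<close>).  An algebra spanned in this way is split semisimple
  (\<open>semisimple\<close>, \<open>split\<close>).  Only spanning sets occur in the part over \<open>K\<close>; coefficients are compared
  in the free module \<open>A\<close> alone.
\<close>

section \<open>Linear hulls\<close>

text \<open>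
  Generating the span step by step provides an induction principle for properties that are
  stable under linear combinations; the generators may repeat, as images of a basis can.
\<close>

inductive_set linear_hull ::
  "('r, 'x) ring_scheme \<Rightarrow> ('r, 'a, 'y) module_scheme \<Rightarrow> 'a set \<Rightarrow> 'a set"
  for R :: "('r, 'x) ring_scheme" and A :: "('r, 'a, 'y) module_scheme" and S :: "'a set" where
  zero: "\<zero>\<^bsub>A\<^esub> \<in> linear_hull R A S"
| step: "\<lbrakk>s \<in> S; r \<in> carrier R; x \<in> linear_hull R A S\<rbrakk> \<Longrightarrow> r \<odot>\<^bsub>A\<^esub> s \<oplus>\<^bsub>A\<^esub> x \<in> linear_hull R A S"

context unital_algebra
begin

lemma hull_closed:
  assumes "x \<in> linear_hull R A S" "S \<subseteq> carrier A"
  shows "x \<in> carrier A"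
  using assms by (induction rule: linear_hull.induct) auto

lemma hull_base: "\<lbrakk>s \<in> S; S \<subseteq> carrier A\<rbrakk> \<Longrightarrow> s \<in> linear_hull R A S"
  using linear_hull.step[where r = \<one> and R = R and A = A and S = S and s = s, OF _ _ linear_hull.zero] by (auto simp: subset_iff)

lemma hull_add:
  assumes "x \<in> linear_hull R A S" "y \<in> linear_hull R A S" "S \<subseteq> carrier A"
  shows "x \<oplus>\<^bsub>A\<^esub> y \<in> linear_hull R A S"
  using assms
proof (induction rule: linear_hull.induct)
  case zero
  then show ?case using hull_closed[of y] by simp
next
  case (step s r x)
  have "r \<odot>\<^bsub>A\<^esub> s \<oplus>\<^bsub>A\<^esub> x \<oplus>\<^bsub>A\<^esub> y = r \<odot>\<^bsub>A\<^esub> s \<oplus>\<^bsub>A\<^esub> (x \<oplus>\<^bsub>A\<^esub> y)"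
    using step hull_closed by (intro M.a_assoc) auto
  then show ?case using step linear_hull.step by metis
qed

lemma hull_smult:
  assumes "x \<in> linear_hull R A S" "r \<in> carrier R" "S \<subseteq> carrier A"
  shows "r \<odot>\<^bsub>A\<^esub> x \<in> linear_hull R A S"
  using assms
proof (induction rule: linear_hull.induct)
  case zero
  then show ?case by (simp add: linear_hull.zero)
next
  case (step s q x)
  have "r \<odot>\<^bsub>A\<^esub> (q \<odot>\<^bsub>A\<^esub> s \<oplus>\<^bsub>A\<^esub> x) = (r \<otimes> q) \<odot>\<^bsub>A\<^esub> s \<oplus>\<^bsub>A\<^esub> r \<odot>\<^bsub>A\<^esub> x"
    using step hull_closed[of x S] by (auto simp: smult_r_distr smult_assoc1 subset_iff)
  then show ?case using step by (simp add: linear_hull.step)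
qed

lemma smult_minus_one: "x \<in> carrier A \<Longrightarrow> (\<ominus> \<one>) \<odot>\<^bsub>A\<^esub> x = \<ominus>\<^bsub>A\<^esub> x"
  by (simp add: smult_l_minus)

lemma hull_neg: "\<lbrakk>x \<in> linear_hull R A S; S \<subseteq> carrier A\<rbrakk> \<Longrightarrow> \<ominus>\<^bsub>A\<^esub> x \<in> linear_hull R A S"
  using hull_smult[of x S "\<ominus> \<one>"] by (simp add: smult_minus_one hull_closed)

lemma hull_minus:
  "\<lbrakk>x \<in> linear_hull R A S; y \<in> linear_hull R A S; S \<subseteq> carrier A\<rbrakk>
    \<Longrightarrow> x \<ominus>\<^bsub>A\<^esub> y \<in> linear_hull R A S"
  by (simp add: a_minus_def hull_add hull_neg)

lemma hull_least:
  assumes "S' \<subseteq> linear_hull R A S" "S \<subseteq> carrier A"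
  shows "linear_hull R A S' \<subseteq> linear_hull R A S"
proof
  fix x assume "x \<in> linear_hull R A S'"
  then show "x \<in> linear_hull R A S"
    using assms by induction (auto intro!: linear_hull.zero hull_add hull_smult)
qed

lemma hull_mono: "S' \<subseteq> S \<Longrightarrow> S \<subseteq> carrier A \<Longrightarrow> linear_hull R A S' \<subseteq> linear_hull R A S"
  by (rule hull_least) (auto intro: hull_base)

lemma hull_mult_right:
  assumes "x \<in> linear_hull R A S" "S \<subseteq> carrier A" "y \<in> carrier A"
    and "\<And>s. s \<in> S \<Longrightarrow> s \<otimes>\<^bsub>A\<^esub> y \<in> linear_hull R A S'" "S' \<subseteq> carrier A"
  shows "x \<otimes>\<^bsub>A\<^esub> y \<in> linear_hull R A S'"
  using assms
proof (induction rule: linear_hull.induct)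
  case (step s r x)
  then have "(r \<odot>\<^bsub>A\<^esub> s \<oplus>\<^bsub>A\<^esub> x) \<otimes>\<^bsub>A\<^esub> y = r \<odot>\<^bsub>A\<^esub> (s \<otimes>\<^bsub>A\<^esub> y) \<oplus>\<^bsub>A\<^esub> x \<otimes>\<^bsub>A\<^esub> y"
    using hull_closed[of x S] by (auto simp: A.l_distr smult_mult_left subset_iff)
  then show ?case using step by (auto intro!: hull_add hull_smult)
qed (auto intro: linear_hull.zero)

lemma hull_mult_left:
  assumes "x \<in> linear_hull R A S" "S \<subseteq> carrier A" "y \<in> carrier A"
    and "\<And>s. s \<in> S \<Longrightarrow> y \<otimes>\<^bsub>A\<^esub> s \<in> linear_hull R A S'" "S' \<subseteq> carrier A"
  shows "y \<otimes>\<^bsub>A\<^esub> x \<in> linear_hull R A S'"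
  using assms
proof (induction rule: linear_hull.induct)
  case (step s r x)
  then have "y \<otimes>\<^bsub>A\<^esub> (r \<odot>\<^bsub>A\<^esub> s \<oplus>\<^bsub>A\<^esub> x) = r \<odot>\<^bsub>A\<^esub> (y \<otimes>\<^bsub>A\<^esub> s) \<oplus>\<^bsub>A\<^esub> y \<otimes>\<^bsub>A\<^esub> x"
    using hull_closed[of x S] by (auto simp: A.r_distr smult_mult_right subset_iff)
  then show ?case using step by (auto intro!: hull_add hull_smult)
qed (auto intro: linear_hull.zero)

text \<open>Scalars act through the algebra, so right ideals are subspaces.\<close>

lemma smult_as_mult: "\<lbrakk>r \<in> carrier R; x \<in> carrier A\<rbrakk> \<Longrightarrow> r \<odot>\<^bsub>A\<^esub> x = x \<otimes>\<^bsub>A\<^esub> (r \<odot>\<^bsub>A\<^esub> \<one>\<^bsub>A\<^esub>)"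
  by (simp add: smult_mult_right)

lemma regular_right_module: "right_module A A (monoid.mult A)"
  by unfold_locales (auto simp: A.l_distr A.r_distr A.m_assoc)

end

section \<open>Algebras spanned by orthogonal cells\<close>

context right_module
begin

lemma act_zero_left [simp]: assumes "x \<in> carrier B" shows "act \<zero>\<^bsub>V\<^esub> x = \<zero>\<^bsub>V\<^esub>"
proof -
  have "act \<zero>\<^bsub>V\<^esub> x \<oplus>\<^bsub>V\<^esub> act \<zero>\<^bsub>V\<^esub> x = act \<zero>\<^bsub>V\<^esub> x"
    using act_add_left[of "\<zero>\<^bsub>V\<^esub>" "\<zero>\<^bsub>V\<^esub>" x] assms by simp
  then show ?thesis using act_closed assms by simp
qed

lemma act_zero_right [simp]: assumes "v \<in> carrier V" shows "act v \<zero>\<^bsub>B\<^esub> = \<zero>\<^bsub>V\<^esub>"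
proof -
  have "act v \<zero>\<^bsub>B\<^esub> \<oplus>\<^bsub>V\<^esub> act v \<zero>\<^bsub>B\<^esub> = act v \<zero>\<^bsub>B\<^esub>"
    using act_add_right[of v "\<zero>\<^bsub>B\<^esub>" "\<zero>\<^bsub>B\<^esub>"] assms by simp
  then show ?thesis using act_closed assms by simp
qed

lemma act_neg_right:
  assumes "v \<in> carrier V" "x \<in> carrier B" shows "act v (\<ominus>\<^bsub>B\<^esub> x) = \<ominus>\<^bsub>V\<^esub> act v x"
proof -
  have "act v (\<ominus>\<^bsub>B\<^esub> x) \<oplus>\<^bsub>V\<^esub> act v x = \<zero>\<^bsub>V\<^esub>"
    using act_add_right[of v "\<ominus>\<^bsub>B\<^esub> x" x] assms by (simp add: B.l_neg)
  then show ?thesis using act_closed assms V.minus_equality by simp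
qed

lemma cyclic_submodule:
  assumes "v \<in> carrier V"
  shows "right_submodule B V act (act v ` carrier B)"
proof -
  have "additive_subgroup (act v ` carrier B) V"
  proof (rule additive_subgroup.intro, rule V.add.subgroupI)
    show "act v ` carrier B \<noteq> {}" by auto
    fix x assume "x \<in> act v ` carrier B"
    then obtain y where "y \<in> carrier B" "x = act v y" by auto
    then show "\<ominus>\<^bsub>V\<^esub> x \<in> act v ` carrier B"
      using act_neg_right[OF assms, of y] by (auto simp: a_inv_def[symmetric] image_iff intro!: bexI[of _ "\<ominus>\<^bsub>B\<^esub> y"])
  next
    fix x y assume "x \<in> act v ` carrier B" "y \<in> act v ` carrier B"
    then show "x \<oplus>\<^bsub>V\<^esub> y \<in> act v ` carrier B"
      using act_add_right[OF assms, symmetric] by (auto simp: image_iff)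
  qed (auto simp: act_closed assms)
  moreover have "act (act v x) y \<in> act v ` carrier B" if "x \<in> carrier B" "y \<in> carrier B" for x y
    using act_mult[OF assms that, symmetric] that by auto
  ultimately show ?thesis by (auto simp: right_submodule_def)
qed

lemma simple_generated:
  assumes "simple_right_module B V act" "v \<in> carrier V" "v \<noteq> \<zero>\<^bsub>V\<^esub>"
  shows "act v ` carrier B = carrier V"
proof -
  have "v \<in> act v ` carrier B"
    using act_one[OF assms(2)] by (metis B.one_closed image_eqI)
  with assms cyclic_submodule[OF assms(2)] show ?thesis
    unfolding simple_right_module_def by auto
qed

end

text \<open>
  The generators multiply like those of a direct product of matrix algebras, twisted by a matrix
  \<open>form l\<close> for each \<open>l\<close>.  As the span of the generators has a unit, a vector in the radical of
  \<open>form l\<close> gives a linear relation among the \<open>b l s t\<close> for each \<open>s\<close>.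
\<close>

locale orthogonal_cells = K?: field K + unital_algebra K B
  for K :: "('k, 'x) ring_scheme" (structure) and B :: "('k, 'b, 'y) module_scheme" (structure) +
  fixes \<Lambda> :: "'l set" and T :: "'l \<Rightarrow> 't set" and b :: "'l \<Rightarrow> 't \<Rightarrow> 't \<Rightarrow> 'b"
    and form :: "'l \<Rightarrow> 't \<Rightarrow> 't \<Rightarrow> 'k"
  assumes finite_index: "finite (Sigma \<Lambda> T)"
    and b_closed: "\<lbrakk>l \<in> \<Lambda>; s \<in> T l; t \<in> T l\<rbrakk> \<Longrightarrow> b l s t \<in> carrier B"
    and form_closed: "\<lbrakk>l \<in> \<Lambda>; s \<in> T l; t \<in> T l\<rbrakk> \<Longrightarrow> form l s t \<in> carrier K"
    and b_mult: "\<lbrakk>l \<in> \<Lambda>; s \<in> T l; t \<in> T l; u \<in> T l; v \<in> T l\<rbrakk>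
      \<Longrightarrow> b l s t \<otimes>\<^bsub>B\<^esub> b l u v = form l t u \<odot>\<^bsub>B\<^esub> b l s v"
    and b_orthogonal: "\<lbrakk>l \<in> \<Lambda>; s \<in> T l; t \<in> T l; m \<in> \<Lambda>; u \<in> T m; v \<in> T m; l \<noteq> m\<rbrakk>
      \<Longrightarrow> b l s t \<otimes>\<^bsub>B\<^esub> b m u v = \<zero>\<^bsub>B\<^esub>"
    and b_spans: "carrier B = linear_hull K B {b l s t | l s t. l \<in> \<Lambda> \<and> s \<in> T l \<and> t \<in> T l}"
begin

text \<open>
  For a single index \<open>(l, s)\<close> this is the right ideal with generators \<open>b l s t\<close>, an image of the cell
  module of \<open>l\<close>.
\<close>

definition row_span :: "('l \<times> 't) set \<Rightarrow> 'b set"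
  where "row_span J = linear_hull K B {b l s t | l s t. (l, s) \<in> J \<and> t \<in> T l}"

lemma row_gens_closed: "J \<subseteq> Sigma \<Lambda> T \<Longrightarrow> {b l s t | l s t. (l, s) \<in> J \<and> t \<in> T l} \<subseteq> carrier B"
  by (auto intro!: b_closed)

lemma spanning_induct [consumes 1, case_names zero step]:
  assumes "z \<in> carrier B" "P \<zero>\<^bsub>B\<^esub>"
    and "\<And>k l s t x. \<lbrakk>k \<in> carrier K; l \<in> \<Lambda>; s \<in> T l; t \<in> T l; x \<in> carrier B; P x\<rbrakk>
      \<Longrightarrow> P (k \<odot>\<^bsub>B\<^esub> b l s t \<oplus>\<^bsub>B\<^esub> x)"
  shows "P z"
proof -
  have "z \<in> linear_hull K B {b l s t | l s t. l \<in> \<Lambda> \<and> s \<in> T l \<and> t \<in> T l}"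
    using assms(1) b_spans by simp
  then show ?thesis
    by induction (use assms b_spans in auto)
qed

text \<open>
  The unit is a linear combination of the \<open>b l s t\<close>, so they cannot all annihilate a nonzero vector.
  In the proofs below this supplies the nonzero values of \<open>form\<close>.
\<close>

lemma faithful:
  assumes "right_module B V act" "w \<in> carrier V" "w \<noteq> \<zero>\<^bsub>V\<^esub>"
  obtains l s t where "l \<in> \<Lambda>" "s \<in> T l" "t \<in> T l" "act w (b l s t) \<noteq> \<zero>\<^bsub>V\<^esub>"
proof -
  interpret V: right_module B V act by fact
  { assume *: "\<And>l s t. l \<in> \<Lambda> \<Longrightarrow> s \<in> T l \<Longrightarrow> t \<in> T l \<Longrightarrow> act w (b l s t) = \<zero>\<^bsub>V\<^esub>"
    have "act w z = \<zero>\<^bsub>V\<^esub>" if "z \<in> carrier B" for z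
      using that
    proof (induction rule: spanning_induct)
      case (step k l s t x)
      have "act w (k \<odot>\<^bsub>B\<^esub> b l s t) = \<zero>\<^bsub>V\<^esub>"
        using step * assms b_closed
        by (subst smult_as_mult) (auto simp: V.act_mult)
      then show ?case using step assms b_closed by (simp add: V.act_add_right)
    qed (simp add: assms)
    then have "w = \<zero>\<^bsub>V\<^esub>" using V.act_one assms by (metis A.one_closed)
    with assms have False by simp }
  then show ?thesis using that by blast
qed

lemma row_span_right_ideal:
  assumes "J \<subseteq> Sigma \<Lambda> T" "x \<in> row_span J" "y \<in> carrier B"
  shows "x \<otimes>\<^bsub>B\<^esub> y \<in> row_span J"
  unfolding row_span_def
proof (rule hull_mult_right[OF assms(2)[unfolded row_span_def]])
  fix g assume "g \<in> {b l s t | l s t. (l, s) \<in> J \<and> t \<in> T l}"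
  then obtain l s t where g: "g = b l s t" "(l, s) \<in> J" "t \<in> T l" "l \<in> \<Lambda>" "s \<in> T l"
    using assms by auto
  show "g \<otimes>\<^bsub>B\<^esub> y \<in> linear_hull K B {b l s t | l s t. (l, s) \<in> J \<and> t \<in> T l}"
  proof (rule hull_mult_left)
    show "y \<in> linear_hull K B {b l s t | l s t. l \<in> \<Lambda> \<and> s \<in> T l \<and> t \<in> T l}"
      using assms b_spans by simp
    fix h assume "h \<in> {b l s t | l s t. l \<in> \<Lambda> \<and> s \<in> T l \<and> t \<in> T l}"
    then obtain m u v where h: "h = b m u v" "m \<in> \<Lambda>" "u \<in> T m" "v \<in> T m" by auto
    show "g \<otimes>\<^bsub>B\<^esub> h \<in> linear_hull K B {b l s t | l s t. (l, s) \<in> J \<and> t \<in> T l}"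
    proof (cases "l = m")
      case True
      have "b l s v \<in> linear_hull K B {b l s t | l s t. (l, s) \<in> J \<and> t \<in> T l}"
        using g h True row_gens_closed[OF assms(1)] by (intro hull_base) auto
      then show ?thesis using g h True b_mult[of l s t u v] row_gens_closed[OF assms(1)]
        by (simp add: hull_smult form_closed)
    next
      case False
      then show ?thesis using g h b_orthogonal by (simp add: linear_hull.zero)
    qed
  qed (use g row_gens_closed[OF assms(1)] b_closed in auto)
qed (use assms row_gens_closed[OF assms(1)] in auto)

text \<open>
  Every row is zero or a simple right ideal.  For \<open>y\<close> in the row \<open>(l, s)\<close>, the product of \<open>y\<close> with
  \<open>b l u v\<close> is \<open>k \<odot> b l s v\<close> with \<open>k\<close> depending on \<open>u\<close> alone; if \<open>y\<close> is not zero, then \<open>k\<close> is not zero for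
  some \<open>u\<close>, and \<open>y\<close> generates the whole row.
\<close>

lemma row_generated:
  assumes "l \<in> \<Lambda>" "s \<in> T l" "y \<in> row_span {(l, s)}" "y \<noteq> \<zero>\<^bsub>B\<^esub>" "v \<in> T l"
  shows "\<exists>z\<in>carrier B. b l s v = y \<otimes>\<^bsub>B\<^esub> z"
proof -
  have gens: "{b l' s' t | l' s' t. (l', s') \<in> {(l, s)} \<and> t \<in> T l'} \<subseteq> carrier B"
    using assms by (intro row_gens_closed) auto
  have y: "y \<in> carrier B"
    using assms(3) gens hull_closed unfolding row_span_def by blast
  have scal: "\<exists>k\<in>carrier K. \<forall>v\<in>T l. y \<otimes>\<^bsub>B\<^esub> b l u v = k \<odot>\<^bsub>B\<^esub> b l s v" if "u \<in> T l" for u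
    using assms(3) unfolding row_span_def
  proof (induction rule: linear_hull.induct)
    case zero
    then show ?case using assms that b_closed by (intro bexI[of _ "\<zero>\<^bsub>K\<^esub>"]) auto
  next
    case (step g r x)
    then obtain t k where g: "g = b l s t" "t \<in> T l"
      and k: "k \<in> carrier K" "\<And>v. v \<in> T l \<Longrightarrow> x \<otimes>\<^bsub>B\<^esub> b l u v = k \<odot>\<^bsub>B\<^esub> b l s v" by auto
    have x: "x \<in> carrier B" using step hull_closed gens by blast
    have "(r \<odot>\<^bsub>B\<^esub> g \<oplus>\<^bsub>B\<^esub> x) \<otimes>\<^bsub>B\<^esub> b l u v = (r \<otimes>\<^bsub>K\<^esub> form l t u \<oplus>\<^bsub>K\<^esub> k) \<odot>\<^bsub>B\<^esub> b l s v"
      if "v \<in> T l" for v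
      using that \<open>u \<in> T l\<close> g k x step assms
      by (simp add: A.l_distr smult_mult_left b_closed b_mult form_closed smult_l_distr smult_assoc1)
    then show ?case using g k step assms that
      by (intro bexI[of _ "r \<otimes>\<^bsub>K\<^esub> form l t u \<oplus>\<^bsub>K\<^esub> k"]) (auto simp: form_closed)
  qed
  obtain m u w where m: "m \<in> \<Lambda>" "u \<in> T m" "w \<in> T m" "y \<otimes>\<^bsub>B\<^esub> b m u w \<noteq> \<zero>\<^bsub>B\<^esub>"
    using faithful[OF regular_right_module y assms(4)] by metis
  have "y \<otimes>\<^bsub>B\<^esub> b m u w = \<zero>\<^bsub>B\<^esub>" if "m \<noteq> l"
    using assms(3) unfolding row_span_def
  proof (induction rule: linear_hull.induct)
    case zero
    then show ?case using m b_closed by simp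
  next
    case (step g r x)
    then obtain t where g: "g = b l s t" "t \<in> T l" by auto
    have x: "x \<in> carrier B" using step hull_closed gens by blast
    have "g \<otimes>\<^bsub>B\<^esub> b m u w = \<zero>\<^bsub>B\<^esub>" using b_orthogonal[of l s t m u w] g m assms that by auto
    then show ?case
      using g x step m assms b_closed by (simp add: A.l_distr smult_mult_left)
  qed
  with m have [simp]: "m = l" by blast
  obtain k where k: "k \<in> carrier K" "\<And>v. v \<in> T l \<Longrightarrow> y \<otimes>\<^bsub>B\<^esub> b l u v = k \<odot>\<^bsub>B\<^esub> b l s v"
    using scal[of u] m by auto
  have "k \<noteq> \<zero>\<^bsub>K\<^esub>" using k(2)[of w] m assms b_closed by auto
  then have inv: "inv\<^bsub>K\<^esub> k \<in> carrier K" "inv\<^bsub>K\<^esub> k \<otimes>\<^bsub>K\<^esub> k = \<one>\<^bsub>K\<^esub>"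
    using k(1) K.field_Units by auto
  have "y \<otimes>\<^bsub>B\<^esub> (inv\<^bsub>K\<^esub> k \<odot>\<^bsub>B\<^esub> b l u v) = (inv\<^bsub>K\<^esub> k \<otimes>\<^bsub>K\<^esub> k) \<odot>\<^bsub>B\<^esub> b l s v"
    using inv(1) k assms m y b_closed by (simp add: smult_mult_right smult_assoc1)
  then show ?thesis
    using inv assms m b_closed by (intro bexI[of _ "inv\<^bsub>K\<^esub> k \<odot>\<^bsub>B\<^esub> b l u v"]) auto
qed

lemma row_span_submodule:
  assumes "J \<subseteq> Sigma \<Lambda> T"
  shows "right_submodule B B (monoid.mult B) (row_span J)"
proof -
  note gens = row_gens_closed[OF assms]
  have "additive_subgroup (row_span J) B"
    unfolding row_span_def
  proof (rule additive_subgroup.intro, rule M.add.subgroupI)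
    show "linear_hull K B {b l s t |l s t. (l, s) \<in> J \<and> t \<in> T l} \<noteq> {}"
      using linear_hull.zero by blast
  qed (use gens in \<open>auto simp: a_inv_def[symmetric] intro: hull_closed hull_neg hull_add\<close>)
  then show ?thesis
    using row_span_right_ideal[OF assms] by (auto simp: right_submodule_def)
qed

lemma row_span_insert:
  assumes "insert p J \<subseteq> Sigma \<Lambda> T" "z \<in> row_span (insert p J)"
  shows "\<exists>x\<in>row_span J. \<exists>y\<in>row_span {p}. z = x \<oplus>\<^bsub>B\<^esub> y"
  using assms(2) unfolding row_span_def
proof (induction rule: linear_hull.induct)
  case zero
  then show ?case by (intro bexI[of _ "\<zero>\<^bsub>B\<^esub>"]) (auto intro: linear_hull.zero)
next
  case (step g r z)
  then obtain l s t where g: "g = b l s t" "(l, s) \<in> insert p J" "t \<in> T l" by auto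
  let ?G = "\<lambda>J. {b l s t |l s t. (l, s) \<in> J \<and> t \<in> T l}"
  obtain x y where xy: "x \<in> linear_hull K B (?G J)" "y \<in> linear_hull K B (?G {p})" "z = x \<oplus>\<^bsub>B\<^esub> y"
    using step.IH by auto
  have c: "?G J \<subseteq> carrier B" "?G {p} \<subseteq> carrier B"
    using row_gens_closed[of J] row_gens_closed[of "{p}"] assms(1) by auto
  have x: "x \<in> carrier B" and y: "y \<in> carrier B" and gB: "r \<odot>\<^bsub>B\<^esub> g \<in> carrier B"
    using xy c hull_closed step g assms(1) b_closed by blast+
  show ?case
  proof (cases "(l, s) = p")
    case True
    have "r \<odot>\<^bsub>B\<^esub> g \<oplus>\<^bsub>B\<^esub> z = x \<oplus>\<^bsub>B\<^esub> (r \<odot>\<^bsub>B\<^esub> g \<oplus>\<^bsub>B\<^esub> y)"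
      using xy x y gB by (simp add: M.a_ac)
    moreover have "r \<odot>\<^bsub>B\<^esub> g \<oplus>\<^bsub>B\<^esub> y \<in> linear_hull K B (?G {p})"
      using True g xy step by (intro linear_hull.step) auto
    ultimately show ?thesis using xy by blast
  next
    case False
    have "r \<odot>\<^bsub>B\<^esub> g \<oplus>\<^bsub>B\<^esub> z = (r \<odot>\<^bsub>B\<^esub> g \<oplus>\<^bsub>B\<^esub> x) \<oplus>\<^bsub>B\<^esub> y"
      using xy x y gB by (simp add: M.a_ac)
    moreover have "r \<odot>\<^bsub>B\<^esub> g \<oplus>\<^bsub>B\<^esub> x \<in> linear_hull K B (?G J)"
      using False g xy step by (intro linear_hull.step) auto
    ultimately show ?thesis using xy by blast
  qed
qed

text \<open>
  The regular module is a finite sum of rows, each simple or zero.  A complement of \<open>N\<close> is the sum of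
  a maximal family of rows with the property that this sum meets \<open>N\<close> in zero.  A row that is not
  contained in \<open>N\<close> plus the sum would meet it in zero, and could be added to the family.
\<close>

lemma semisimple: "semisimple_ring B"
  unfolding semisimple_ring_def semisimple_right_module_def
proof (intro conjI allI impI)
  show "right_module B B (monoid.mult B)" by (rule regular_right_module)
  fix N assume N: "right_submodule B B (monoid.mult B) N"
  interpret N: additive_subgroup N B using N by (simp add: right_submodule_def)
  have N_mult: "x \<otimes>\<^bsub>B\<^esub> y \<in> N" if "x \<in> N" "y \<in> carrier B" for x y
    using N that by (auto simp: right_submodule_def)
  \<comment> \<open>The families of rows whose sum meets \<open>N\<close> trivially.\<close>
  define \<J> where "\<J> = {J. J \<subseteq> Sigma \<Lambda> T \<and> N \<inter> row_span J = {\<zero>\<^bsub>B\<^esub>}}"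
  have "row_span {} = {\<zero>\<^bsub>B\<^esub>}"
    unfolding row_span_def by (auto elim: linear_hull.cases intro: linear_hull.zero)
  then have "{} \<in> \<J>" by (auto simp: \<J>_def)
  moreover have "finite \<J>" unfolding \<J>_def using finite_index by auto
  ultimately obtain J where J: "J \<in> \<J>" and max: "\<And>J'. J' \<in> \<J> \<Longrightarrow> J \<subseteq> J' \<Longrightarrow> J' = J"
    using finite_has_maximal[of \<J>] by blast
  have JI: "J \<subseteq> Sigma \<Lambda> T" and J0: "N \<inter> row_span J = {\<zero>\<^bsub>B\<^esub>}" using J by (auto simp: \<J>_def)
  note sub = row_span_submodule[OF JI]
  interpret P: additive_subgroup "row_span J" B using sub by (simp add: right_submodule_def)
  define S where "S = N <+>\<^bsub>B\<^esub> row_span J"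
  have S_eq: "S = {x \<oplus>\<^bsub>B\<^esub> y | x y. x \<in> N \<and> y \<in> row_span J}"
    unfolding S_def set_add_def' by auto
  have S_I: "x \<oplus>\<^bsub>B\<^esub> y \<in> S" if "x \<in> N" "y \<in> row_span J" for x y
    using that S_eq by auto
  have S_mult: "x \<otimes>\<^bsub>B\<^esub> y \<in> S" if "x \<in> S" "y \<in> carrier B" for x y
  proof -
    obtain n p where np: "n \<in> N" "p \<in> row_span J" "x = n \<oplus>\<^bsub>B\<^esub> p" using \<open>x \<in> S\<close> S_eq by auto
    have "x \<otimes>\<^bsub>B\<^esub> y = n \<otimes>\<^bsub>B\<^esub> y \<oplus>\<^bsub>B\<^esub> p \<otimes>\<^bsub>B\<^esub> y"
      using np that by (simp add: A.l_distr)
    then show ?thesis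
      using S_I[OF N_mult row_span_right_ideal[OF JI]] np that by simp
  qed
  have gen: "b l s t \<in> S" if lst: "l \<in> \<Lambda>" "s \<in> T l" "t \<in> T l" for l s t
  proof (cases "\<exists>y\<in>S. y \<in> row_span {(l, s)} \<and> y \<noteq> \<zero>\<^bsub>B\<^esub>")
    case True
    then show ?thesis using row_generated lst S_mult by metis
  next
    case False
    have I: "insert (l, s) J \<subseteq> Sigma \<Lambda> T" using JI lst by auto
    have "n = \<zero>\<^bsub>B\<^esub>" if n: "n \<in> N" "n \<in> row_span (insert (l, s) J)" for n
    proof -
      obtain x y where xy: "x \<in> row_span J" "y \<in> row_span {(l, s)}" "n = x \<oplus>\<^bsub>B\<^esub> y"
        using row_span_insert[OF I n(2)] by auto
      have yB: "y \<in> carrier B"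
        using xy(2) row_gens_closed[of "{(l, s)}"] I hull_closed unfolding row_span_def by blast
      have "y = n \<oplus>\<^bsub>B\<^esub> (\<ominus>\<^bsub>B\<^esub> x)"
        using xy yB by (simp add: M.a_comm[of x y] M.a_assoc M.r_neg)
      then have "y \<in> S" using S_I[OF n(1) P.a_inv_closed[OF xy(1)]] by simp
      then have "y = \<zero>\<^bsub>B\<^esub>" using False xy by blast
      then have "n = x" using xy by simp
      then show ?thesis using n xy J0 by blast
    qed
    moreover have "\<zero>\<^bsub>B\<^esub> \<in> row_span (insert (l, s) J)" unfolding row_span_def by (rule linear_hull.zero)
    ultimately have "insert (l, s) J \<in> \<J>" using I by (auto simp: \<J>_def)
    then have "insert (l, s) J = J" using max by blast
    then have "b l s t \<in> row_span J"
      unfolding row_span_def using lst row_gens_closed[OF JI] by (intro hull_base) auto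
    moreover have "b l s t = \<zero>\<^bsub>B\<^esub> \<oplus>\<^bsub>B\<^esub> b l s t" using lst b_closed by simp
    ultimately show ?thesis using S_I[OF N.zero_closed] by metis
  qed
  have "z \<in> S" if "z \<in> carrier B" for z
    using that
  proof (induction rule: spanning_induct)
    case zero
    show ?case using S_I[OF N.zero_closed P.zero_closed] by simp
  next
    case (step k l s t x)
    have "k \<odot>\<^bsub>B\<^esub> b l s t \<in> S"
      using step S_mult[OF gen] b_closed by (subst smult_as_mult) auto
    then obtain n p where np: "n \<in> N" "p \<in> row_span J" "k \<odot>\<^bsub>B\<^esub> b l s t = n \<oplus>\<^bsub>B\<^esub> p"
      using S_eq by auto
    obtain n' p' where np': "n' \<in> N" "p' \<in> row_span J" "x = n' \<oplus>\<^bsub>B\<^esub> p'"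
      using S_eq step by auto
    have "k \<odot>\<^bsub>B\<^esub> b l s t \<oplus>\<^bsub>B\<^esub> x = (n \<oplus>\<^bsub>B\<^esub> n') \<oplus>\<^bsub>B\<^esub> (p \<oplus>\<^bsub>B\<^esub> p')"
      using np np' by (simp add: M.a_ac)
    then show ?case using S_I np np' by simp
  qed
  moreover have "S \<subseteq> carrier B" using S_eq by auto
  ultimately have "S = carrier B" by blast
  then show "\<exists>N'. right_submodule B B (monoid.mult B) N' \<and> N \<inter> N' = {\<zero>\<^bsub>B\<^esub>} \<and> N <+>\<^bsub>B\<^esub> N' = carrier B"
    using sub J0 S_def by blast
qed

text \<open>
  A suitable multiple \<open>e\<close> of some \<open>b l p u\<close> satisfies \<open>e z e = k e\<close> with \<open>k\<close> a scalar, for all \<open>z\<close>, and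
  fixes a nonzero vector \<open>x\<close> of the simple module.  An endomorphism sends \<open>x\<close> to some \<open>x z\<close>, and
  therefore to \<open>x e z e = k x\<close>; as \<open>x\<close> generates the module, the endomorphism is the scalar \<open>k\<close>.
\<close>

lemma split: "split_algebra K B TYPE('v)"
  unfolding split_algebra_def
proof (intro allI impI ballI)
  fix V :: "'v ring" and act f
  assume simple: "simple_right_module B V act" and f: "f \<in> module_endomorphisms B V act"
  interpret V: right_module B V act using simple by (simp add: simple_right_module_def)
  have f_act: "f (act v x) = act (f v) x" if "v \<in> carrier V" "x \<in> carrier B" for v x
    using f that by (auto simp: module_endomorphisms_def)
  have f_closed: "f v \<in> carrier V" if "v \<in> carrier V" for v
    using f that by (auto simp: module_endomorphisms_def)
  obtain w where w: "w \<in> carrier V" "w \<noteq> \<zero>\<^bsub>V\<^esub>"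
    using simple V.zero_closed by (auto simp: simple_right_module_def)
  obtain l s u where lsu: "l \<in> \<Lambda>" "s \<in> T l" "u \<in> T l" and nz: "act w (b l s u) \<noteq> \<zero>\<^bsub>V\<^esub>"
    using faithful[OF V.right_module_axioms w] by metis
  define x where "x = act w (b l s u)"
  have x: "x \<in> carrier V" "x \<noteq> \<zero>\<^bsub>V\<^esub>" using nz w lsu V.act_closed b_closed by (auto simp: x_def)
  obtain m p q where mpq: "m \<in> \<Lambda>" "p \<in> T m" "q \<in> T m" and nz': "act x (b m p q) \<noteq> \<zero>\<^bsub>V\<^esub>"
    using faithful[OF V.right_module_axioms x] by metis
  have eq: "act x (b m p q) = act w (b l s u \<otimes>\<^bsub>B\<^esub> b m p q)"
    using w lsu mpq b_closed by (simp add: x_def V.act_mult)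
  have [simp]: "m = l"
    using nz' eq b_orthogonal[of l s u m p q] lsu mpq w by fastforce
  have pl: "p \<in> T l" "q \<in> T l" using mpq by auto
  define r where "r = form l u p"
  have r: "r \<in> carrier K" "r \<noteq> \<zero>\<^bsub>K\<^esub>"
    using nz' eq lsu pl w b_closed by (auto simp: r_def form_closed b_mult)
  then have inv: "inv\<^bsub>K\<^esub> r \<in> carrier K" "inv\<^bsub>K\<^esub> r \<otimes>\<^bsub>K\<^esub> r = \<one>\<^bsub>K\<^esub>"
    using K.field_Units by auto
  define e where "e = inv\<^bsub>K\<^esub> r \<odot>\<^bsub>B\<^esub> b l p u"
  have e: "e \<in> carrier B" using inv lsu pl b_closed by (simp add: e_def)
  have "b l s u \<otimes>\<^bsub>B\<^esub> e = (inv\<^bsub>K\<^esub> r \<otimes>\<^bsub>K\<^esub> r) \<odot>\<^bsub>B\<^esub> b l s u"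
    using inv r lsu pl b_closed
    by (simp add: e_def smult_mult_right b_mult flip: r_def smult_assoc1)
  then have xe: "act x e = x"
    using w lsu e b_closed inv by (simp add: x_def flip: V.act_mult)
  have "\<exists>k\<in>carrier K. b l p u \<otimes>\<^bsub>B\<^esub> z \<otimes>\<^bsub>B\<^esub> b l p u = k \<odot>\<^bsub>B\<^esub> b l p u" if "z \<in> carrier B" for z
    using that
  proof (induction rule: spanning_induct)
    case zero
    then show ?case using lsu pl b_closed by (intro bexI[of _ "\<zero>\<^bsub>K\<^esub>"]) auto
  next
    case (step k m v v' y)
    then obtain k' where k': "k' \<in> carrier K" "b l p u \<otimes>\<^bsub>B\<^esub> y \<otimes>\<^bsub>B\<^esub> b l p u = k' \<odot>\<^bsub>B\<^esub> b l p u" by auto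
    have "\<exists>k\<in>carrier K. b l p u \<otimes>\<^bsub>B\<^esub> b m v v' \<otimes>\<^bsub>B\<^esub> b l p u = k \<odot>\<^bsub>B\<^esub> b l p u"
    proof (cases "m = l")
      case True
      then have "b l p u \<otimes>\<^bsub>B\<^esub> b m v v' \<otimes>\<^bsub>B\<^esub> b l p u = (form l u v \<otimes>\<^bsub>K\<^esub> form l v' p) \<odot>\<^bsub>B\<^esub> b l p u"
        using step lsu pl
        by (simp add: b_mult b_closed form_closed smult_mult_left smult_assoc1)
      then show ?thesis using True step lsu pl form_closed
        by (intro bexI[of _ "form l u v \<otimes>\<^bsub>K\<^esub> form l v' p"]) auto
    next
      case False
      then have "b l p u \<otimes>\<^bsub>B\<^esub> b m v v' = \<zero>\<^bsub>B\<^esub>" using b_orthogonal step lsu pl by metis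
      then show ?thesis using lsu pl b_closed by (intro bexI[of _ "\<zero>\<^bsub>K\<^esub>"]) auto
    qed
    then obtain k'' where k'': "k'' \<in> carrier K"
      "b l p u \<otimes>\<^bsub>B\<^esub> b m v v' \<otimes>\<^bsub>B\<^esub> b l p u = k'' \<odot>\<^bsub>B\<^esub> b l p u" by auto
    have "b l p u \<otimes>\<^bsub>B\<^esub> (k \<odot>\<^bsub>B\<^esub> b m v v' \<oplus>\<^bsub>B\<^esub> y) \<otimes>\<^bsub>B\<^esub> b l p u
        = (k \<otimes>\<^bsub>K\<^esub> k'' \<oplus>\<^bsub>K\<^esub> k') \<odot>\<^bsub>B\<^esub> b l p u"
      using step lsu pl k' k'' b_closed
      by (simp add: A.r_distr A.l_distr smult_mult_right smult_mult_left smult_l_distr smult_assoc1)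
    then show ?case using step k' k'' by (intro bexI[of _ "k \<otimes>\<^bsub>K\<^esub> k'' \<oplus>\<^bsub>K\<^esub> k'"]) auto
  qed note corner = this
  have corner: "\<exists>k\<in>carrier K. e \<otimes>\<^bsub>B\<^esub> z \<otimes>\<^bsub>B\<^esub> e = k \<odot>\<^bsub>B\<^esub> e" if z: "z \<in> carrier B" for z
  proof -
    obtain k where k: "k \<in> carrier K" "b l p u \<otimes>\<^bsub>B\<^esub> z \<otimes>\<^bsub>B\<^esub> b l p u = k \<odot>\<^bsub>B\<^esub> b l p u"
      using corner[OF z] by auto
    have "e \<otimes>\<^bsub>B\<^esub> z \<otimes>\<^bsub>B\<^esub> e = (inv\<^bsub>K\<^esub> r \<otimes>\<^bsub>K\<^esub> k) \<odot>\<^bsub>B\<^esub> e"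
      using k z inv lsu pl b_closed
      by (simp add: e_def smult_mult_right smult_mult_left K.m_ac flip: smult_assoc1)
    then show ?thesis using k inv by (intro bexI[of _ "inv\<^bsub>K\<^esub> r \<otimes>\<^bsub>K\<^esub> k"]) auto
  qed
  have gen: "carrier V = act x ` carrier B"
    using V.simple_generated[OF simple x] by simp
  then obtain z where z: "z \<in> carrier B" "f x = act x z" using f_closed x by auto
  obtain k where k: "k \<in> carrier K" "e \<otimes>\<^bsub>B\<^esub> z \<otimes>\<^bsub>B\<^esub> e = k \<odot>\<^bsub>B\<^esub> e" using corner z by auto
  have k1: "k \<odot>\<^bsub>B\<^esub> \<one>\<^bsub>B\<^esub> \<in> carrier B" using k by simp
  have "f x = act (f x) e" using f_act[OF x(1) e] xe by simp
  also have "\<dots> = act x (e \<otimes>\<^bsub>B\<^esub> z \<otimes>\<^bsub>B\<^esub> e)" using x e z xe by (simp add: V.act_mult V.act_closed)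
  also have "\<dots> = act x (e \<otimes>\<^bsub>B\<^esub> (k \<odot>\<^bsub>B\<^esub> \<one>\<^bsub>B\<^esub>))" using k smult_as_mult[OF _ e] by simp
  also have "\<dots> = act x (k \<odot>\<^bsub>B\<^esub> \<one>\<^bsub>B\<^esub>)" using x e k1 xe by (simp add: V.act_mult)
  finally have fx: "f x = act x (k \<odot>\<^bsub>B\<^esub> \<one>\<^bsub>B\<^esub>)" .
  have "f v = act v (k \<odot>\<^bsub>B\<^esub> \<one>\<^bsub>B\<^esub>)" if "v \<in> carrier V" for v
  proof -
    have "v \<in> act x ` carrier B" using that gen by (rule subst[rotated])
    then obtain y where y: "y \<in> carrier B" "v = act x y" by blast
    have "f v = act x ((k \<odot>\<^bsub>B\<^esub> \<one>\<^bsub>B\<^esub>) \<otimes>\<^bsub>B\<^esub> y)"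
      using y x k1 f_act[OF x(1)] fx by (simp add: V.act_mult)
    also have "(k \<odot>\<^bsub>B\<^esub> \<one>\<^bsub>B\<^esub>) \<otimes>\<^bsub>B\<^esub> y = y \<otimes>\<^bsub>B\<^esub> (k \<odot>\<^bsub>B\<^esub> \<one>\<^bsub>B\<^esub>)"
      using y k by (simp add: smult_mult_left smult_mult_right)
    finally show ?thesis using y x k1 by (simp add: V.act_mult)
  qed
  then show "\<exists>c\<in>carrier K. \<forall>v\<in>carrier V. f v = act v (c \<odot>\<^bsub>B\<^esub> \<one>\<^bsub>B\<^esub>)" using k by blast
qed

lemma split_semisimple: "split_semisimple_algebra K B TYPE('v)"
  unfolding split_semisimple_algebra_def
  using unital_algebra_axioms semisimple split by blast

end

section \<open>Filtrations by cells with identity elements\<close>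

text \<open>
  Elements are added one at a time, larger ones first.  This serves to descend through the ideals
  of the filtration, and with the reversed order of tableaux to climb through the cells below a
  given one.
\<close>

lemma finite_upset_induct [consumes 3, case_names empty insert]:
  assumes "finite F" "irreflp_on F gt" "transp_on F gt"
    and "P {}"
    and "\<And>U l. \<lbrakk>U \<subseteq> F; \<And>m n. \<lbrakk>m \<in> U; n \<in> F; gt n m\<rbrakk> \<Longrightarrow> n \<in> U; l \<in> F; l \<notin> U;
      \<And>m. \<lbrakk>m \<in> F; gt m l\<rbrakk> \<Longrightarrow> m \<in> U; P U\<rbrakk> \<Longrightarrow> P (insert l U)"
  shows "P F"
  using assms
proof (induction F rule: finite_psubset_induct)
  case (psubset F)
  show ?case
  proof (cases "F = {}")
    case True
    then show ?thesis using psubset.prems(3) by simp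
  next
    case False
    note irrefl = psubset.prems(1) and trans = psubset.prems(2)
    have "asymp_on F (\<lambda>x y. gt y x)"
    proof (rule asymp_onI)
      fix x y assume "x \<in> F" "y \<in> F" "gt y x"
      then show "\<not> gt x y" using transp_onD[OF trans, of x y x] irreflp_onD[OF irrefl, of x] by blast
    qed
    moreover have "transp_on F (\<lambda>x y. gt y x)"
      using transp_onD[OF trans] by (blast intro: transp_onI)
    ultimately obtain l where l: "l \<in> F" "\<And>m. m \<in> F \<Longrightarrow> m \<noteq> l \<Longrightarrow> \<not> gt l m"
      using Finite_Set.bex_min_element[of F "\<lambda>x y. gt y x", OF psubset.hyps(1) _ _ False] by blast
    have nl: "\<not> gt l m" if "m \<in> F" for m
      using l that irreflp_onD[OF irrefl, of l] by blast
    have "P (F - {l})"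
    proof (rule psubset.IH)
      show "irreflp_on (F - {l}) gt" "transp_on (F - {l}) gt"
        using irrefl trans by (auto intro: irreflp_on_subset transp_on_subset)
      fix U k
      assume U: "U \<subseteq> F - {l}" and up: "\<And>m n. \<lbrakk>m \<in> U; n \<in> F - {l}; gt n m\<rbrakk> \<Longrightarrow> n \<in> U"
        and k: "k \<in> F - {l}" "k \<notin> U" "\<And>m. \<lbrakk>m \<in> F - {l}; gt m k\<rbrakk> \<Longrightarrow> m \<in> U" "P U"
      show "P (insert k U)"
      proof (rule psubset.prems(4))
        show "\<And>m n. \<lbrakk>m \<in> U; n \<in> F; gt n m\<rbrakk> \<Longrightarrow> n \<in> U" using up U nl by blast
        show "\<And>m. \<lbrakk>m \<in> F; gt m k\<rbrakk> \<Longrightarrow> m \<in> U" using k nl by blast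
      qed (use U k in auto)
    qed (use l psubset.prems(3) in auto)
    then have "P (insert l (F - {l}))"
    proof (rule psubset.prems(4)[rotated 5])
      show "\<And>m n. \<lbrakk>m \<in> F - {l}; n \<in> F; gt n m\<rbrakk> \<Longrightarrow> n \<in> F - {l}" using nl by blast
      show "\<And>m. \<lbrakk>m \<in> F; gt m l\<rbrakk> \<Longrightarrow> m \<in> F - {l}" using nl by blast
    qed (use l in auto)
    then show ?thesis using l by (simp add: insert_absorb)
  qed
qed

lemma (in abelian_group) add_minus_cancel:
  assumes "x \<in> carrier G" "y \<in> carrier G"
  shows "y \<oplus> (x \<ominus> y) = x"
  using assms by (simp add: a_minus_def a_comm[of x "\<ominus> y"] r_neg2)

lemma (in abelian_group) add_minus_add_cancel:
  assumes "x \<in> carrier G" "y \<in> carrier G" "z \<in> carrier G"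
  shows "y \<oplus> (x \<oplus> z \<ominus> (y \<oplus> z)) = x"
proof -
  have "(y \<oplus> (x \<oplus> z \<ominus> (y \<oplus> z))) \<oplus> z = (y \<oplus> z) \<oplus> (x \<oplus> z \<ominus> (y \<oplus> z))"
    using assms by (simp add: a_ac)
  also have "\<dots> = x \<oplus> z" using assms by (intro add_minus_cancel) auto
  finally show ?thesis using assms by simp
qed

text \<open>
  The cells span an increasing family of subspaces \<open>cells U\<close>, for \<open>U\<close> a set of indices.  The conditions
  that make them ideals, and their layers unital, are added in a second locale since they are phrased
  in terms of \<open>cells\<close>.
\<close>

locale cell_filtration = K?: field K + unital_algebra K B
  for K :: "('k, 'x) ring_scheme" (structure) and B :: "('k, 'b, 'y) module_scheme" (structure) +
  fixes \<Lambda> :: "'l set" and gt :: "'l \<Rightarrow> 'l \<Rightarrow> bool" and T :: "'l \<Rightarrow> 't set"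
    and a :: "'l \<Rightarrow> 't \<Rightarrow> 't \<Rightarrow> 'b" and form :: "'l \<Rightarrow> 't \<Rightarrow> 't \<Rightarrow> 'k"
  assumes poset: "finite \<Lambda>" "irreflp_on \<Lambda> gt" "transp_on \<Lambda> gt"
    and finite_T: "l \<in> \<Lambda> \<Longrightarrow> finite (T l)"
    and a_closed: "\<lbrakk>l \<in> \<Lambda>; s \<in> T l; t \<in> T l\<rbrakk> \<Longrightarrow> a l s t \<in> carrier B"
    and form_closed: "\<lbrakk>l \<in> \<Lambda>; s \<in> T l; t \<in> T l\<rbrakk> \<Longrightarrow> form l s t \<in> carrier K"
begin

definition cells :: "'l set \<Rightarrow> 'b set"
  where "cells U = linear_hull K B {a l s t | l s t. l \<in> U \<and> s \<in> T l \<and> t \<in> T l}"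

definition above :: "'l \<Rightarrow> 'l set" where "above l = {m \<in> \<Lambda>. gt m l}"

definition upset :: "'l set \<Rightarrow> bool"
  where "upset U \<longleftrightarrow> U \<subseteq> \<Lambda> \<and> (\<forall>l\<in>U. above l \<subseteq> U)"

lemma upset_above: "l \<in> \<Lambda> \<Longrightarrow> upset (above l)"
  using transp_onD[OF poset(3)] unfolding upset_def above_def by blast

lemma gens_closed: "U \<subseteq> \<Lambda> \<Longrightarrow> {a l s t | l s t. l \<in> U \<and> s \<in> T l \<and> t \<in> T l} \<subseteq> carrier B"
  by (auto intro!: a_closed)

lemma cells_closed: "\<lbrakk>x \<in> cells U; U \<subseteq> \<Lambda>\<rbrakk> \<Longrightarrow> x \<in> carrier B"
  unfolding cells_def by (rule hull_closed[OF _ gens_closed])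

lemma cells_gen: "\<lbrakk>l \<in> U; s \<in> T l; t \<in> T l; U \<subseteq> \<Lambda>\<rbrakk> \<Longrightarrow> a l s t \<in> cells U"
  unfolding cells_def by (rule hull_base) (use gens_closed[of U] in auto)

lemma cells_add: "\<lbrakk>x \<in> cells U; y \<in> cells U; U \<subseteq> \<Lambda>\<rbrakk> \<Longrightarrow> x \<oplus>\<^bsub>B\<^esub> y \<in> cells U"
  unfolding cells_def by (rule hull_add) (use gens_closed[of U] in auto)

lemma cells_minus: "\<lbrakk>x \<in> cells U; y \<in> cells U; U \<subseteq> \<Lambda>\<rbrakk> \<Longrightarrow> x \<ominus>\<^bsub>B\<^esub> y \<in> cells U"
  unfolding cells_def by (rule hull_minus) (use gens_closed[of U] in auto)

lemma cells_smult: "\<lbrakk>x \<in> cells U; k \<in> carrier K; U \<subseteq> \<Lambda>\<rbrakk> \<Longrightarrow> k \<odot>\<^bsub>B\<^esub> x \<in> cells U"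
  unfolding cells_def by (rule hull_smult) (use gens_closed[of U] in auto)

lemma cells_mono: "\<lbrakk>x \<in> cells U; U \<subseteq> U'; U' \<subseteq> \<Lambda>\<rbrakk> \<Longrightarrow> x \<in> cells U'"
  unfolding cells_def
  by (rule subsetD[OF hull_mono[OF _ gens_closed[of U']]]) auto

lemma cells_induct [consumes 2, case_names zero step]:
  assumes "x \<in> cells U" "U \<subseteq> \<Lambda>" "P \<zero>\<^bsub>B\<^esub>"
    and "\<And>k l s t x. \<lbrakk>k \<in> carrier K; l \<in> U; s \<in> T l; t \<in> T l; x \<in> carrier B; P x\<rbrakk>
      \<Longrightarrow> P (k \<odot>\<^bsub>B\<^esub> a l s t \<oplus>\<^bsub>B\<^esub> x)"
  shows "P x"
  using assms(1) unfolding cells_def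
proof (induction rule: linear_hull.induct)
  case (step g r x)
  then show ?case using hull_closed[OF step(3) gens_closed[OF assms(2)]] assms(4) by auto
qed (rule assms)

end

locale nondegenerate_cell_filtration = cell_filtration K B \<Lambda> gt T a form
  for K :: "('k, 'x) ring_scheme" (structure) and B :: "('k, 'b, 'y) module_scheme" (structure)
    and \<Lambda> :: "'l set" and gt and T :: "'l \<Rightarrow> 't set" and a and form +
  assumes spans: "carrier B = cells \<Lambda>"
    and ideal_right: "\<lbrakk>l \<in> \<Lambda>; s \<in> T l; t \<in> T l; x \<in> carrier B\<rbrakk>
      \<Longrightarrow> a l s t \<otimes>\<^bsub>B\<^esub> x \<in> cells (insert l (above l))"
    and ideal_left: "\<lbrakk>l \<in> \<Lambda>; s \<in> T l; t \<in> T l; x \<in> carrier B\<rbrakk>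
      \<Longrightarrow> x \<otimes>\<^bsub>B\<^esub> a l s t \<in> cells (insert l (above l))"
    and mult: "\<lbrakk>l \<in> \<Lambda>; s \<in> T l; t \<in> T l; u \<in> T l; v \<in> T l\<rbrakk>
      \<Longrightarrow> a l s t \<otimes>\<^bsub>B\<^esub> a l u v \<ominus>\<^bsub>B\<^esub> form l t u \<odot>\<^bsub>B\<^esub> a l s v \<in> cells (above l)"
    and mult_distinct: "\<lbrakk>l \<in> \<Lambda>; s \<in> T l; t \<in> T l; m \<in> \<Lambda>; u \<in> T m; v \<in> T m; l \<noteq> m; \<not> gt l m\<rbrakk>
      \<Longrightarrow> a l s t \<otimes>\<^bsub>B\<^esub> a m u v \<in> cells (above l)"
    and left_identity: "l \<in> \<Lambda> \<Longrightarrow> \<exists>h\<in>cells (insert l (above l)). \<forall>s\<in>T l. \<forall>t\<in>T l.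
      h \<otimes>\<^bsub>B\<^esub> a l s t \<ominus>\<^bsub>B\<^esub> a l s t \<in> cells (above l)"
    and right_identity: "l \<in> \<Lambda> \<Longrightarrow> \<exists>h\<in>cells (insert l (above l)). \<forall>s\<in>T l. \<forall>t\<in>T l.
      a l s t \<otimes>\<^bsub>B\<^esub> h \<ominus>\<^bsub>B\<^esub> a l s t \<in> cells (above l)"
begin

lemma cells_ideal_right:
  assumes "upset U" "x \<in> cells U" "y \<in> carrier B"
  shows "x \<otimes>\<^bsub>B\<^esub> y \<in> cells U"
  unfolding cells_def
proof (rule hull_mult_right[OF assms(2)[unfolded cells_def]])
  fix g assume "g \<in> {a l s t |l s t. l \<in> U \<and> s \<in> T l \<and> t \<in> T l}"
  then obtain l s t where g: "g = a l s t" "l \<in> U" "s \<in> T l" "t \<in> T l" by auto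
  then have "g \<otimes>\<^bsub>B\<^esub> y \<in> cells (insert l (above l))"
    using assms ideal_right unfolding upset_def by blast
  moreover have "insert l (above l) \<subseteq> U" "U \<subseteq> \<Lambda>" using g assms unfolding upset_def by auto
  ultimately show "g \<otimes>\<^bsub>B\<^esub> y \<in> linear_hull K B {a l s t |l s t. l \<in> U \<and> s \<in> T l \<and> t \<in> T l}"
    using cells_mono cells_def by blast
qed (use assms gens_closed in \<open>auto simp: upset_def\<close>)

lemma cells_ideal_left:
  assumes "upset U" "x \<in> cells U" "y \<in> carrier B"
  shows "y \<otimes>\<^bsub>B\<^esub> x \<in> cells U"
  unfolding cells_def
proof (rule hull_mult_left[OF assms(2)[unfolded cells_def]])
  fix g assume "g \<in> {a l s t |l s t. l \<in> U \<and> s \<in> T l \<and> t \<in> T l}"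
  then obtain l s t where g: "g = a l s t" "l \<in> U" "s \<in> T l" "t \<in> T l" by auto
  then have "y \<otimes>\<^bsub>B\<^esub> g \<in> cells (insert l (above l))"
    using assms ideal_left unfolding upset_def by blast
  moreover have "insert l (above l) \<subseteq> U" "U \<subseteq> \<Lambda>" using g assms unfolding upset_def by auto
  ultimately show "y \<otimes>\<^bsub>B\<^esub> g \<in> linear_hull K B {a l s t |l s t. l \<in> U \<and> s \<in> T l \<and> t \<in> T l}"
    using cells_mono cells_def by blast
qed (use assms gens_closed in \<open>auto simp: upset_def\<close>)

definition identity_of :: "'l set \<Rightarrow> 'b \<Rightarrow> bool"
  where "identity_of U e \<longleftrightarrow> e \<in> cells U \<and> (\<forall>x\<in>cells U. e \<otimes>\<^bsub>B\<^esub> x = x \<and> x \<otimes>\<^bsub>B\<^esub> e = x)"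

lemma identity_closed: "\<lbrakk>identity_of U e; U \<subseteq> \<Lambda>\<rbrakk> \<Longrightarrow> e \<in> carrier B"
  unfolding identity_of_def using cells_closed by blast

text \<open>
  Both products lie in the ideal, so both are equal to \<open>e x e\<close>.
\<close>

lemma identity_central:
  assumes "identity_of U e" "upset U" "x \<in> carrier B"
  shows "e \<otimes>\<^bsub>B\<^esub> x = x \<otimes>\<^bsub>B\<^esub> e"
proof -
  have e: "e \<in> cells U" "e \<in> carrier B"
    using assms identity_closed unfolding identity_of_def upset_def by auto
  have "e \<otimes>\<^bsub>B\<^esub> x = e \<otimes>\<^bsub>B\<^esub> x \<otimes>\<^bsub>B\<^esub> e"
    using assms cells_ideal_right[OF assms(2) e(1) assms(3)] unfolding identity_of_def by simp
  also have "\<dots> = e \<otimes>\<^bsub>B\<^esub> (x \<otimes>\<^bsub>B\<^esub> e)" using e assms by (simp add: A.m_assoc)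
  also have "\<dots> = x \<otimes>\<^bsub>B\<^esub> e"
    using assms cells_ideal_left[OF assms(2) e(1) assms(3)] unfolding identity_of_def by simp
  finally show ?thesis .
qed

text \<open>
  If \<open>h\<close> is a left identity for the cell \<open>l\<close> modulo the ideal of \<open>U\<close>, and \<open>e\<close> is the identity of that
  ideal, then \<open>e + h (1 - e)\<close> is a left identity for the larger ideal.  In the same way there is a
  right identity, and the two agree.
\<close>

lemma identity_of_insert:
  assumes U: "upset U" and l: "l \<in> \<Lambda>" "l \<notin> U" "above l \<subseteq> U" and e: "identity_of U e"
  shows "\<exists>e'. identity_of (insert l U) e'"
proof -
  have U': "upset (insert l U)" "insert l U \<subseteq> \<Lambda>" "U \<subseteq> \<Lambda>" using U l unfolding upset_def by auto
  have sub: "insert l (above l) \<subseteq> insert l U" using l by auto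
  obtain h where h: "h \<in> cells (insert l (above l))"
    "\<And>s t. s \<in> T l \<Longrightarrow> t \<in> T l \<Longrightarrow> h \<otimes>\<^bsub>B\<^esub> a l s t \<ominus>\<^bsub>B\<^esub> a l s t \<in> cells (above l)"
    using left_identity[OF l(1)] by blast
  obtain h' where h': "h' \<in> cells (insert l (above l))"
    "\<And>s t. s \<in> T l \<Longrightarrow> t \<in> T l \<Longrightarrow> a l s t \<otimes>\<^bsub>B\<^esub> h' \<ominus>\<^bsub>B\<^esub> a l s t \<in> cells (above l)"
    using right_identity[OF l(1)] by blast
  have hU: "h \<in> cells (insert l U)" "h' \<in> cells (insert l U)"
    using h(1) h'(1) sub U'(2) cells_mono by blast+
  have eU: "e \<in> cells (insert l U)" using e U'(2) cells_mono[of e U] unfolding identity_of_def by blast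
  have B: "h \<in> carrier B" "h' \<in> carrier B" "e \<in> carrier B"
    using hU eU U'(2) cells_closed by blast+
  have e_left: "e \<otimes>\<^bsub>B\<^esub> x = x" and e_right: "x \<otimes>\<^bsub>B\<^esub> e = x" if "x \<in> cells U" for x
    using e that unfolding identity_of_def by auto
  \<comment> \<open>The left and right identities for the ideal of \<open>insert l U\<close>.\<close>
  define p where "p = e \<oplus>\<^bsub>B\<^esub> (h \<ominus>\<^bsub>B\<^esub> h \<otimes>\<^bsub>B\<^esub> e)"
  define q where "q = e \<oplus>\<^bsub>B\<^esub> (h' \<ominus>\<^bsub>B\<^esub> e \<otimes>\<^bsub>B\<^esub> h')"
  have pU: "p \<in> cells (insert l U)"
    unfolding p_def using hU eU U' B cells_ideal_right by (simp add: cells_add cells_minus)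
  have qU: "q \<in> cells (insert l U)"
    unfolding q_def using hU eU U' B cells_ideal_left by (simp add: cells_add cells_minus)
  have pq: "p \<in> carrier B" "q \<in> carrier B" using pU qU U' cells_closed by blast+
  have p_left: "p \<otimes>\<^bsub>B\<^esub> x = x" if "x \<in> cells (insert l U)" for x
    using that U'(2)
  proof (induction rule: cells_induct)
    case zero
    then show ?case using pq by simp
  next
    case (step k m s t x)
    have c: "a m s t \<in> carrier B" using step U' a_closed by blast
    have "p \<otimes>\<^bsub>B\<^esub> a m s t = a m s t"
    proof (cases "m = l")
      case False
      then have "a m s t \<in> cells U" using step cells_gen U' by blast
      then show ?thesis using e_left[of "a m s t"] c B
        by (simp add: p_def A.l_distr A.m_assoc a_minus_def A.l_minus M.r_neg)
    next
      case True
      define z where "z = h \<otimes>\<^bsub>B\<^esub> a m s t \<ominus>\<^bsub>B\<^esub> a m s t"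
      have z: "z \<in> cells U" using h(2)[of s t] True step cells_mono[of z "above l" U] l U' z_def by auto
      have zB: "z \<in> carrier B" using z U' cells_closed by blast
      have ha: "h \<otimes>\<^bsub>B\<^esub> a m s t = a m s t \<oplus>\<^bsub>B\<^esub> z" using c B by (simp add: z_def M.add_minus_cancel)
      have "p \<otimes>\<^bsub>B\<^esub> a m s t = e \<otimes>\<^bsub>B\<^esub> a m s t \<oplus>\<^bsub>B\<^esub> (h \<otimes>\<^bsub>B\<^esub> a m s t \<ominus>\<^bsub>B\<^esub> h \<otimes>\<^bsub>B\<^esub> (e \<otimes>\<^bsub>B\<^esub> a m s t))"
        using c B by (simp add: p_def A.l_distr A.m_assoc a_minus_def A.l_minus)
      also have "h \<otimes>\<^bsub>B\<^esub> (e \<otimes>\<^bsub>B\<^esub> a m s t) = h \<otimes>\<^bsub>B\<^esub> a m s t \<otimes>\<^bsub>B\<^esub> e"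
        using c B identity_central[OF e U c] by (simp add: A.m_assoc)
      also have "\<dots> = e \<otimes>\<^bsub>B\<^esub> a m s t \<oplus>\<^bsub>B\<^esub> z"
        using ha c B zB identity_central[OF e U c] e_right[OF z] by (simp add: A.l_distr)
      also have "h \<otimes>\<^bsub>B\<^esub> a m s t = a m s t \<oplus>\<^bsub>B\<^esub> z" by (rule ha)
      also have "e \<otimes>\<^bsub>B\<^esub> a m s t \<oplus>\<^bsub>B\<^esub> (a m s t \<oplus>\<^bsub>B\<^esub> z \<ominus>\<^bsub>B\<^esub> (e \<otimes>\<^bsub>B\<^esub> a m s t \<oplus>\<^bsub>B\<^esub> z)) = a m s t"
        using c B zB by (intro M.add_minus_add_cancel) auto
      finally show ?thesis .
    qed
    then show ?case using step c pq by (simp add: A.r_distr smult_mult_right)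
  qed
  have q_right: "x \<otimes>\<^bsub>B\<^esub> q = x" if "x \<in> cells (insert l U)" for x
    using that U'(2)
  proof (induction rule: cells_induct)
    case zero
    then show ?case using pq by simp
  next
    case (step k m s t x)
    have c: "a m s t \<in> carrier B" using step U' a_closed by blast
    have "a m s t \<otimes>\<^bsub>B\<^esub> q = a m s t"
    proof (cases "m = l")
      case False
      then have "a m s t \<in> cells U" using step cells_gen U' by blast
      then show ?thesis using e_right[of "a m s t"] c B
        by (simp add: q_def A.r_distr a_minus_def A.r_minus M.r_neg flip: A.m_assoc)
    next
      case True
      define z where "z = a m s t \<otimes>\<^bsub>B\<^esub> h' \<ominus>\<^bsub>B\<^esub> a m s t"
      have z: "z \<in> cells U" using h'(2)[of s t] True step cells_mono[of z "above l" U] l U' z_def by auto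
      have zB: "z \<in> carrier B" using z U' cells_closed by blast
      have ha: "a m s t \<otimes>\<^bsub>B\<^esub> h' = a m s t \<oplus>\<^bsub>B\<^esub> z" using c B by (simp add: z_def M.add_minus_cancel)
      have "a m s t \<otimes>\<^bsub>B\<^esub> q = a m s t \<otimes>\<^bsub>B\<^esub> e \<oplus>\<^bsub>B\<^esub> (a m s t \<otimes>\<^bsub>B\<^esub> h' \<ominus>\<^bsub>B\<^esub> (a m s t \<otimes>\<^bsub>B\<^esub> e) \<otimes>\<^bsub>B\<^esub> h')"
        using c B by (simp add: q_def A.r_distr A.m_assoc a_minus_def A.r_minus)
      also have "a m s t \<otimes>\<^bsub>B\<^esub> e \<otimes>\<^bsub>B\<^esub> h' = e \<otimes>\<^bsub>B\<^esub> (a m s t \<otimes>\<^bsub>B\<^esub> h')"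
        using c B identity_central[OF e U c, symmetric] by (simp add: A.m_assoc)
      also have "\<dots> = a m s t \<otimes>\<^bsub>B\<^esub> e \<oplus>\<^bsub>B\<^esub> z"
        using ha c B zB identity_central[OF e U c] e_left[OF z] by (simp add: A.r_distr)
      also have "a m s t \<otimes>\<^bsub>B\<^esub> h' = a m s t \<oplus>\<^bsub>B\<^esub> z" by (rule ha)
      also have "a m s t \<otimes>\<^bsub>B\<^esub> e \<oplus>\<^bsub>B\<^esub> (a m s t \<oplus>\<^bsub>B\<^esub> z \<ominus>\<^bsub>B\<^esub> (a m s t \<otimes>\<^bsub>B\<^esub> e \<oplus>\<^bsub>B\<^esub> z)) = a m s t"
        using c B zB by (intro M.add_minus_add_cancel) auto
      finally show ?thesis .
    qed
    then show ?case using step c pq by (simp add: A.l_distr smult_mult_left)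
  qed
  have "p = q" using p_left[OF qU] q_right[OF pU] by simp
  then have "identity_of (insert l U) p"
    unfolding identity_of_def using pU p_left q_right by auto
  then show ?thesis by blast
qed

lemma identity_exists:
  assumes "upset U"
  shows "\<exists>e. identity_of U e"
proof -
  have U: "finite U" "irreflp_on U gt" "transp_on U gt"
    using assms poset unfolding upset_def
    by (auto intro: finite_subset irreflp_on_subset transp_on_subset)
  have "upset U \<and> (\<exists>e. identity_of U e)"
    using U
  proof (induction rule: finite_upset_induct)
    case empty
    have "cells {} = {\<zero>\<^bsub>B\<^esub>}"
      unfolding cells_def by (auto elim: linear_hull.cases intro: linear_hull.zero)
    then show ?case by (auto simp: identity_of_def upset_def intro!: exI[of _ "\<zero>\<^bsub>B\<^esub>"])
  next
    case (insert W l)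
    have U: "l \<in> \<Lambda>" "above l \<subseteq> U"
      using insert.hyps assms unfolding upset_def by auto
    moreover have "above l \<subseteq> W"
    proof
      fix m assume m: "m \<in> above l"
      then show "m \<in> W" using insert.hyps(5)[of m] U unfolding above_def by auto
    qed
    moreover have "upset (insert l W)"
      using insert.IH calculation unfolding upset_def by auto
    ultimately show ?case using insert.IH insert.hyps identity_of_insert[of W l] by blast
  qed
  then show ?thesis by blast
qed

definition unit_above :: "'l \<Rightarrow> 'b" where "unit_above l = (SOME e. identity_of (above l) e)"

lemma unit_above: "l \<in> \<Lambda> \<Longrightarrow> identity_of (above l) (unit_above l)"
  unfolding unit_above_def using identity_exists[OF upset_above] by (rule someI_ex)

text \<open>
  This central idempotent cuts away the cells above \<open>l\<close>, so that congruences modulo those cells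
  become equations.
\<close>

definition coidentity :: "'l \<Rightarrow> 'b" where "coidentity l = \<one>\<^bsub>B\<^esub> \<ominus>\<^bsub>B\<^esub> unit_above l"

lemma unit_above_closed: "l \<in> \<Lambda> \<Longrightarrow> unit_above l \<in> carrier B"
  using unit_above identity_closed upset_above upset_def by blast

lemma coidentity_closed: "l \<in> \<Lambda> \<Longrightarrow> coidentity l \<in> carrier B"
  unfolding coidentity_def using unit_above_closed by simp

lemma coidentity_central:
  "\<lbrakk>l \<in> \<Lambda>; x \<in> carrier B\<rbrakk> \<Longrightarrow> coidentity l \<otimes>\<^bsub>B\<^esub> x = x \<otimes>\<^bsub>B\<^esub> coidentity l"
  using unit_above_closed[of l] identity_central[OF unit_above upset_above]
  by (simp add: coidentity_def a_minus_def A.l_distr A.r_distr A.l_minus A.r_minus)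

lemma coidentity_kills: "\<lbrakk>l \<in> \<Lambda>; x \<in> cells (above l)\<rbrakk> \<Longrightarrow> x \<otimes>\<^bsub>B\<^esub> coidentity l = \<zero>\<^bsub>B\<^esub>"
  using unit_above_closed[of l] unit_above[of l] cells_closed[of x "above l"]
  by (simp add: coidentity_def a_minus_def A.r_distr A.r_minus identity_of_def M.r_neg above_def)

lemma coidentity_idem: "l \<in> \<Lambda> \<Longrightarrow> coidentity l \<otimes>\<^bsub>B\<^esub> coidentity l = coidentity l"
proof -
  assume l: "l \<in> \<Lambda>"
  have "unit_above l \<otimes>\<^bsub>B\<^esub> coidentity l = \<zero>\<^bsub>B\<^esub>"
    using l coidentity_kills unit_above identity_of_def by blast
  moreover have "coidentity l \<otimes>\<^bsub>B\<^esub> coidentity l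
      = coidentity l \<ominus>\<^bsub>B\<^esub> unit_above l \<otimes>\<^bsub>B\<^esub> coidentity l"
    using l coidentity_closed unit_above_closed
    by (subst coidentity_def) (simp add: a_minus_def A.l_distr A.l_minus)
  ultimately show ?thesis using l coidentity_closed by (simp add: a_minus_def)
qed

definition b :: "'l \<Rightarrow> 't \<Rightarrow> 't \<Rightarrow> 'b" where "b l s t = a l s t \<otimes>\<^bsub>B\<^esub> coidentity l"

lemma b_product:
  assumes "l \<in> \<Lambda>" "s \<in> T l" "t \<in> T l" "m \<in> \<Lambda>" "u \<in> T m" "v \<in> T m"
  shows "b l s t \<otimes>\<^bsub>B\<^esub> b m u v = a l s t \<otimes>\<^bsub>B\<^esub> a m u v \<otimes>\<^bsub>B\<^esub> coidentity l \<otimes>\<^bsub>B\<^esub> coidentity m"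
proof -
  have c: "a l s t \<in> carrier B" "a m u v \<in> carrier B" "coidentity l \<in> carrier B" "coidentity m \<in> carrier B"
    using assms a_closed coidentity_closed by auto
  have "b l s t \<otimes>\<^bsub>B\<^esub> b m u v = a l s t \<otimes>\<^bsub>B\<^esub> (coidentity l \<otimes>\<^bsub>B\<^esub> a m u v) \<otimes>\<^bsub>B\<^esub> coidentity m"
    using c by (simp add: b_def A.m_assoc)
  also have "coidentity l \<otimes>\<^bsub>B\<^esub> a m u v = a m u v \<otimes>\<^bsub>B\<^esub> coidentity l"
    using coidentity_central assms(1) c by blast
  finally show ?thesis using c by (simp add: A.m_assoc)
qed

text \<open>
  \<open>a l s t\<close> differs from \<open>b l s t\<close> by an element of the ideal above \<open>l\<close>, where induction applies.
\<close>

lemma b_spans: "carrier B = linear_hull K B {b l s t | l s t. l \<in> \<Lambda> \<and> s \<in> T l \<and> t \<in> T l}"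
proof -
  let ?G = "{b l s t | l s t. l \<in> \<Lambda> \<and> s \<in> T l \<and> t \<in> T l}"
  define H where "H = linear_hull K B ?G"
  have gens: "?G \<subseteq> carrier B"
    using a_closed coidentity_closed by (auto simp: b_def)
  have H_add: "x \<oplus>\<^bsub>B\<^esub> y \<in> H" if "x \<in> H" "y \<in> H" for x y
    using that gens unfolding H_def by (intro hull_add) auto
  have bH: "b l s t \<in> H" if "l \<in> \<Lambda>" "s \<in> T l" "t \<in> T l" for l s t
    using that gens unfolding H_def by (intro hull_base) auto
  have "cells \<Lambda> \<subseteq> H"
    using poset
  proof (induction rule: finite_upset_induct)
    case empty
    have "cells {} = {\<zero>\<^bsub>B\<^esub>}"
      unfolding cells_def by (auto elim: linear_hull.cases intro: linear_hull.zero)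
    then show ?case by (simp add: linear_hull.zero H_def)
  next
    case (insert U l)
    have above: "above l \<subseteq> U" "U \<subseteq> \<Lambda>" "l \<in> \<Lambda>"
      using insert.hyps unfolding above_def by auto
    have "g \<in> H" if g: "g \<in> {a m s t |m s t. m \<in> insert l U \<and> s \<in> T m \<and> t \<in> T m}" for g
    proof -
      obtain m s t where m: "g = a m s t" "m \<in> insert l U" "s \<in> T m" "t \<in> T m" using g by auto
      show ?thesis
      proof (cases "m = l")
        case False
        then have "g \<in> cells U" using m above cells_gen by simp
        then show ?thesis using insert.IH by blast
      next
        case True
        have c: "a l s t \<in> carrier B" "unit_above l \<in> carrier B"
          using m True above a_closed unit_above_closed by auto
        have "unit_above l \<in> cells (above l)"
          using unit_above[OF above(3)] unfolding identity_of_def by simp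
        then have "a l s t \<otimes>\<^bsub>B\<^esub> unit_above l \<in> cells (above l)"
          using cells_ideal_left[OF upset_above[OF above(3)] _ c(1)] by simp
        then have "a l s t \<otimes>\<^bsub>B\<^esub> unit_above l \<in> cells U"
          by (rule cells_mono) (use above in auto)
        then have "a l s t \<otimes>\<^bsub>B\<^esub> unit_above l \<in> H" using insert.IH by auto
        moreover have "b l s t \<in> H" using m True above bH by simp
        ultimately have "b l s t \<oplus>\<^bsub>B\<^esub> a l s t \<otimes>\<^bsub>B\<^esub> unit_above l \<in> H" by (intro H_add)
        moreover have "b l s t \<oplus>\<^bsub>B\<^esub> a l s t \<otimes>\<^bsub>B\<^esub> unit_above l = a l s t"
          using c by (simp add: b_def coidentity_def a_minus_def A.r_distr A.r_minus M.a_assoc M.l_neg)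
        ultimately show ?thesis using m True by simp
      qed
    qed
    then have "{a m s t |m s t. m \<in> insert l U \<and> s \<in> T m \<and> t \<in> T m} \<subseteq> H" by blast
    then show ?case unfolding cells_def H_def by (rule hull_least[OF _ gens])
  qed
  then show ?thesis using spans hull_closed[OF _ gens] unfolding H_def by blast
qed

text \<open>
  The coidentities are central and kill whatever is congruent to zero.  A product of two different
  cells always lies above one of the two, whose coidentity then kills it.
\<close>

theorem orthogonal: "orthogonal_cells K B \<Lambda> T b form"
proof unfold_locales
  show "finite (Sigma \<Lambda> T)" using poset finite_T by auto
  show "carrier B = linear_hull K B {b l s t | l s t. l \<in> \<Lambda> \<and> s \<in> T l \<and> t \<in> T l}" by (rule b_spans)
next
  fix l s t assume "l \<in> \<Lambda>" "s \<in> T l" "t \<in> T l"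
  then show "b l s t \<in> carrier B" "form l s t \<in> carrier K"
    using a_closed coidentity_closed form_closed by (auto simp: b_def)
next
  fix l s t u v assume *: "l \<in> \<Lambda>" "s \<in> T l" "t \<in> T l" "u \<in> T l" "v \<in> T l"
  have c: "a l s t \<in> carrier B" "a l u v \<in> carrier B" "a l s v \<in> carrier B" "coidentity l \<in> carrier B"
    "form l t u \<in> carrier K"
    using * a_closed coidentity_closed form_closed by auto
  define z where "z = a l s t \<otimes>\<^bsub>B\<^esub> a l u v \<ominus>\<^bsub>B\<^esub> form l t u \<odot>\<^bsub>B\<^esub> a l s v"
  have "z \<in> carrier B" "z \<otimes>\<^bsub>B\<^esub> coidentity l = \<zero>\<^bsub>B\<^esub>"
    using * c mult coidentity_kills by (auto simp: z_def)
  moreover have "a l s t \<otimes>\<^bsub>B\<^esub> a l u v = form l t u \<odot>\<^bsub>B\<^esub> a l s v \<oplus>\<^bsub>B\<^esub> z"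
    using c by (simp add: z_def M.add_minus_cancel)
  ultimately have "a l s t \<otimes>\<^bsub>B\<^esub> a l u v \<otimes>\<^bsub>B\<^esub> coidentity l = form l t u \<odot>\<^bsub>B\<^esub> (a l s v \<otimes>\<^bsub>B\<^esub> coidentity l)"
    using c by (simp add: A.l_distr smult_mult_left)
  then show "b l s t \<otimes>\<^bsub>B\<^esub> b l u v = form l t u \<odot>\<^bsub>B\<^esub> b l s v"
    using * c by (simp add: b_product) (simp add: A.m_assoc smult_mult_left coidentity_idem b_def)
next
  fix l s t m u v assume *: "l \<in> \<Lambda>" "s \<in> T l" "t \<in> T l" "m \<in> \<Lambda>" "u \<in> T m" "v \<in> T m" "l \<noteq> m"
  have c: "a l s t \<in> carrier B" "a m u v \<in> carrier B" "coidentity l \<in> carrier B" "coidentity m \<in> carrier B"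
    using * a_closed coidentity_closed by auto
  show "b l s t \<otimes>\<^bsub>B\<^esub> b m u v = \<zero>\<^bsub>B\<^esub>"
  proof (cases "gt l m")
    case False
    then have "a l s t \<otimes>\<^bsub>B\<^esub> a m u v \<otimes>\<^bsub>B\<^esub> coidentity l = \<zero>\<^bsub>B\<^esub>"
      using * mult_distinct coidentity_kills by blast
    then show ?thesis using * c by (simp add: b_product)
  next
    case True
    have "a l s t \<otimes>\<^bsub>B\<^esub> a m u v \<in> cells (insert l (above l))" using * c ideal_right by blast
    moreover have "insert l (above l) \<subseteq> above m" "above m \<subseteq> \<Lambda>"
      using * True transp_onD[OF poset(3)] unfolding above_def by blast+
    ultimately have "a l s t \<otimes>\<^bsub>B\<^esub> a m u v \<otimes>\<^bsub>B\<^esub> coidentity m = \<zero>\<^bsub>B\<^esub>"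
      using * cells_mono coidentity_kills by blast
    then have "a l s t \<otimes>\<^bsub>B\<^esub> a m u v \<otimes>\<^bsub>B\<^esub> coidentity m \<otimes>\<^bsub>B\<^esub> coidentity l = \<zero>\<^bsub>B\<^esub>"
      using c by simp
    then show ?thesis
      using * c coidentity_central[of l "coidentity m"] by (simp add: b_product A.m_assoc)
  qed
qed

end

section \<open>Extension of scalars as a quotient ring\<close>

text \<open>
  The product of the free ring is a nested linear extension.  This is its additivity in the factor
  over which the inner extension runs.
\<close>

lemma frag_extend_fun_diff:
  "frag_extend (\<lambda>i. f i - g i) x = frag_extend f x - frag_extend g x"
  using subset_UNIV by (induction x rule: frag_induction) (auto simp: frag_extend_diff)

locale scalar_extension = A: unital_algebra R A + K: cring K
  for R :: "('r, 'x) ring_scheme" (structure) and K :: "('k, 'y) ring_scheme" (structure)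
    and A :: "('r, 'a, 'z) module_scheme" (structure) +
  fixes \<iota> :: "'r \<Rightarrow> 'k"
  assumes \<iota>_hom: "\<iota> \<in> ring_hom R K"
begin

abbreviation "F \<equiv> tensor_free A K"
abbreviation "N \<equiv> tensor_kernel R \<iota> K A"
abbreviation "B \<equiv> base_change R \<iota> K A"
abbreviation "tms \<equiv> carrier A \<times> carrier K"

lemma \<iota>_closed: "r \<in> carrier R \<Longrightarrow> \<iota> r \<in> carrier K"
  using \<iota>_hom by (rule ring_hom_closed)

lemma F_simps:
  "x \<in> carrier F \<longleftrightarrow> Poly_Mapping.keys x \<subseteq> tms"
  "\<zero>\<^bsub>F\<^esub> = 0" "x \<oplus>\<^bsub>F\<^esub> y = x + y" "\<one>\<^bsub>F\<^esub> = frag_of (\<one>\<^bsub>A\<^esub>, \<one>\<^bsub>K\<^esub>)"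
  by (auto simp: tensor_free_def)

lemma F_mult: "x \<otimes>\<^bsub>F\<^esub> y = frag_extend
  (\<lambda>(a, k). frag_extend (\<lambda>(b, l). frag_of (a \<otimes>\<^bsub>A\<^esub> b, k \<otimes>\<^bsub>K\<^esub> l)) y) x"
  by (simp add: tensor_free_def)

lemma F_mult_of [simp]: "frag_of (a, k) \<otimes>\<^bsub>F\<^esub> frag_of (b, l) = frag_of (a \<otimes>\<^bsub>A\<^esub> b, k \<otimes>\<^bsub>K\<^esub> l)"
  by (simp add: F_mult)

lemma F_mult_diff_left: "(x - y) \<otimes>\<^bsub>F\<^esub> z = x \<otimes>\<^bsub>F\<^esub> z - y \<otimes>\<^bsub>F\<^esub> z"
  by (simp add: F_mult frag_extend_diff)

lemma F_mult_diff_right: "z \<otimes>\<^bsub>F\<^esub> (x - y) = z \<otimes>\<^bsub>F\<^esub> x - z \<otimes>\<^bsub>F\<^esub> y"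
  by (simp add: F_mult frag_extend_diff case_prod_unfold frag_extend_fun_diff)

lemma F_mult_zero [simp]: "0 \<otimes>\<^bsub>F\<^esub> z = 0" "z \<otimes>\<^bsub>F\<^esub> 0 = 0"
  using F_mult_diff_left[of 0 0 z] F_mult_diff_right[of z 0 0] by simp_all

lemma F_mult_add_left: "(x + y) \<otimes>\<^bsub>F\<^esub> z = x \<otimes>\<^bsub>F\<^esub> z + y \<otimes>\<^bsub>F\<^esub> z"
  using F_mult_diff_left[of x "0 - y" z] F_mult_diff_left[of 0 y z] by simp

lemma F_mult_add_right: "z \<otimes>\<^bsub>F\<^esub> (x + y) = z \<otimes>\<^bsub>F\<^esub> x + z \<otimes>\<^bsub>F\<^esub> y"
  using F_mult_diff_right[of z x "0 - y"] F_mult_diff_right[of z 0 y] by simp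

lemma F_induct [consumes 1, case_names zero one diff]:
  assumes "x \<in> carrier F" "P 0" "\<And>a k. \<lbrakk>a \<in> carrier A; k \<in> carrier K\<rbrakk> \<Longrightarrow> P (frag_of (a, k))"
    and "\<And>x y. \<lbrakk>P x; P y\<rbrakk> \<Longrightarrow> P (x - y)"
  shows "P x"
  using assms(1)[unfolded F_simps] by (induction rule: frag_induction) (use assms in auto)

lemma F_closed:
  "0 \<in> carrier F"
  "\<lbrakk>a \<in> carrier A; k \<in> carrier K\<rbrakk> \<Longrightarrow> frag_of (a, k) \<in> carrier F"
  "\<lbrakk>x \<in> carrier F; y \<in> carrier F\<rbrakk> \<Longrightarrow> x + y \<in> carrier F"
  "\<lbrakk>x \<in> carrier F; y \<in> carrier F\<rbrakk> \<Longrightarrow> x - y \<in> carrier F"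
  "x \<in> carrier F \<Longrightarrow> - x \<in> carrier F"
  using keys_add[of x y] keys_diff[of x y] by (auto simp: F_simps)

lemma F_mult_closed:
  assumes "x \<in> carrier F" "y \<in> carrier F"
  shows "x \<otimes>\<^bsub>F\<^esub> y \<in> carrier F"
  using assms(1)
proof (induction rule: F_induct)
  case (one a k)
  show ?case using assms(2)
    by (induction rule: F_induct) (use one in \<open>simp_all add: F_mult_diff_right F_closed\<close>)
qed (simp_all add: F_mult_diff_left F_closed)

lemma F_mult_assoc:
  assumes "x \<in> carrier F" "y \<in> carrier F" "z \<in> carrier F"
  shows "x \<otimes>\<^bsub>F\<^esub> y \<otimes>\<^bsub>F\<^esub> z = x \<otimes>\<^bsub>F\<^esub> (y \<otimes>\<^bsub>F\<^esub> z)"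
  using assms(1)
proof (induction rule: F_induct)
  case (one a k)
  show ?case using assms(2)
  proof (induction rule: F_induct)
    case (one b l)
    show ?case using assms(3)
      by (induction rule: F_induct)
        (use one \<open>a \<in> carrier A\<close> \<open>k \<in> carrier K\<close> in \<open>auto simp: F_mult_diff_right A.m_assoc K.m_assoc\<close>)
  qed (auto simp: F_mult_diff_right F_mult_diff_left)
qed (auto simp: F_mult_diff_left)

lemma F_mult_one: assumes "x \<in> carrier F" shows "\<one>\<^bsub>F\<^esub> \<otimes>\<^bsub>F\<^esub> x = x" "x \<otimes>\<^bsub>F\<^esub> \<one>\<^bsub>F\<^esub> = x"
  unfolding F_simps using assms
  by (induction rule: F_induct) (auto simp: F_mult_diff_right F_mult_diff_left)

lemma F_ring: "ring F"
proof (rule ringI)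
  show "abelian_group F"
  proof (rule abelian_groupI)
    fix x assume "x \<in> carrier F"
    then show "\<exists>y\<in>carrier F. y \<oplus>\<^bsub>F\<^esub> x = \<zero>\<^bsub>F\<^esub>"
      by (intro bexI[of _ "- x"]) (simp_all add: F_simps(2,3) F_closed)
  qed (simp_all add: F_simps(2,3) F_closed add_ac)
  show "Group.monoid F"
    by (rule monoidI)
      (simp_all add: F_mult_assoc F_mult_one F_mult_closed, simp add: F_simps(4) F_closed)
qed (simp_all add: F_simps(3) F_mult_add_left F_mult_add_right)

sublocale F: ring F by (rule F_ring)

lemma F_a_inv: "x \<in> carrier F \<Longrightarrow> \<ominus>\<^bsub>F\<^esub> x = - x"
  by (rule F.minus_equality) (auto simp: F_simps F_closed(5)[unfolded F_simps])

lemma F_minus: "\<lbrakk>x \<in> carrier F; y \<in> carrier F\<rbrakk> \<Longrightarrow> x \<ominus>\<^bsub>F\<^esub> y = x - y"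
  by (simp add: a_minus_def F_a_inv F_simps)

lemma relations_closed: "tensor_relations R \<iota> K A \<subseteq> carrier F"
  unfolding tensor_relations_def by (auto intro!: F_closed simp: \<iota>_closed)

lemma N_subgroup: "subgroup N (add_monoid F)"
  unfolding tensor_kernel_def
  using F.add.generate_is_subgroup[of "tensor_relations R \<iota> K A"] relations_closed by simp

lemma N_closed: "x \<in> N \<Longrightarrow> x \<in> carrier F"
  using subgroup.subset[OF N_subgroup] by auto

lemma N_zero: "0 \<in> N" using subgroup.one_closed[OF N_subgroup] by (simp add: F_simps)

lemma N_add: "\<lbrakk>x \<in> N; y \<in> N\<rbrakk> \<Longrightarrow> x + y \<in> N"
  using subgroup.m_closed[OF N_subgroup] by (simp add: F_simps)

lemma N_neg: "x \<in> N \<Longrightarrow> - x \<in> N"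
  using subgroup.m_inv_closed[OF N_subgroup, of x] F_a_inv[of x] N_closed[of x]
  by (simp add: a_inv_def)

lemma N_diff: "\<lbrakk>x \<in> N; y \<in> N\<rbrakk> \<Longrightarrow> x - y \<in> N"
  using N_add[of x "- y"] N_neg by simp

lemma N_relation: "x \<in> tensor_relations R \<iota> K A \<Longrightarrow> x \<in> N"
  unfolding tensor_kernel_def by (rule generate.incl)

lemma N_induct [consumes 1, case_names zero rel add neg]:
  assumes "x \<in> N" "P 0" "\<And>x. x \<in> tensor_relations R \<iota> K A \<Longrightarrow> P x"
    "\<And>x y. \<lbrakk>P x; P y\<rbrakk> \<Longrightarrow> P (x + y)" "\<And>x. P x \<Longrightarrow> P (- x)"
  shows "P x"
  using assms(1) unfolding tensor_kernel_def
proof (induction rule: generate.induct)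
  case (inv h)
  then have "inv\<^bsub>add_monoid F\<^esub> h = - h" using F_a_inv[of h] relations_closed by (auto simp: a_inv_def)
  then show ?case using assms inv by simp
qed (use assms in \<open>auto simp: F_simps\<close>)

lemma rel_add_left:
  "\<lbrakk>a \<in> carrier A; b \<in> carrier A; k \<in> carrier K\<rbrakk>
    \<Longrightarrow> frag_of (a \<oplus>\<^bsub>A\<^esub> b, k) - frag_of (a, k) - frag_of (b, k) \<in> tensor_relations R \<iota> K A"
  unfolding tensor_relations_def by blast

lemma rel_add_right:
  "\<lbrakk>a \<in> carrier A; k \<in> carrier K; l \<in> carrier K\<rbrakk>
    \<Longrightarrow> frag_of (a, k \<oplus>\<^bsub>K\<^esub> l) - frag_of (a, k) - frag_of (a, l) \<in> tensor_relations R \<iota> K A"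
  unfolding tensor_relations_def by blast

lemma rel_smult:
  "\<lbrakk>r \<in> carrier R; a \<in> carrier A; k \<in> carrier K\<rbrakk>
    \<Longrightarrow> frag_of (r \<odot>\<^bsub>A\<^esub> a, k) - frag_of (a, \<iota> r \<otimes>\<^bsub>K\<^esub> k) \<in> tensor_relations R \<iota> K A"
  unfolding tensor_relations_def by blast

lemma relation_cases:
  assumes "x \<in> tensor_relations R \<iota> K A"
  obtains (add_left) a b k where "a \<in> carrier A" "b \<in> carrier A" "k \<in> carrier K"
      "x = frag_of (a \<oplus>\<^bsub>A\<^esub> b, k) - frag_of (a, k) - frag_of (b, k)"
  | (add_right) a k l where "a \<in> carrier A" "k \<in> carrier K" "l \<in> carrier K"
      "x = frag_of (a, k \<oplus>\<^bsub>K\<^esub> l) - frag_of (a, k) - frag_of (a, l)"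
  | (smult) r a k where "r \<in> carrier R" "a \<in> carrier A" "k \<in> carrier K"
      "x = frag_of (r \<odot>\<^bsub>A\<^esub> a, k) - frag_of (a, \<iota> r \<otimes>\<^bsub>K\<^esub> k)"
  using assms unfolding tensor_relations_def
  by (elim UnE CollectE exE conjE) (rule that; assumption)+

lemma relation_mult:
  assumes "x \<in> tensor_relations R \<iota> K A" "c \<in> carrier A" "m \<in> carrier K"
  shows "frag_of (c, m) \<otimes>\<^bsub>F\<^esub> x \<in> tensor_relations R \<iota> K A"
    and "x \<otimes>\<^bsub>F\<^esub> frag_of (c, m) \<in> tensor_relations R \<iota> K A"
proof -
  show "frag_of (c, m) \<otimes>\<^bsub>F\<^esub> x \<in> tensor_relations R \<iota> K A"
    using assms(1)
  proof (cases rule: relation_cases)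
    case (add_left a b k)
    then show ?thesis using assms rel_add_left[of "c \<otimes>\<^bsub>A\<^esub> a" "c \<otimes>\<^bsub>A\<^esub> b" "m \<otimes>\<^bsub>K\<^esub> k"]
      by (simp add: F_mult_diff_right A.r_distr)
  next
    case (add_right a k l)
    then show ?thesis using assms rel_add_right[of "c \<otimes>\<^bsub>A\<^esub> a" "m \<otimes>\<^bsub>K\<^esub> k" "m \<otimes>\<^bsub>K\<^esub> l"]
      by (simp add: F_mult_diff_right K.r_distr)
  next
    case (smult r a k)
    then show ?thesis using assms rel_smult[of r "c \<otimes>\<^bsub>A\<^esub> a" "m \<otimes>\<^bsub>K\<^esub> k"]
      by (simp add: F_mult_diff_right A.smult_mult_right K.m_lcomm \<iota>_closed)
  qed
  show "x \<otimes>\<^bsub>F\<^esub> frag_of (c, m) \<in> tensor_relations R \<iota> K A"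
    using assms(1)
  proof (cases rule: relation_cases)
    case (add_left a b k)
    then show ?thesis using assms rel_add_left[of "a \<otimes>\<^bsub>A\<^esub> c" "b \<otimes>\<^bsub>A\<^esub> c" "k \<otimes>\<^bsub>K\<^esub> m"]
      by (simp add: F_mult_diff_left A.l_distr)
  next
    case (add_right a k l)
    then show ?thesis using assms rel_add_right[of "a \<otimes>\<^bsub>A\<^esub> c" "k \<otimes>\<^bsub>K\<^esub> m" "l \<otimes>\<^bsub>K\<^esub> m"]
      by (simp add: F_mult_diff_left K.l_distr)
  next
    case (smult r a k)
    then show ?thesis using assms rel_smult[of r "a \<otimes>\<^bsub>A\<^esub> c" "k \<otimes>\<^bsub>K\<^esub> m"]
      by (simp add: F_mult_diff_left A.smult_mult_left K.m_assoc \<iota>_closed)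
  qed
qed

text \<open>
  By additivity in both factors this reduces to the product of a relation with a generator of the
  free group, which is a relation of the same kind.
\<close>

lemma N_mult:
  assumes "x \<in> N" "y \<in> carrier F"
  shows "y \<otimes>\<^bsub>F\<^esub> x \<in> N" "x \<otimes>\<^bsub>F\<^esub> y \<in> N"
proof -
  have neg: "y \<otimes>\<^bsub>F\<^esub> (- x) = - (y \<otimes>\<^bsub>F\<^esub> x)" "(- x) \<otimes>\<^bsub>F\<^esub> y = - (x \<otimes>\<^bsub>F\<^esub> y)" for x
    using F_mult_diff_right[of y 0 x] F_mult_diff_left[of 0 x y] by simp_all
  have rel: "y \<otimes>\<^bsub>F\<^esub> x \<in> N" "x \<otimes>\<^bsub>F\<^esub> y \<in> N" if "x \<in> tensor_relations R \<iota> K A" for x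
    using assms(2)
    by (induction rule: F_induct)
      (use that in \<open>auto simp: N_zero relation_mult N_relation F_mult_diff_left F_mult_diff_right N_diff\<close>)
  show "y \<otimes>\<^bsub>F\<^esub> x \<in> N" "x \<otimes>\<^bsub>F\<^esub> y \<in> N"
    using assms(1)
    by (induction rule: N_induct)
      (auto simp: N_zero rel neg N_neg N_add F_mult_add_left F_mult_add_right)
qed

lemma N_ideal: "ideal N F"
  by (rule idealI[OF F_ring N_subgroup]) (auto simp: N_mult)

sublocale N: ideal N F by (rule N_ideal)

definition cls :: "(('a \<times> 'k) \<Rightarrow>\<^sub>0 int) \<Rightarrow> (('a \<times> 'k) \<Rightarrow>\<^sub>0 int) set"
  where "cls x = N +>\<^bsub>F\<^esub> x"

lemma cls_eq_iff: "\<lbrakk>x \<in> carrier F; y \<in> carrier F\<rbrakk> \<Longrightarrow> cls x = cls y \<longleftrightarrow> x - y \<in> N"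
  unfolding cls_def using F.quotient_eq_iff_same_a_r_cos[OF N_ideal, of x y]
  by (simp add: F_minus)

lemma mem_cls_iff: "x \<in> carrier F \<Longrightarrow> y \<in> cls x \<longleftrightarrow> y \<in> carrier F \<and> y - x \<in> N"
proof
  assume x: "x \<in> carrier F" and "y \<in> cls x"
  then obtain n where "n \<in> N" "y = n + x"
    unfolding cls_def a_r_coset_def' by (auto simp: F_simps)
  then show "y \<in> carrier F \<and> y - x \<in> N" using x N_closed F_closed by auto
next
  assume "x \<in> carrier F" "y \<in> carrier F \<and> y - x \<in> N"
  then show "y \<in> cls x"
    unfolding cls_def a_r_coset_def' by (auto simp: F_simps intro!: bexI[of _ "y - x"])
qed

text \<open>The action of a scalar on the free group that induces the scalar multiplication.\<close>

definition scale :: "'k \<Rightarrow> (('a \<times> 'k) \<Rightarrow>\<^sub>0 int) \<Rightarrow> (('a \<times> 'k) \<Rightarrow>\<^sub>0 int)"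
  where "scale c = frag_extend (\<lambda>(a, k). frag_of (a, c \<otimes>\<^bsub>K\<^esub> k))"

lemma scale_simps [simp]:
  "scale c 0 = 0" "scale c (frag_of (a, k)) = frag_of (a, c \<otimes>\<^bsub>K\<^esub> k)"
  "scale c (x - y) = scale c x - scale c y" "scale c (x + y) = scale c x + scale c y"
  "scale c (- x) = - scale c x"
  by (simp_all add: scale_def frag_extend_diff frag_extend_add frag_extend_minus)

lemma scale_closed:
  assumes "c \<in> carrier K" "x \<in> carrier F"
  shows "scale c x \<in> carrier F"
  using assms(2) by (induction rule: F_induct) (use assms(1) in \<open>simp_all add: F_closed\<close>)

text \<open>
  Since the scaling of a relation is again a relation, the union over a coset in the scalar
  multiplication of the tensor product consists of copies of a single coset.
\<close>

lemma scale_N: assumes "x \<in> N" "c \<in> carrier K" shows "scale c x \<in> N"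
  using assms(1)
proof (induction rule: N_induct)
  case (rel x)
  then show ?case
  proof (cases rule: relation_cases)
    case (add_left a b k)
    then show ?thesis using assms N_relation[OF rel_add_left[of a b "c \<otimes>\<^bsub>K\<^esub> k"]] by simp
  next
    case (add_right a k l)
    then show ?thesis using assms N_relation[OF rel_add_right[of a "c \<otimes>\<^bsub>K\<^esub> k" "c \<otimes>\<^bsub>K\<^esub> l"]]
      by (simp add: K.r_distr)
  next
    case (smult r a k)
    then show ?thesis using assms N_relation[OF rel_smult[of r a "c \<otimes>\<^bsub>K\<^esub> k"]]
      by (simp add: K.m_lcomm \<iota>_closed)
  qed
qed (use assms in \<open>auto simp: N_zero N_add N_neg\<close>)

lemma scale_one: "x \<in> carrier F \<Longrightarrow> scale \<one>\<^bsub>K\<^esub> x = x"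
  by (induction rule: F_induct) auto

lemma scale_scale:
  assumes "x \<in> carrier F" "c \<in> carrier K" "d \<in> carrier K"
  shows "scale (c \<otimes>\<^bsub>K\<^esub> d) x = scale c (scale d x)"
  using assms(1) by (induction rule: F_induct) (use assms in \<open>auto simp: K.m_assoc\<close>)

lemma scale_add:
  assumes "x \<in> carrier F" "c \<in> carrier K" "d \<in> carrier K"
  shows "scale (c \<oplus>\<^bsub>K\<^esub> d) x - (scale c x + scale d x) \<in> N"
  using assms(1)
proof (induction rule: F_induct)
  case (one a k)
  then show ?case
    using assms N_relation[OF rel_add_right[of a "c \<otimes>\<^bsub>K\<^esub> k" "d \<otimes>\<^bsub>K\<^esub> k"]]
    by (simp add: K.l_distr diff_diff_eq)
next
  case (diff x y)
  have "scale (c \<oplus>\<^bsub>K\<^esub> d) (x - y) - (scale c (x - y) + scale d (x - y))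
      = (scale (c \<oplus>\<^bsub>K\<^esub> d) x - (scale c x + scale d x)) - (scale (c \<oplus>\<^bsub>K\<^esub> d) y - (scale c y + scale d y))"
    by simp
  then show ?case using diff N_diff by metis
qed (simp add: N_zero)

lemma scale_mult:
  assumes "x \<in> carrier F" "y \<in> carrier F" "c \<in> carrier K"
  shows "scale c x \<otimes>\<^bsub>F\<^esub> y = scale c (x \<otimes>\<^bsub>F\<^esub> y)" "x \<otimes>\<^bsub>F\<^esub> scale c y = scale c (x \<otimes>\<^bsub>F\<^esub> y)"
proof -
  have "scale c x \<otimes>\<^bsub>F\<^esub> y = scale c (x \<otimes>\<^bsub>F\<^esub> y) \<and> x \<otimes>\<^bsub>F\<^esub> scale c y = scale c (x \<otimes>\<^bsub>F\<^esub> y)"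
    using assms(1)
  proof (induction rule: F_induct)
    case (one a k)
    show ?case using assms(2)
      by (induction rule: F_induct)
        (use one assms in \<open>auto simp: F_mult_diff_right K.m_assoc K.m_lcomm\<close>)
  qed (auto simp: F_mult_diff_left)
  then show "scale c x \<otimes>\<^bsub>F\<^esub> y = scale c (x \<otimes>\<^bsub>F\<^esub> y)" "x \<otimes>\<^bsub>F\<^esub> scale c y = scale c (x \<otimes>\<^bsub>F\<^esub> y)"
    by auto
qed

lemma B_fields:
  "carrier B = carrier (F Quot N)" "monoid.mult B = monoid.mult (F Quot N)"
  "one B = one (F Quot N)" "ring.zero B = ring.zero (F Quot N)" "ring.add B = ring.add (F Quot N)"
  by (simp_all add: base_change_def ring.defs module.defs)

lemma B_carrier: "carrier B = cls ` carrier F"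
  unfolding B_fields by (auto simp: FactRing_def A_RCOSETS_defs cls_def a_r_coset_def)

lemma B_simps:
  "\<lbrakk>x \<in> carrier F; y \<in> carrier F\<rbrakk> \<Longrightarrow> cls x \<otimes>\<^bsub>B\<^esub> cls y = cls (x \<otimes>\<^bsub>F\<^esub> y)"
  "\<lbrakk>x \<in> carrier F; y \<in> carrier F\<rbrakk> \<Longrightarrow> cls x \<oplus>\<^bsub>B\<^esub> cls y = cls (x + y)"
  "\<one>\<^bsub>B\<^esub> = cls \<one>\<^bsub>F\<^esub>" "\<zero>\<^bsub>B\<^esub> = cls 0"
  unfolding B_fields using N.rcos_ring_hom F.a_rcos_zero[OF N_ideal N_zero]
  by (auto simp: ring_hom_def cls_def F_simps) (simp add: FactRing_def)+

lemma B_smult: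
  assumes "c \<in> carrier K" "x \<in> carrier F"
  shows "c \<odot>\<^bsub>B\<^esub> cls x = cls (scale c x)"
proof -
  have "c \<odot>\<^bsub>B\<^esub> cls x = (\<Union>y\<in>cls x. cls (scale c y))"
    by (simp add: base_change_def ring.defs module.defs cls_def scale_def)
  moreover have "cls (scale c y) = cls (scale c x)" if "y \<in> cls x" for y
    using that assms scale_N[of "y - x" c] scale_closed by (simp add: mem_cls_iff cls_eq_iff)
  moreover have "x \<in> cls x" using assms by (simp add: mem_cls_iff N_zero)
  ultimately show ?thesis by blast
qed

lemma cls_closed: "x \<in> carrier F \<Longrightarrow> cls x \<in> carrier B" by (simp add: B_carrier)

lemma B_E: assumes "z \<in> carrier B" obtains x where "x \<in> carrier F" "z = cls x"
  using assms B_carrier by auto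

lemma B_unital_algebra: "unital_algebra K B"
proof -
  have "ring B"
  proof (rule ringI)
    show "abelian_group B"
    proof (rule abelian_groupI)
      fix z assume "z \<in> carrier B"
      then obtain x where "x \<in> carrier F" "z = cls x" by (rule B_E)
      then show "\<exists>y\<in>carrier B. y \<oplus>\<^bsub>B\<^esub> z = \<zero>\<^bsub>B\<^esub>"
        by (intro bexI[of _ "cls (- x)"]) (auto simp: B_simps F_closed cls_closed)
    qed (auto elim!: B_E simp: B_simps F_closed cls_closed add_ac)
    show "Group.monoid B"
      by (rule monoidI)
        (auto elim!: B_E simp: B_simps F_mult_closed cls_closed F_mult_assoc F_mult_one)
  qed (auto elim!: B_E simp: B_simps F_mult_closed F_closed F_mult_add_left F_mult_add_right)
  moreover have "module K B"
  proof (rule moduleI)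
    show "abelian_group B" using \<open>ring B\<close> by (simp add: ring_def)
    fix c d z assume c: "c \<in> carrier K" "d \<in> carrier K" and "z \<in> carrier B"
    then obtain x where x: "x \<in> carrier F" "z = cls x" by (rule_tac B_E)
    show "(c \<oplus>\<^bsub>K\<^esub> d) \<odot>\<^bsub>B\<^esub> z = c \<odot>\<^bsub>B\<^esub> z \<oplus>\<^bsub>B\<^esub> d \<odot>\<^bsub>B\<^esub> z"
      using c x scale_add[of x c d] by (simp add: B_smult B_simps scale_closed F_closed cls_eq_iff)
  qed (auto elim!: B_E simp: B_simps B_smult cls_closed scale_closed F_closed scale_scale scale_one K.is_cring)
  ultimately show ?thesis
    unfolding unital_algebra_def unital_algebra_axioms_def
    by (auto elim!: B_E simp: B_simps B_smult F_mult_closed scale_closed scale_mult)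
qed

text \<open>
  The ring homomorphism \<open>x \<mapsto> x \<otimes> 1\<close>, through which everything known about \<open>A\<close> is transferred.
\<close>

definition embed :: "'a \<Rightarrow> (('a \<times> 'k) \<Rightarrow>\<^sub>0 int) set"
  where "embed x = cls (frag_of (x, \<one>\<^bsub>K\<^esub>))"

lemma embed_closed: "x \<in> carrier A \<Longrightarrow> embed x \<in> carrier B"
  by (simp add: embed_def cls_closed F_closed)

lemma embed_add: "\<lbrakk>x \<in> carrier A; y \<in> carrier A\<rbrakk> \<Longrightarrow> embed (x \<oplus>\<^bsub>A\<^esub> y) = embed x \<oplus>\<^bsub>B\<^esub> embed y"
  using N_relation[OF rel_add_left[of x y "\<one>\<^bsub>K\<^esub>"]]
  by (simp add: embed_def B_simps F_closed cls_eq_iff diff_diff_eq)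

lemma embed_mult: "\<lbrakk>x \<in> carrier A; y \<in> carrier A\<rbrakk> \<Longrightarrow> embed (x \<otimes>\<^bsub>A\<^esub> y) = embed x \<otimes>\<^bsub>B\<^esub> embed y"
  by (simp add: embed_def B_simps F_closed)

lemma embed_smult:
  "\<lbrakk>r \<in> carrier R; x \<in> carrier A\<rbrakk> \<Longrightarrow> embed (r \<odot>\<^bsub>A\<^esub> x) = \<iota> r \<odot>\<^bsub>B\<^esub> embed x"
  using N_relation[OF rel_smult[of r x "\<one>\<^bsub>K\<^esub>"]]
  by (simp add: embed_def B_smult F_closed cls_eq_iff \<iota>_closed)

lemma embed_spans: "carrier B = linear_hull K B (embed ` carrier A)"
proof -
  interpret B: unital_algebra K B by (rule B_unital_algebra)
  have sub: "embed ` carrier A \<subseteq> carrier B" using embed_closed by auto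
  have "cls x \<in> linear_hull K B (embed ` carrier A)" if "x \<in> carrier F" for x
  proof -
    have "x \<in> carrier F \<and> cls x \<in> linear_hull K B (embed ` carrier A)"
      using that
    proof (induction rule: F_induct)
      case zero
      then show ?case using linear_hull.zero[of B K] by (simp add: B_simps F_closed)
    next
      case (one a k)
      have "cls (frag_of (a, k)) = k \<odot>\<^bsub>B\<^esub> embed a"
        using one by (simp add: embed_def B_smult F_closed)
      moreover have "embed a \<in> linear_hull K B (embed ` carrier A)"
        using one sub by (intro B.hull_base) auto
      ultimately show ?case using one sub B.hull_smult by (simp add: F_closed)
    next
      case (diff x y)
      have "cls (x - y) = cls x \<oplus>\<^bsub>B\<^esub> cls (- y)" using diff by (simp add: B_simps F_closed)
      moreover have "cls (- y) = \<ominus>\<^bsub>B\<^esub> cls y"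
        using diff by (intro B.M.minus_equality[symmetric]) (auto simp: B_simps F_closed cls_closed)
      ultimately show ?case using diff sub by (auto simp: F_closed intro!: B.hull_add B.hull_neg)
    qed
    then show ?thesis by simp
  qed
  then show ?thesis using B.hull_closed[OF _ sub] by (auto elim!: B_E)
qed

end

section \<open>Coordinates and bilinear forms of a cellular algebra\<close>

context unital_algebra
begin

definition coords :: "'c set \<Rightarrow> 'c \<Rightarrow> 'c \<Rightarrow> 'a"
  where "coords S x = (THE f. f \<in> S \<rightarrow>\<^sub>E carrier R \<and> x = (\<Oplus>\<^bsub>A\<^esub>b\<in>S. f b \<odot>\<^bsub>A\<^esub> b))"

context
  fixes S assumes free: "finite_free_basis R A S"
begin

lemma basis_finite: "finite S" and basis_closed: "S \<subseteq> carrier A"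
  using free by (auto simp: finite_free_basis_def)

lemma coords_expansion:
  assumes "x \<in> carrier A"
  shows "coords S x \<in> S \<rightarrow>\<^sub>E carrier R" "x = (\<Oplus>\<^bsub>A\<^esub>b\<in>S. coords S x b \<odot>\<^bsub>A\<^esub> b)"
proof -
  have "\<exists>!f. f \<in> S \<rightarrow>\<^sub>E carrier R \<and> x = (\<Oplus>\<^bsub>A\<^esub>b\<in>S. f b \<odot>\<^bsub>A\<^esub> b)"
    using free assms by (auto simp: finite_free_basis_def)
  from theI'[OF this] show "coords S x \<in> S \<rightarrow>\<^sub>E carrier R" "x = (\<Oplus>\<^bsub>A\<^esub>b\<in>S. coords S x b \<odot>\<^bsub>A\<^esub> b)"
    unfolding coords_def by auto
qed

lemma coords_closed: "\<lbrakk>x \<in> carrier A; b \<in> S\<rbrakk> \<Longrightarrow> coords S x b \<in> carrier R"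
  using coords_expansion(1) by (auto simp: PiE_def Pi_def)

lemma coords_unique:
  assumes "f \<in> S \<rightarrow> carrier R" "b \<in> S"
  shows "coords S (\<Oplus>\<^bsub>A\<^esub>b\<in>S. f b \<odot>\<^bsub>A\<^esub> b) b = f b"
proof -
  define x where "x = (\<Oplus>\<^bsub>A\<^esub>b\<in>S. f b \<odot>\<^bsub>A\<^esub> b)"
  have x: "x \<in> carrier A" unfolding x_def using assms basis_closed[THEN subsetD] by (intro M.finsum_closed) (simp add: Pi_iff)
  have "x = (\<Oplus>\<^bsub>A\<^esub>b\<in>S. restrict f S b \<odot>\<^bsub>A\<^esub> b)"
    unfolding x_def using assms basis_closed[THEN subsetD] by (intro M.finsum_cong') (simp_all add: Pi_iff)
  moreover have "restrict f S \<in> S \<rightarrow>\<^sub>E carrier R" using assms by auto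
  moreover have "\<exists>!f. f \<in> S \<rightarrow>\<^sub>E carrier R \<and> x = (\<Oplus>\<^bsub>A\<^esub>b\<in>S. f b \<odot>\<^bsub>A\<^esub> b)"
    using free x by (auto simp: finite_free_basis_def)
  ultimately have "coords S x = restrict f S" using coords_expansion[OF x] by blast
  then show ?thesis using assms by (simp add: x_def)
qed

lemma coords_add:
  assumes "x \<in> carrier A" "y \<in> carrier A" "b \<in> S"
  shows "coords S (x \<oplus>\<^bsub>A\<^esub> y) b = coords S x b \<oplus> coords S y b"
proof -
  have "x \<oplus>\<^bsub>A\<^esub> y = (\<Oplus>\<^bsub>A\<^esub>b\<in>S. coords S x b \<odot>\<^bsub>A\<^esub> b) \<oplus>\<^bsub>A\<^esub> (\<Oplus>\<^bsub>A\<^esub>b\<in>S. coords S y b \<odot>\<^bsub>A\<^esub> b)"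
    using assms coords_expansion(2) by simp
  also have "\<dots> = (\<Oplus>\<^bsub>A\<^esub>b\<in>S. coords S x b \<odot>\<^bsub>A\<^esub> b \<oplus>\<^bsub>A\<^esub> coords S y b \<odot>\<^bsub>A\<^esub> b)"
    using assms coords_closed basis_closed[THEN subsetD] by (intro M.finsum_addf[symmetric]) (simp_all add: Pi_iff)
  also have "\<dots> = (\<Oplus>\<^bsub>A\<^esub>b\<in>S. (coords S x b \<oplus> coords S y b) \<odot>\<^bsub>A\<^esub> b)"
    using assms coords_closed basis_closed[THEN subsetD] by (intro M.finsum_cong') (simp_all add: Pi_iff smult_l_distr)
  finally show ?thesis using assms coords_unique coords_closed by simp
qed

lemma coords_smult:
  assumes "x \<in> carrier A" "r \<in> carrier R" "b \<in> S"
  shows "coords S (r \<odot>\<^bsub>A\<^esub> x) b = r \<otimes> coords S x b"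
proof -
  have "r \<odot>\<^bsub>A\<^esub> x = r \<odot>\<^bsub>A\<^esub> (\<Oplus>\<^bsub>A\<^esub>b\<in>S. coords S x b \<odot>\<^bsub>A\<^esub> b)"
    using assms coords_expansion(2) by simp
  also have "\<dots> = (\<Oplus>\<^bsub>A\<^esub>b\<in>S. r \<odot>\<^bsub>A\<^esub> (coords S x b \<odot>\<^bsub>A\<^esub> b))"
    using assms coords_closed basis_closed[THEN subsetD] basis_finite by (intro finsum_smult_ldistr) (simp_all add: Pi_iff)
  also have "\<dots> = (\<Oplus>\<^bsub>A\<^esub>b\<in>S. (r \<otimes> coords S x b) \<odot>\<^bsub>A\<^esub> b)"
    using assms coords_closed basis_closed[THEN subsetD] by (intro M.finsum_cong') (simp_all add: Pi_iff smult_assoc1)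
  finally show ?thesis using assms coords_unique coords_closed by simp
qed

lemma coords_basis:
  assumes "b \<in> S" "b' \<in> S"
  shows "coords S b' b = (if b = b' then \<one> else \<zero>)"
proof -
  have b': "b' \<in> carrier A" using assms basis_closed by auto
  have "(\<Oplus>\<^bsub>A\<^esub>b\<in>S. (if b = b' then \<one> else \<zero>) \<odot>\<^bsub>A\<^esub> b) = (\<Oplus>\<^bsub>A\<^esub>b\<in>S. if b' = b then b else \<zero>\<^bsub>A\<^esub>)"
    using basis_closed by (intro M.finsum_cong') auto
  also have "\<dots> = b'"
    using assms basis_finite basis_closed by (intro M.finsum_singleton) auto
  finally show ?thesis using coords_unique[of "\<lambda>b. if b = b' then \<one> else \<zero>" b] assms by simp
qed

text \<open>
  Only basis vectors that occur in \<open>x\<close> are added, which is what allows arguments about the support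
  of \<open>x\<close> to be carried out one basis vector at a time.
\<close>

lemma basis_induct [consumes 1, case_names zero step]:
  assumes "x \<in> carrier A" "P \<zero>\<^bsub>A\<^esub>"
    and step: "\<And>r b y. \<lbrakk>r \<in> carrier R; b \<in> S; coords S x b \<noteq> \<zero>; y \<in> carrier A; P y\<rbrakk>
      \<Longrightarrow> P (r \<odot>\<^bsub>A\<^esub> b \<oplus>\<^bsub>A\<^esub> y)"
  shows "P x"
proof -
  have "P (\<Oplus>\<^bsub>A\<^esub>b\<in>S'. coords S x b \<odot>\<^bsub>A\<^esub> b)" if "finite S'" "S' \<subseteq> S" for S'
    using that
  proof (induction S' rule: finite_induct)
    case empty
    then show ?case using assms by simp
  next
    case (insert b S')
    let ?y = "\<Oplus>\<^bsub>A\<^esub>b\<in>S'. coords S x b \<odot>\<^bsub>A\<^esub> b"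
    have cl: "coords S x b' \<odot>\<^bsub>A\<^esub> b' \<in> carrier A" if "b' \<in> insert b S'" for b'
      using that insert.prems assms(1) coords_closed basis_closed by blast
    then have y: "?y \<in> carrier A" by (intro M.finsum_closed) auto
    have eq: "(\<Oplus>\<^bsub>A\<^esub>b\<in>insert b S'. coords S x b \<odot>\<^bsub>A\<^esub> b) = coords S x b \<odot>\<^bsub>A\<^esub> b \<oplus>\<^bsub>A\<^esub> ?y"
      using insert cl by (intro M.finsum_insert) auto
    have b: "b \<in> S" "b \<in> carrier A" using insert basis_closed by auto
    show ?case
    proof (cases "coords S x b = \<zero>")
      case True
      then show ?thesis using eq b y insert by simp
    next
      case False
      then show ?thesis unfolding eq using b y insert coords_closed[OF assms(1)] by (intro step) auto
    qed
  qed
  from this[OF basis_finite] show ?thesis using coords_expansion(2)[OF assms(1)] by simp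
qed

end

end

context cellular_algebra
begin

abbreviation "I \<equiv> cell_index \<Lambda> T"

definition cell_elt :: "'l \<times> 't \<times> 't \<Rightarrow> 'a" where "cell_elt = (\<lambda>(l, s, t). a l s t)"

definition coeff :: "'l \<times> 't \<times> 't \<Rightarrow> 'a \<Rightarrow> 'r" where "coeff p x = coords (cell_basis \<Lambda> T a) x (cell_elt p)"

lemma cell_elt_simp: "cell_elt (l, s, t) = a l s t" by (simp add: cell_elt_def)

lemma I_iff: "(l, s, t) \<in> I \<longleftrightarrow> l \<in> \<Lambda> \<and> s \<in> T l \<and> t \<in> T l"
  by (auto simp: cell_index_def)

lemma cell_elt_basis: "p \<in> I \<Longrightarrow> cell_elt p \<in> cell_basis \<Lambda> T a"
  by (auto simp: cell_basis_def cell_elt_def)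

lemma cell_elt_inj: "\<lbrakk>p \<in> I; q \<in> I\<rbrakk> \<Longrightarrow> cell_elt p = cell_elt q \<longleftrightarrow> p = q"
  using inj_cell unfolding cell_elt_def inj_on_def by blast

lemma cell_elt_closed: "p \<in> I \<Longrightarrow> cell_elt p \<in> carrier A"
  using cell_elt_basis basis_closed[OF basis] by blast

lemma a_closed: "\<lbrakk>l \<in> \<Lambda>; s \<in> T l; t \<in> T l\<rbrakk> \<Longrightarrow> a l s t \<in> carrier A"
  using cell_elt_closed[of "(l, s, t)"] by (simp add: I_iff cell_elt_simp)

lemma coeff_closed: "\<lbrakk>p \<in> I; x \<in> carrier A\<rbrakk> \<Longrightarrow> coeff p x \<in> carrier R"
  unfolding coeff_def using coords_closed[OF basis] cell_elt_basis by blast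

lemma coeff_add: "\<lbrakk>p \<in> I; x \<in> carrier A; y \<in> carrier A\<rbrakk> \<Longrightarrow> coeff p (x \<oplus>\<^bsub>A\<^esub> y) = coeff p x \<oplus> coeff p y"
  unfolding coeff_def using coords_add[OF basis] cell_elt_basis by blast

lemma coeff_smult: "\<lbrakk>p \<in> I; x \<in> carrier A; r \<in> carrier R\<rbrakk> \<Longrightarrow> coeff p (r \<odot>\<^bsub>A\<^esub> x) = r \<otimes> coeff p x"
  unfolding coeff_def using coords_smult[OF basis] cell_elt_basis by blast

lemma coeff_zero: "p \<in> I \<Longrightarrow> coeff p \<zero>\<^bsub>A\<^esub> = \<zero>"
  using coeff_smult[of p "\<zero>\<^bsub>A\<^esub>" \<zero>] coeff_closed by simp

lemma coeff_minus: "\<lbrakk>p \<in> I; x \<in> carrier A; y \<in> carrier A\<rbrakk> \<Longrightarrow> coeff p (x \<ominus>\<^bsub>A\<^esub> y) = coeff p x \<ominus> coeff p y"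
  using coeff_add[of p x "\<ominus>\<^bsub>A\<^esub> y"] coeff_smult[of p y "\<ominus> \<one>"] smult_minus_one[of y] coeff_closed[of p y]
  by (simp add: a_minus_def R.l_minus)

lemma coeff_elt: "\<lbrakk>p \<in> I; q \<in> I\<rbrakk> \<Longrightarrow> coeff p (cell_elt q) = (if p = q then \<one> else \<zero>)"
  unfolding coeff_def using coords_basis[OF basis] cell_elt_basis cell_elt_inj by simp

lemma coeff_a: "\<lbrakk>p \<in> I; l \<in> \<Lambda>; s \<in> T l; t \<in> T l\<rbrakk> \<Longrightarrow> coeff p (a l s t) = (if p = (l, s, t) then \<one> else \<zero>)"
  using coeff_elt[of p "(l, s, t)"] by (simp add: I_iff cell_elt_simp)

lemma cell_induct [consumes 1, case_names zero step]:
  assumes "x \<in> carrier A" "P \<zero>\<^bsub>A\<^esub>"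
    and "\<And>r l s t y. \<lbrakk>r \<in> carrier R; l \<in> \<Lambda>; s \<in> T l; t \<in> T l; coeff (l, s, t) x \<noteq> \<zero>; y \<in> carrier A; P y\<rbrakk>
      \<Longrightarrow> P (r \<odot>\<^bsub>A\<^esub> a l s t \<oplus>\<^bsub>A\<^esub> y)"
  shows "P x"
  using assms(1)
proof (induction rule: basis_induct[OF basis, consumes 1, case_names zero step])
  case (step r b y)
  then obtain l s t where "l \<in> \<Lambda>" "s \<in> T l" "t \<in> T l" "b = a l s t"
    by (auto simp: cell_basis_def cell_index_def)
  then show ?case using step assms(3) by (simp add: coeff_def cell_elt_simp)
qed (rule assms)

lemma coeff_eqI:
  assumes "x \<in> carrier A" "y \<in> carrier A" "\<And>p. p \<in> I \<Longrightarrow> coeff p x = coeff p y"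
  shows "x = y"
proof -
  have "x \<ominus>\<^bsub>A\<^esub> y \<in> carrier A" using assms by simp
  then have "x \<ominus>\<^bsub>A\<^esub> y = \<zero>\<^bsub>A\<^esub>"
  proof (induction rule: cell_induct)
    case (step r l s t z)
    then show ?case using assms coeff_minus[of "(l, s, t)" x y] coeff_closed by (simp add: I_iff a_minus_def R.r_neg)
  qed simp
  then show ?thesis using assms by simp
qed

lemma coeff_finsum:
  assumes "p \<in> I" "finite J" "\<And>i. i \<in> J \<Longrightarrow> w i \<in> carrier R" "\<And>i. i \<in> J \<Longrightarrow> g i \<in> carrier A"
  shows "coeff p (\<Oplus>\<^bsub>A\<^esub>i\<in>J. w i \<odot>\<^bsub>A\<^esub> g i) = (\<Oplus>i\<in>J. w i \<otimes> coeff p (g i))"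
  using assms(2-)
proof (induction J rule: finite_induct)
  case empty
  then show ?case using assms(1) by (simp add: coeff_zero)
next
  case (insert j J)
  have "(\<Oplus>\<^bsub>A\<^esub>i\<in>insert j J. w i \<odot>\<^bsub>A\<^esub> g i) = w j \<odot>\<^bsub>A\<^esub> g j \<oplus>\<^bsub>A\<^esub> (\<Oplus>\<^bsub>A\<^esub>i\<in>J. w i \<odot>\<^bsub>A\<^esub> g i)"
    using insert by (intro M.finsum_insert) auto
  moreover have "(\<Oplus>i\<in>insert j J. w i \<otimes> coeff p (g i)) = w j \<otimes> coeff p (g j) \<oplus> (\<Oplus>i\<in>J. w i \<otimes> coeff p (g i))"
    using insert assms(1) coeff_closed by (intro R.finsum_insert) auto
  moreover have "(\<Oplus>\<^bsub>A\<^esub>i\<in>J. w i \<odot>\<^bsub>A\<^esub> g i) \<in> carrier A" using insert by (intro M.finsum_closed) auto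
  ultimately show ?case using insert assms(1) by (simp add: coeff_add coeff_smult)
qed

lemma coeff_finsum_mult:
  assumes "p \<in> I" "finite J" "\<And>i. i \<in> J \<Longrightarrow> w i \<in> carrier R" "\<And>i. i \<in> J \<Longrightarrow> g i \<in> carrier A"
    "z \<in> carrier A"
  shows "coeff p ((\<Oplus>\<^bsub>A\<^esub>i\<in>J. w i \<odot>\<^bsub>A\<^esub> g i) \<otimes>\<^bsub>A\<^esub> z) = (\<Oplus>i\<in>J. w i \<otimes> coeff p (g i \<otimes>\<^bsub>A\<^esub> z))"
proof -
  have "(\<Oplus>\<^bsub>A\<^esub>i\<in>J. w i \<odot>\<^bsub>A\<^esub> g i) \<otimes>\<^bsub>A\<^esub> z = (\<Oplus>\<^bsub>A\<^esub>i\<in>J. (w i \<odot>\<^bsub>A\<^esub> g i) \<otimes>\<^bsub>A\<^esub> z)"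
    using assms by (intro A.finsum_ldistr) auto
  also have "\<dots> = (\<Oplus>\<^bsub>A\<^esub>i\<in>J. w i \<odot>\<^bsub>A\<^esub> (g i \<otimes>\<^bsub>A\<^esub> z))"
    using assms by (intro M.finsum_cong') (auto simp: smult_mult_left)
  finally show ?thesis using assms by (simp add: coeff_finsum)
qed

lemma higher_cells_coeff:
  assumes "z \<in> higher_cells R A \<Lambda> gt T a l"
  shows "z \<in> carrier A" "\<And>p. \<lbrakk>p \<in> I; \<not> gt (fst p) l\<rbrakk> \<Longrightarrow> coeff p z = \<zero>"
proof -
  let ?S = "cell_basis {m \<in> \<Lambda>. gt m l} T a"
  obtain f where f: "f \<in> ?S \<rightarrow> carrier R" "z = (\<Oplus>\<^bsub>A\<^esub>b\<in>?S. f b \<odot>\<^bsub>A\<^esub> b)"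
    using assms unfolding higher_cells_def lin_span_def by auto
  have S: "?S \<subseteq> cell_basis \<Lambda> T a"
    unfolding cell_basis_def by (rule image_mono) (auto simp: cell_index_def)
  then have SA: "?S \<subseteq> carrier A" "finite ?S"
    using basis_closed[OF basis] basis_finite[OF basis] finite_subset by auto
  show "z \<in> carrier A"
    unfolding f(2) using f(1) SA(1)[THEN subsetD] by (intro M.finsum_closed) (simp add: Pi_iff)
  fix p assume p: "p \<in> I" "\<not> gt (fst p) l"
  have "coeff p b = \<zero>" if "b \<in> ?S" for b
    using that p coeff_a[of p] by (auto simp: cell_basis_def cell_index_def)
  then have "(\<Oplus>b\<in>?S. f b \<otimes> coeff p b) = (\<Oplus>b\<in>?S. \<zero>)"
    using f(1) by (intro R.finsum_cong') (simp_all add: Pi_iff)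
  moreover have "coeff p z = (\<Oplus>b\<in>?S. f b \<otimes> coeff p b)"
    unfolding f(2) using f(1) SA(1)[THEN subsetD] SA(2) p by (intro coeff_finsum) (simp_all add: Pi_iff)
  ultimately show "coeff p z = \<zero>" by simp
qed

lemma coeff_row:
  assumes l: "l \<in> \<Lambda>" "s \<in> T l" and p: "(m, u, w) \<in> I"
    and r: "\<And>v. v \<in> V \<Longrightarrow> r v \<in> carrier R" and V: "V \<subseteq> T l"
  shows "coeff (m, u, w) (\<Oplus>\<^bsub>A\<^esub>v\<in>V. r v \<odot>\<^bsub>A\<^esub> a l s v) = (if m = l \<and> u = s \<and> w \<in> V then r w else \<zero>)"
proof -
  have fin: "finite V" using finite_T[OF l(1)] V finite_subset by blast
  have "coeff (m, u, w) (\<Oplus>\<^bsub>A\<^esub>v\<in>V. r v \<odot>\<^bsub>A\<^esub> a l s v) = (\<Oplus>v\<in>V. r v \<otimes> coeff (m, u, w) (a l s v))"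
    using p fin r l V a_closed by (intro coeff_finsum) auto
  also have "\<dots> = (\<Oplus>v\<in>V. if w = v then (if m = l \<and> u = s then r v else \<zero>) else \<zero>)"
    using p l r V coeff_a by (intro R.finsum_cong') (auto simp: subset_iff)
  also have "\<dots> = (if m = l \<and> u = s \<and> w \<in> V then r w else \<zero>)"
  proof (cases "w \<in> V")
    case True
    then show ?thesis using fin r by (subst R.finsum_singleton) auto
  next
    case False
    then have "(\<Oplus>v\<in>V. if w = v then (if m = l \<and> u = s then r v else \<zero>) else \<zero>) = (\<Oplus>v\<in>V. \<zero>)"
      by (intro R.finsum_cong') auto
    then show ?thesis using False by simp
  qed
  finally show ?thesis .
qed

lemma row_closed:
  assumes "l \<in> \<Lambda>" "s \<in> T l" "\<And>v. v \<in> V \<Longrightarrow> r v \<in> carrier R" "V \<subseteq> T l"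
  shows "(\<Oplus>\<^bsub>A\<^esub>v\<in>V. r v \<odot>\<^bsub>A\<^esub> a l s v) \<in> carrier A"
  using assms a_closed by (intro M.finsum_closed) (auto simp: subset_iff)

lemma coeff_cong_higher:
  assumes "x \<in> carrier A" "y \<in> carrier A" "x \<ominus>\<^bsub>A\<^esub> y \<in> higher_cells R A \<Lambda> gt T a l"
    "p \<in> I" "\<not> gt (fst p) l"
  shows "coeff p x = coeff p y"
  using higher_cells_coeff(2)[OF assms(3-5)] coeff_minus[OF assms(4,1,2)] coeff_closed assms by simp

text \<open>
  The multiplication rule of a cellular basis in terms of coefficients.  That \<open>r\<close> does not depend
  on \<open>s\<close> is what makes \<open>form\<close> below well defined.
\<close>

lemma cell_right:
  assumes "x \<in> carrier A" "l \<in> \<Lambda>" "t \<in> T l"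
  obtains r where "r \<in> T l \<rightarrow> carrier R"
    "\<And>m u v s. \<lbrakk>(m, u, v) \<in> I; \<not> gt m l; s \<in> T l\<rbrakk>
      \<Longrightarrow> coeff (m, u, v) (a l s t \<otimes>\<^bsub>A\<^esub> x) = (if m = l \<and> u = s then r v else \<zero>)"
proof -
  obtain r where r: "r \<in> T l \<rightarrow> carrier R" "\<And>s. s \<in> T l \<Longrightarrow>
          (a l s t \<otimes>\<^bsub>A\<^esub> x) \<ominus>\<^bsub>A\<^esub> (\<Oplus>\<^bsub>A\<^esub>v\<in>T l. r v \<odot>\<^bsub>A\<^esub> a l s v) \<in> higher_cells R A \<Lambda> gt T a l"
    using cell_mult[OF assms] by blast
  show thesis
  proof (rule that[OF r(1)])
    fix m u v s assume p: "(m, u, v) \<in> I" "\<not> gt m l" "s \<in> T l"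
    have "coeff (m, u, v) (a l s t \<otimes>\<^bsub>A\<^esub> x) = coeff (m, u, v) (\<Oplus>\<^bsub>A\<^esub>v\<in>T l. r v \<odot>\<^bsub>A\<^esub> a l s v)"
      using p r assms a_closed by (intro coeff_cong_higher[OF _ row_closed r(2)]) auto
    then show "coeff (m, u, v) (a l s t \<otimes>\<^bsub>A\<^esub> x) = (if m = l \<and> u = s then r v else \<zero>)"
      using coeff_row[OF assms(2) p(3,1) _ order_refl, of r] p r(1) by (auto simp: I_iff Pi_iff)
  qed
qed

lemma cell_right_zero:
  assumes "x \<in> carrier A" "l \<in> \<Lambda>" "s \<in> T l" "t \<in> T l" "(m, u, v) \<in> I" "\<not> gt m l" "\<not> (m = l \<and> u = s)"
  shows "coeff (m, u, v) (a l s t \<otimes>\<^bsub>A\<^esub> x) = \<zero>"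
  by (rule cell_right[OF assms(1,2,4)]) (use assms in auto)

lemma not_gt_refl: "l \<in> \<Lambda> \<Longrightarrow> \<not> gt l l"
  using irreflp_onD[OF finite_poset(2)] by blast

lemma cell_right_indep:
  assumes "x \<in> carrier A" "l \<in> \<Lambda>" "s \<in> T l" "s' \<in> T l" "t \<in> T l" "v \<in> T l"
  shows "coeff (l, s, v) (a l s t \<otimes>\<^bsub>A\<^esub> x) = coeff (l, s', v) (a l s' t \<otimes>\<^bsub>A\<^esub> x)"
  by (rule cell_right[OF assms(1,2,5)]) (use assms not_gt_refl in \<open>auto simp: I_iff\<close>)

lemma star_closed: "x \<in> carrier A \<Longrightarrow> star x \<in> carrier A"
  using star_bij by (auto simp: bij_betw_def)

lemma coeff_star:
  assumes "x \<in> carrier A" "(m, u, v) \<in> I"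
  shows "coeff (m, u, v) (star x) = coeff (m, v, u) x"
  using assms(1)
proof (induction rule: cell_induct)
  case zero
  have "star \<zero>\<^bsub>A\<^esub> = \<zero>\<^bsub>A\<^esub>" using star_smult[of \<zero> "\<zero>\<^bsub>A\<^esub>"] star_closed by simp
  then show ?case using assms by (simp add: coeff_zero I_iff)
next
  case (step r l s t y)
  have vu: "(m, v, u) \<in> I" using assms by (simp add: I_iff)
  have "coeff (m, u, v) (a l t s) = coeff (m, v, u) (a l s t)"
    using step assms vu by (auto simp: coeff_a)
  then show ?case
    using step assms vu a_closed star_closed
    by (simp add: star_add star_smult star_cell coeff_add coeff_smult)
qed

text \<open>
  The anti-automorphism turns left multiplication into right multiplication; the two lemmas after
  this one are the mirror images of those for right multiplication.
\<close>

lemma coeff_mult_star: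
  assumes "x \<in> carrier A" "l \<in> \<Lambda>" "s \<in> T l" "t \<in> T l" "(m, u, v) \<in> I"
  shows "coeff (m, u, v) (x \<otimes>\<^bsub>A\<^esub> a l s t) = coeff (m, v, u) (a l t s \<otimes>\<^bsub>A\<^esub> star x)"
proof -
  have "a l t s \<otimes>\<^bsub>A\<^esub> star x = star (x \<otimes>\<^bsub>A\<^esub> a l s t)"
    using assms a_closed by (simp add: star_mult star_cell)
  then show ?thesis using assms a_closed by (simp add: coeff_star I_iff)
qed

lemma cell_left_zero:
  assumes "x \<in> carrier A" "l \<in> \<Lambda>" "s \<in> T l" "t \<in> T l" "(m, u, v) \<in> I" "\<not> gt m l" "\<not> (m = l \<and> v = t)"
  shows "coeff (m, u, v) (x \<otimes>\<^bsub>A\<^esub> a l s t) = \<zero>"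
  using assms by (simp add: coeff_mult_star cell_right_zero star_closed I_iff)

lemma cell_left_indep:
  assumes "x \<in> carrier A" "l \<in> \<Lambda>" "s \<in> T l" "t \<in> T l" "t' \<in> T l" "u \<in> T l"
  shows "coeff (l, u, t) (x \<otimes>\<^bsub>A\<^esub> a l s t) = coeff (l, u, t') (x \<otimes>\<^bsub>A\<^esub> a l s t')"
  using assms cell_right_indep[of "star x" l t t' s u] by (simp add: coeff_mult_star star_closed I_iff)

text \<open>
  The value of the bilinear form of the cell module is read off at one particular coefficient;
  \<open>coeff_product\<close> shows that every other choice would give the same.
\<close>

definition form :: "'l \<Rightarrow> 't \<Rightarrow> 't \<Rightarrow> 'r"
  where "form l t u = coeff (l, t, t) (a l t t \<otimes>\<^bsub>A\<^esub> a l u t)"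

lemma form_closed: "\<lbrakk>l \<in> \<Lambda>; t \<in> T l; u \<in> T l\<rbrakk> \<Longrightarrow> form l t u \<in> carrier R"
  unfolding form_def by (intro coeff_closed) (auto simp: I_iff a_closed)

text \<open>
  Right multiplication preserves the first index and left multiplication the last one, so only
  \<open>a l s v\<close> can occur modulo higher cells.  Its coefficient depends neither on \<open>s\<close> nor on \<open>v\<close>.
\<close>

lemma coeff_product:
  assumes l: "l \<in> \<Lambda>" "s \<in> T l" "t \<in> T l" "u \<in> T l" "v \<in> T l" and p: "(m, w, z) \<in> I" "\<not> gt m l"
  shows "coeff (m, w, z) (a l s t \<otimes>\<^bsub>A\<^esub> a l u v) = (if (m, w, z) = (l, s, v) then form l t u else \<zero>)"
proof (cases "(m, w, z) = (l, s, v)")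
  case True
  have "coeff (l, s, v) (a l s t \<otimes>\<^bsub>A\<^esub> a l u v) = coeff (l, t, v) (a l t t \<otimes>\<^bsub>A\<^esub> a l u v)"
    using l a_closed by (intro cell_right_indep) auto
  also have "\<dots> = form l t u"
    unfolding form_def using l a_closed by (intro cell_left_indep) auto
  finally show ?thesis using True by simp
next
  case False
  have c: "a l s t \<in> carrier A" "a l u v \<in> carrier A" using l a_closed by auto
  have "coeff (m, w, z) (a l s t \<otimes>\<^bsub>A\<^esub> a l u v) = \<zero>"
  proof (cases "m = l \<and> w = s")
    case True
    then show ?thesis using False by (intro cell_left_zero[OF c(1) l(1,4,5) p]) simp
  next
    case False
    then show ?thesis by (rule cell_right_zero[OF c(2) l(1-3) p])
  qed
  then show ?thesis by (simp only: if_not_P[OF False])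
qed

text \<open>
  The product lies in the ideals generated by both cells.  Modulo the cells above \<open>l\<close> only the cell \<open>l\<close>
  itself could remain, and that would require \<open>l > m\<close>.
\<close>

lemma coeff_product_distinct:
  assumes l: "l \<in> \<Lambda>" "s \<in> T l" "t \<in> T l" and m: "m \<in> \<Lambda>" "u \<in> T m" "v \<in> T m"
    and ne: "l \<noteq> m" "\<not> gt l m" and p: "(n, w, z) \<in> I" "\<not> gt n l"
  shows "coeff (n, w, z) (a l s t \<otimes>\<^bsub>A\<^esub> a m u v) = \<zero>"
proof (cases "n = l")
  case True
  then show ?thesis using ne by (intro cell_left_zero a_closed l m p) auto
next
  case False
  then show ?thesis by (intro cell_right_zero a_closed l m p) auto
qed

end

section \<open>Nondegeneracy of the forms\<close>

text \<open>
  Gaussian elimination with cross-multiplication in place of division: a pivot \<open>\<phi> s0 t0\<close> removes the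
  unknown \<open>s0\<close> and the equation \<open>t0\<close>.
\<close>

lemma (in domain) underdetermined_system:
  assumes "finite T" "finite S" "card T < card S"
    and "\<And>s t. \<lbrakk>s \<in> S; t \<in> T\<rbrakk> \<Longrightarrow> \<phi> s t \<in> carrier R"
  shows "\<exists>w \<in> S \<rightarrow> carrier R. (\<exists>s\<in>S. w s \<noteq> \<zero>) \<and> (\<forall>t\<in>T. (\<Oplus>s\<in>S. w s \<otimes> \<phi> s t) = \<zero>)"
  using assms
proof (induction T arbitrary: S \<phi> rule: finite_induct)
  case empty
  then have "S \<noteq> {}" by auto
  then show ?case by (intro bexI[of _ "\<lambda>_. \<one>"]) auto
next
  case (insert t0 T)
  show ?case
  proof (cases "\<forall>s\<in>S. \<phi> s t0 = \<zero>")
    case True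
    obtain w where w: "w \<in> S \<rightarrow> carrier R" "\<exists>s\<in>S. w s \<noteq> \<zero>" "\<forall>t\<in>T. (\<Oplus>s\<in>S. w s \<otimes> \<phi> s t) = \<zero>"
      using insert.IH[of S \<phi>] insert.prems insert.hyps by auto
    have "(\<Oplus>s\<in>S. w s \<otimes> \<phi> s t0) = (\<Oplus>s\<in>S. \<zero>)"
      using True w(1) by (intro finsum_cong') (simp_all add: Pi_iff)
    then show ?thesis using w by auto
  next
    case False
    then obtain s0 where s0: "s0 \<in> S" "\<phi> s0 t0 \<noteq> \<zero>" by auto
    define S' where "S' = S - {s0}"
    have S': "finite S'" "s0 \<notin> S'" "S = insert s0 S'" "card T < card S'"
      using insert s0 by (auto simp: S'_def)
    have c: "\<phi> s t \<in> carrier R" if "s \<in> S" "t \<in> insert t0 T" for s t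
      using that insert.prems by auto
    define \<psi> where "\<psi> s t = \<phi> s0 t0 \<otimes> \<phi> s t \<ominus> \<phi> s t0 \<otimes> \<phi> s0 t" for s t
    have \<psi>: "\<psi> s t \<in> carrier R" if "s \<in> S'" "t \<in> insert t0 T" for s t
      using that c S' by (simp add: \<psi>_def)
    obtain w where w: "w \<in> S' \<rightarrow> carrier R" "\<exists>s\<in>S'. w s \<noteq> \<zero>" "\<forall>t\<in>T. (\<Oplus>s\<in>S'. w s \<otimes> \<psi> s t) = \<zero>"
      using insert.IH[of S' \<psi>] S' \<psi> by blast
    have wc: "w s \<in> carrier R" if "s \<in> S'" for s using w(1) that by auto
    have \<psi>_sum: "(\<Oplus>s\<in>S'. w s \<otimes> \<psi> s t) = \<zero>" if "t \<in> insert t0 T" for t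
    proof (cases "t = t0")
      case True
      have "(\<Oplus>s\<in>S'. w s \<otimes> \<psi> s t) = (\<Oplus>s\<in>S'. \<zero>)"
        using wc c S'(3) True by (intro finsum_cong') (simp_all add: \<psi>_def m_comm a_minus_def r_neg)
      then show ?thesis by simp
    qed (use that w in auto)
      \<comment> \<open>The equation at \<open>t0\<close> determines the coefficient of the pivot row.\<close>
  define g where "g = (\<Oplus>s\<in>S'. w s \<otimes> \<phi> s t0)"
    define u where "u s = (if s = s0 then \<ominus> g else w s \<otimes> \<phi> s0 t0)" for s
    have g: "g \<in> carrier R" unfolding g_def using wc c S'(3) by (intro finsum_closed) auto
    have u: "u s \<in> carrier R" if "s \<in> S" for s
      using that g wc c s0(1) S'(3) by (auto simp: u_def)
    have "(\<Oplus>s\<in>S. u s \<otimes> \<phi> s t) = \<zero>" if t: "t \<in> insert t0 T" for t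
    proof -
      have ct: "\<phi> s t \<in> carrier R" "\<phi> s t0 \<in> carrier R" if "s \<in> S" for s using c that t by auto
      have "(\<Oplus>s\<in>S'. u s \<otimes> \<phi> s t) = (\<Oplus>s\<in>S'. w s \<otimes> \<psi> s t \<oplus> (w s \<otimes> \<phi> s t0) \<otimes> \<phi> s0 t)"
      proof (intro finsum_cong')
        fix s assume s: "s \<in> S'"
        have k: "w s \<in> carrier R" "\<phi> s t \<in> carrier R" "\<phi> s t0 \<in> carrier R" "\<phi> s0 t \<in> carrier R" "\<phi> s0 t0 \<in> carrier R"
          using wc ct s s0 S' by auto
        have "u s = w s \<otimes> \<phi> s0 t0" using s S'(2) by (auto simp: u_def)
        moreover have "(w s \<otimes> \<phi> s0 t0) \<otimes> \<phi> s t = w s \<otimes> \<psi> s t \<oplus> (w s \<otimes> \<phi> s t0) \<otimes> \<phi> s0 t"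
          unfolding \<psi>_def using k by algebra
        ultimately show "u s \<otimes> \<phi> s t = w s \<otimes> \<psi> s t \<oplus> (w s \<otimes> \<phi> s t0) \<otimes> \<phi> s0 t" by simp
      qed (use wc ct \<psi> t s0(1) S'(3) in auto)
      also have "\<dots> = (\<Oplus>s\<in>S'. w s \<otimes> \<psi> s t) \<oplus> (\<Oplus>s\<in>S'. (w s \<otimes> \<phi> s t0) \<otimes> \<phi> s0 t)"
        using wc ct \<psi> t s0(1) S'(3) by (intro finsum_addf) auto
      also have "(\<Oplus>s\<in>S'. (w s \<otimes> \<phi> s t0) \<otimes> \<phi> s0 t) = g \<otimes> \<phi> s0 t"
        unfolding g_def using wc ct S' by (intro finsum_ldistr[symmetric]) auto
      finally have "(\<Oplus>s\<in>S'. u s \<otimes> \<phi> s t) = g \<otimes> \<phi> s0 t"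
        using \<psi>_sum[OF t] g ct s0(1) by simp
      moreover have "(\<Oplus>s\<in>S. u s \<otimes> \<phi> s t) = u s0 \<otimes> \<phi> s0 t \<oplus> (\<Oplus>s\<in>S'. u s \<otimes> \<phi> s t)"
        unfolding S'(3) using u ct S' by (intro finsum_insert) auto
      ultimately show ?thesis using g ct s0(1) by (simp add: u_def l_minus l_neg)
    qed
    moreover have "\<exists>s\<in>S. u s \<noteq> \<zero>"
    proof -
      obtain s where s: "s \<in> S'" "w s \<noteq> \<zero>" using w(2) by auto
      have "w s \<otimes> \<phi> s0 t0 \<noteq> \<zero>" using s s0 wc c integral by blast
      then show ?thesis using s S' by (intro bexI[of _ s]) (auto simp: u_def)
    qed
    ultimately show ?thesis using u by (intro bexI[of _ u]) auto
  qed
qed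

text \<open>
  Adjoin to the rows of \<open>\<phi>\<close> the negative of the unit vector at \<open>x\<close>.  There are then more rows than
  columns, so the rows are linearly dependent; the coefficient \<open>d\<close> of the additional row is not
  zero because the rows of \<open>\<phi>\<close> are independent.
\<close>

lemma (in domain) scaled_dual_vector:
  assumes fin: "finite T" and closed: "\<And>s t. \<lbrakk>s \<in> T; t \<in> T\<rbrakk> \<Longrightarrow> \<phi> s t \<in> carrier R"
    and nondeg: "\<And>w. \<lbrakk>w \<in> T \<rightarrow> carrier R; \<And>t. t \<in> T \<Longrightarrow> (\<Oplus>s\<in>T. w s \<otimes> \<phi> s t) = \<zero>\<rbrakk>
      \<Longrightarrow> \<forall>s\<in>T. w s = \<zero>"
    and x: "x \<in> T"
  obtains w d where "w \<in> T \<rightarrow> carrier R" "d \<in> carrier R" "d \<noteq> \<zero>"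
    "\<And>t. t \<in> T \<Longrightarrow> (\<Oplus>s\<in>T. w s \<otimes> \<phi> s t) = (if t = x then d else \<zero>)"
proof -
  define \<psi> where "\<psi> s t = (case s of None \<Rightarrow> if t = x then \<ominus> \<one> else \<zero> | Some s \<Rightarrow> \<phi> s t)" for s t
  have \<psi>: "\<psi> s t \<in> carrier R" if "s \<in> insert None (Some ` T)" "t \<in> T" for s t
    using that closed by (auto simp: \<psi>_def)
  have "card T < card (insert None (Some ` T))"
    using fin by (simp add: card_image)
  then obtain v where v: "v \<in> insert None (Some ` T) \<rightarrow> carrier R" "\<exists>s\<in>insert None (Some ` T). v s \<noteq> \<zero>"
      "\<And>t. t \<in> T \<Longrightarrow> (\<Oplus>s\<in>insert None (Some ` T). v s \<otimes> \<psi> s t) = \<zero>"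
    using underdetermined_system[of T "insert None (Some ` T)" \<psi>] fin \<psi> by blast
  define w where "w s = v (Some s)" for s
  define d where "d = v None"
  have w: "w \<in> T \<rightarrow> carrier R" and d: "d \<in> carrier R" using v(1) by (auto simp: w_def d_def)
  have sum: "(\<Oplus>s\<in>T. w s \<otimes> \<phi> s t) = (if t = x then d else \<zero>)" if t: "t \<in> T" for t
  proof -
    have cl: "v s \<otimes> \<psi> s t \<in> carrier R" if "s \<in> insert None (Some ` T)" for s
      using that v(1) \<psi>[OF _ t] by auto
    have "\<zero> = v None \<otimes> \<psi> None t \<oplus> (\<Oplus>s\<in>Some ` T. v s \<otimes> \<psi> s t)"
      using v(3)[OF t] fin cl by (subst (asm) finsum_insert) auto
    also have "(\<Oplus>s\<in>Some ` T. v s \<otimes> \<psi> s t) = (\<Oplus>s\<in>T. v (Some s) \<otimes> \<psi> (Some s) t)"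
      using cl by (intro finsum_reindex) auto
    also have "\<dots> = (\<Oplus>s\<in>T. w s \<otimes> \<phi> s t)" by (simp add: w_def \<psi>_def)
    finally have *: "\<zero> = d \<otimes> \<psi> None t \<oplus> (\<Oplus>s\<in>T. w s \<otimes> \<phi> s t)" by (simp add: d_def)
    define tot where "tot = (\<Oplus>s\<in>T. w s \<otimes> \<phi> s t)"
    have tot: "tot \<in> carrier R" unfolding tot_def using w closed t by (intro finsum_closed) auto
    show ?thesis
    proof (cases "t = x")
      case True
      then have "\<ominus> d \<oplus> tot = \<zero>" using * d by (simp add: \<psi>_def r_minus tot_def)
      then have "d \<oplus> (\<ominus> d \<oplus> tot) = d" using d by simp
      then show ?thesis using True r_neg2[OF d tot] unfolding tot_def by simp
    next
      case False
      then show ?thesis using * tot d by (simp add: \<psi>_def tot_def)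
    qed
  qed
  have "d \<noteq> \<zero>"
  proof
    assume "d = \<zero>"
    then have "\<forall>s\<in>T. w s = \<zero>" using sum by (intro nondeg w) simp
    then show False using v(2) \<open>d = \<zero>\<close> by (auto simp: w_def d_def)
  qed
  then show thesis using that w d sum by blast
qed

locale separated_jm_family = jm_family R A \<Lambda> gt T a star sdom M L c + R: domain R
  for R :: "('r, 'x) ring_scheme" (structure) and A :: "('r, 'a, 'y) module_scheme" (structure)
    and \<Lambda> :: "'l set" and gt and T :: "'l \<Rightarrow> 't set" and a star sdom M L
    and c :: "'l \<times> 't \<Rightarrow> nat \<Rightarrow> 'r" +
  assumes separates: "jm_separates \<Lambda> gt T sdom M c"
begin

text \<open>
  The indices that can occur in \<open>a m u t \<otimes> L i\<close>: right multiplication preserves the index \<open>u\<close> within the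
  cell \<open>m\<close>, and moves \<open>t\<close> upwards.
\<close>

definition index_ge :: "'l \<times> 't \<times> 't \<Rightarrow> 'l \<times> 't \<times> 't \<Rightarrow> bool"
  where "index_ge = (\<lambda>(n, w, v) (m, u, t). gt n m \<or> (n = m \<and> w = u \<and> (v = t \<or> sdom n v t)))"

lemma not_sdom_refl: "\<lbrakk>l \<in> \<Lambda>; t \<in> T l\<rbrakk> \<Longrightarrow> \<not> sdom l t t"
  using irreflp_onD[OF dom_order(1)] by blast

lemma gt_trans: "\<lbrakk>l \<in> \<Lambda>; m \<in> \<Lambda>; n \<in> \<Lambda>; gt l m; gt m n\<rbrakk> \<Longrightarrow> gt l n"
  using transp_onD[OF finite_poset(3)] by blast

lemma sdom_trans: "\<lbrakk>l \<in> \<Lambda>; s \<in> T l; t \<in> T l; u \<in> T l; sdom l s t; sdom l t u\<rbrakk> \<Longrightarrow> sdom l s u"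
  using transp_onD[OF dom_order(2)] by blast

lemma index_ge_trans: "\<lbrakk>p \<in> I; q \<in> I; r \<in> I; index_ge p q; index_ge q r\<rbrakk> \<Longrightarrow> index_ge p r"
  by (auto simp: index_ge_def I_iff intro: gt_trans sdom_trans)

lemma index_ge_antisym: "\<lbrakk>p \<in> I; q \<in> I; index_ge p q; index_ge q p\<rbrakk> \<Longrightarrow> p = q"
  using gt_trans[of "fst p" "fst q" "fst p"] not_gt_refl[of "fst p"]
    sdom_trans[of "fst p" "snd (snd p)" "snd (snd q)" "snd (snd p)"] not_sdom_refl[of "fst p" "snd (snd p)"]
  by (cases p; cases q) (auto simp: index_ge_def I_iff)

lemma jm_coeff:
  assumes i: "i \<in> {1..M}" and p: "(l, s, t) \<in> I" and q: "q \<in> I"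
    and "index_ge q (l, s, t) \<Longrightarrow> q = (l, s, t)"
  shows "coeff q (a l s t \<otimes>\<^bsub>A\<^esub> L i) = (if q = (l, s, t) then c (l, t) i else \<zero>)"
proof -
  have l: "l \<in> \<Lambda>" "s \<in> T l" "t \<in> T l" using p by (auto simp: I_iff)
  obtain n w v where nwv: "q = (n, w, v)" using prod_cases3 by blast
  have ngt: "\<not> gt n l" using assms(4) not_gt_refl[OF l(1)] by (auto simp: nwv index_ge_def)
  obtain r where r: "r \<in> T l \<rightarrow> carrier R" "\<And>s. s \<in> T l \<Longrightarrow>
          (a l s t \<otimes>\<^bsub>A\<^esub> L i) \<ominus>\<^bsub>A\<^esub>
            (c (l, t) i \<odot>\<^bsub>A\<^esub> a l s t \<oplus>\<^bsub>A\<^esub> (\<Oplus>\<^bsub>A\<^esub>v\<in>{v \<in> T l. sdom l v t}. r v \<odot>\<^bsub>A\<^esub> a l s v))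
            \<in> higher_cells R A \<Lambda> gt T a l"
    using L_triangular[OF i l(1,3)] by blast
  let ?row = "\<Oplus>\<^bsub>A\<^esub>v\<in>{v \<in> T l. sdom l v t}. r v \<odot>\<^bsub>A\<^esub> a l s v"
  have rc: "r v \<in> carrier R" if "v \<in> T l" for v using that r(1) by auto
  have row: "?row \<in> carrier A" using l rc by (intro row_closed) auto
  have cc: "c (l, t) i \<in> carrier R" using c_closed i l by auto
  have al: "a l s t \<in> carrier A" "L i \<in> carrier A" using l i a_closed L_closed by auto
  have "coeff q (a l s t \<otimes>\<^bsub>A\<^esub> L i) = coeff q (c (l, t) i \<odot>\<^bsub>A\<^esub> a l s t \<oplus>\<^bsub>A\<^esub> ?row)"
    by (rule coeff_cong_higher[OF _ _ r(2)[OF l(2)] q]) (use row cc al ngt nwv in auto)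
  also have "\<dots> = c (l, t) i \<otimes> coeff q (a l s t) \<oplus> coeff q ?row"
    using q row cc al by (simp add: coeff_add coeff_smult)
  also have "coeff q ?row = \<zero>"
  proof -
    have "\<not> (n = l \<and> w = s \<and> v \<in> {v \<in> T l. sdom l v t})"
    proof
      assume *: "n = l \<and> w = s \<and> v \<in> {v \<in> T l. sdom l v t}"
      then have "index_ge q (l, s, t)" by (simp add: nwv index_ge_def)
      then have "v = t" using assms(4) nwv by simp
      then show False using * not_sdom_refl[OF l(1,3)] by simp
    qed
    moreover have "coeff q ?row = (if n = l \<and> w = s \<and> v \<in> {v \<in> T l. sdom l v t} then r v else \<zero>)"
      unfolding nwv by (rule coeff_row) (use l q rc nwv in simp_all)
    ultimately show ?thesis by (simp only: if_False)
  qed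
  finally show ?thesis using cc q l by (simp add: coeff_a)
qed

text \<open>
  Coefficients only move upwards under multiplication by \<open>L i\<close>.  If \<open>y\<close> has no coefficients strictly
  below an index, then nothing flows into this index and its coefficient is multiplied by the
  diagonal entry.
\<close>

lemma jm_diagonal:
  assumes i: "i \<in> {1..M}" and y: "y \<in> carrier A" and q: "(n, w, v) \<in> I"
    and van: "\<And>p. \<lbrakk>p \<in> I; index_ge (n, w, v) p; p \<noteq> (n, w, v)\<rbrakk> \<Longrightarrow> coeff p y = \<zero>"
  shows "coeff (n, w, v) (y \<otimes>\<^bsub>A\<^esub> L i) = coeff (n, w, v) y \<otimes> c (n, v) i"
  using y
proof (induction rule: cell_induct)
  case zero
  then show ?case using q i L_closed c_closed by (simp add: coeff_zero I_iff)
next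
  case (step r l s t z)
  have p: "(l, s, t) \<in> I" using step by (simp add: I_iff)
  have cl: "a l s t \<in> carrier A" "L i \<in> carrier A" "c (n, v) i \<in> carrier R"
    using step a_closed L_closed c_closed i q by (auto simp: I_iff)
  have "coeff (n, w, v) (a l s t \<otimes>\<^bsub>A\<^esub> L i) = (if (n, w, v) = (l, s, t) then c (l, t) i else \<zero>)"
    using van[OF p] step(5) by (intro jm_coeff[OF i p q]) auto
  then have "coeff (n, w, v) (a l s t \<otimes>\<^bsub>A\<^esub> L i) = coeff (n, w, v) (a l s t) \<otimes> c (n, v) i"
    using q step cl by (auto simp: coeff_a)
  moreover have "coeff (n, w, v) ((r \<odot>\<^bsub>A\<^esub> a l s t \<oplus>\<^bsub>A\<^esub> z) \<otimes>\<^bsub>A\<^esub> L i)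
      = r \<otimes> coeff (n, w, v) (a l s t \<otimes>\<^bsub>A\<^esub> L i) \<oplus> coeff (n, w, v) (z \<otimes>\<^bsub>A\<^esub> L i)"
    using step cl q by (simp add: A.l_distr smult_mult_left coeff_add coeff_smult)
  moreover have "coeff (n, w, v) (r \<odot>\<^bsub>A\<^esub> a l s t \<oplus>\<^bsub>A\<^esub> z) = r \<otimes> coeff (n, w, v) (a l s t) \<oplus> coeff (n, w, v) z"
    using step cl q by (simp add: coeff_add coeff_smult)
  ultimately show ?case
    using step cl q coeff_closed by (simp add: R.l_distr R.m_assoc)
qed

definition factor :: "nat \<Rightarrow> 'r \<Rightarrow> 'a" where "factor i k = L i \<ominus>\<^bsub>A\<^esub> k \<odot>\<^bsub>A\<^esub> \<one>\<^bsub>A\<^esub>"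

lemma factor_closed: "\<lbrakk>i \<in> {1..M}; k \<in> carrier R\<rbrakk> \<Longrightarrow> factor i k \<in> carrier A"
  using L_closed by (simp add: factor_def)

lemma factor_diagonal:
  assumes i: "i \<in> {1..M}" and k: "k \<in> carrier R" and y: "y \<in> carrier A" and q: "(n, w, v) \<in> I"
    and van: "\<And>p. \<lbrakk>p \<in> I; index_ge (n, w, v) p; p \<noteq> (n, w, v)\<rbrakk> \<Longrightarrow> coeff p y = \<zero>"
  shows "coeff (n, w, v) (y \<otimes>\<^bsub>A\<^esub> factor i k) = coeff (n, w, v) y \<otimes> (c (n, v) i \<ominus> k)"
proof -
  have L: "L i \<in> carrier A" "c (n, v) i \<in> carrier R" using i L_closed c_closed q by (auto simp: I_iff)
  have cq: "coeff (n, w, v) y \<in> carrier R" using coeff_closed q y by blast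
  have "y \<otimes>\<^bsub>A\<^esub> factor i k = y \<otimes>\<^bsub>A\<^esub> L i \<ominus>\<^bsub>A\<^esub> k \<odot>\<^bsub>A\<^esub> y"
    using y k L by (simp add: factor_def a_minus_def A.r_distr A.r_minus smult_mult_right)
  then have "coeff (n, w, v) (y \<otimes>\<^bsub>A\<^esub> factor i k) = coeff (n, w, v) y \<otimes> c (n, v) i \<ominus> k \<otimes> coeff (n, w, v) y"
    using y k L q jm_diagonal[OF i y q van] by (simp add: coeff_minus coeff_smult)
  also have "\<dots> = coeff (n, w, v) y \<otimes> (c (n, v) i \<ominus> k)"
    using cq k L by algebra
  finally show ?thesis .
qed

text \<open>
  The argument sketched at the top, with the row \<open>s\<close> of the cell \<open>l\<close> as a copy of the cell module:
  the vector \<open>w\<close> becomes the element \<open>x\<close>.  The factors of \<open>y\<close> are multiplied up one by one, for \<open>(m, t)\<close>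
  running through the cells below \<open>l\<close> from bottom to top.  This order ensures that the coefficients of
  \<open>y\<close> that have been made zero stay zero.
\<close>

lemma form_nondegenerate:
  assumes l: "l \<in> \<Lambda>" and w: "w \<in> T l \<rightarrow> carrier R"
    and ker: "\<And>t. t \<in> T l \<Longrightarrow> (\<Oplus>s\<in>T l. w s \<otimes> form l s t) = \<zero>"
  shows "\<forall>s\<in>T l. w s = \<zero>"
proof (rule ccontr)
  assume "\<not> (\<forall>s\<in>T l. w s = \<zero>)"
  then have ne: "{s \<in> T l. w s \<noteq> \<zero>} \<noteq> {}" by auto
  have wc: "w s \<in> carrier R" if "s \<in> T l" for s using w that by auto
  have tr: "transp_on {s \<in> T l. w s \<noteq> \<zero>} (\<lambda>x y. sdom l y x)"
    by (rule transp_onI) (use sdom_trans[OF l] in blast)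
  have as: "asymp_on {s \<in> T l. w s \<noteq> \<zero>} (\<lambda>x y. sdom l y x)"
    by (rule asymp_onI) (use sdom_trans[OF l] not_sdom_refl[OF l] in blast)
  have "finite {s \<in> T l. w s \<noteq> \<zero>}" using finite_T[OF l] by simp
  then obtain s where "s \<in> {s \<in> T l. w s \<noteq> \<zero>}"
      "\<And>v. v \<in> {s \<in> T l. w s \<noteq> \<zero>} \<Longrightarrow> v \<noteq> s \<Longrightarrow> \<not> sdom l s v"
    using Finite_Set.bex_min_element[OF _ as tr ne] by blast
  then have s: "s \<in> T l" "w s \<noteq> \<zero>" and s_min: "\<And>v. \<lbrakk>v \<in> T l; sdom l s v\<rbrakk> \<Longrightarrow> w v = \<zero>"
    using not_sdom_refl[OF l] by blast+
  define x where "x = (\<Oplus>\<^bsub>A\<^esub>v\<in>T l. w v \<odot>\<^bsub>A\<^esub> a l s v)"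
  have x: "x \<in> carrier A" unfolding x_def using l s wc by (intro row_closed) auto
  have coeff_x: "coeff (m, u, v) x = (if m = l \<and> u = s \<and> v \<in> T l then w v else \<zero>)" if "(m, u, v) \<in> I" for m u v
    unfolding x_def using l s wc that by (intro coeff_row) auto
  let ?q = "(l, s, s)"
  have q: "?q \<in> I" using l s by (simp add: I_iff)
  \<comment> \<open>The pairs whose contents have to be cancelled by factors of \<open>y\<close>.\<close>
  define low where "low = {(m, t). m \<in> \<Lambda> \<and> t \<in> T m \<and> gt l m}"
  define below where "below = (\<lambda>p q. tableau_gt gt sdom q p)"
  have "low \<subseteq> Sigma \<Lambda> T" by (auto simp: low_def)
  then have fin: "finite low" using finite_subset finite_poset(1) finite_T by blast
  have irr: "irreflp_on low below"
    by (rule irreflp_onI) (use not_gt_refl not_sdom_refl in \<open>auto simp: low_def below_def tableau_gt_def\<close>)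
  have trans: "transp_on low below"
    by (rule transp_onI) (auto simp: low_def below_def tableau_gt_def intro: gt_trans sdom_trans)
  have "\<exists>y\<in>carrier A. (\<forall>m u t. (m, u, t) \<in> I \<longrightarrow> (m, t) \<in> low \<longrightarrow> coeff (m, u, t) y = \<zero>) \<and>
      coeff ?q (x \<otimes>\<^bsub>A\<^esub> y) \<noteq> \<zero> \<and>
      (\<forall>p\<in>I. index_ge ?q p \<longrightarrow> p \<noteq> ?q \<longrightarrow> coeff p (x \<otimes>\<^bsub>A\<^esub> y) = \<zero>)"
    (is "?P low")
    using fin irr trans
  proof (rule finite_upset_induct[where P = ?P])
    have "coeff p x = \<zero>" if "p \<in> I" "index_ge ?q p" "p \<noteq> ?q" for p
      using that coeff_x s_min not_gt_refl[OF l] by (cases p) (auto simp: index_ge_def I_iff)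
    then show "?P {}" using x q coeff_x s by (intro bexI[of _ "\<one>\<^bsub>A\<^esub>"]) auto
  next
    fix D p0
    assume D: "D \<subseteq> low" and D_down: "\<And>m n. \<lbrakk>m \<in> D; n \<in> low; below n m\<rbrakk> \<Longrightarrow> n \<in> D"
      and p0: "p0 \<in> low" "p0 \<notin> D" and p0_down: "\<And>m. \<lbrakk>m \<in> low; below m p0\<rbrakk> \<Longrightarrow> m \<in> D"
      and IH: "?P D"
    obtain y where y: "y \<in> carrier A"
      and y0: "\<And>m u t. \<lbrakk>(m, u, t) \<in> I; (m, t) \<in> D\<rbrakk> \<Longrightarrow> coeff (m, u, t) y = \<zero>"
      and yq: "coeff ?q (x \<otimes>\<^bsub>A\<^esub> y) \<noteq> \<zero>"
      and yz: "\<And>p. \<lbrakk>p \<in> I; index_ge ?q p; p \<noteq> ?q\<rbrakk> \<Longrightarrow> coeff p (x \<otimes>\<^bsub>A\<^esub> y) = \<zero>"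
      using IH by blast
    obtain m0 t0 where mt: "p0 = (m0, t0)" "m0 \<in> \<Lambda>" "t0 \<in> T m0" "gt l m0"
      using p0(1) by (auto simp: low_def)
    obtain i where i: "i \<in> {1..M}" "c (l, s) i \<noteq> c (m0, t0) i"
      using separates l s mt unfolding jm_separates_def tableau_gt_def by fastforce
    define k where "k = c (m0, t0) i"
    have k: "k \<in> carrier R" "c (l, s) i \<in> carrier R" using c_closed i mt l s by (auto simp: k_def)
    define y' where "y' = y \<otimes>\<^bsub>A\<^esub> factor i k"
    have f: "factor i k \<in> carrier A" using factor_closed i k by blast
    have y': "y' \<in> carrier A" "x \<otimes>\<^bsub>A\<^esub> y' = x \<otimes>\<^bsub>A\<^esub> y \<otimes>\<^bsub>A\<^esub> factor i k"
      using x y f by (auto simp: y'_def A.m_assoc)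
    \<comment> \<open>For pairs in \<open>D\<close> the coefficients stay zero as all lower pairs are in \<open>D\<close> too; for \<open>p0\<close> the diagonal factor is zero.\<close>
    have vanish: "coeff (m, u, t) y' = \<zero>" if p: "(m, u, t) \<in> I" and "(m, t) \<in> insert p0 D" for m u t
    proof -
      have mlow: "(m, t) \<in> low" using that p0 D by auto
      have "coeff p y = \<zero>" if p': "p \<in> I" "index_ge (m, u, t) p" "p \<noteq> (m, u, t)" for p
      proof -
        obtain m' u' t' where [simp]: "p = (m', u', t')" using prod_cases3 by blast
        have "below (m', t') (m, t)" using p' by (auto simp: index_ge_def below_def tableau_gt_def)
        moreover have "(m', t') \<in> low"
          using p' p mlow gt_trans[OF l, of m m'] by (auto simp: low_def index_ge_def I_iff)
        ultimately have "(m', t') \<in> D"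
          using \<open>(m, t) \<in> insert p0 D\<close> D_down p0_down by blast
        then show ?thesis using y0 p' by simp
      qed
      then have "coeff (m, u, t) y' = coeff (m, u, t) y \<otimes> (c (m, t) i \<ominus> k)"
        unfolding y'_def by (intro factor_diagonal[OF i(1) k(1) y p]) auto
      moreover have "coeff (m, u, t) y \<in> carrier R" "c (m, t) i \<in> carrier R"
        using coeff_closed p y c_closed i by (auto simp: I_iff)
      moreover have "coeff (m, u, t) y = \<zero> \<or> c (m, t) i = k"
        using that y0 by (auto simp: mt k_def)
      ultimately show ?thesis using k by (auto simp: a_minus_def R.r_neg)
    qed
    have xy: "x \<otimes>\<^bsub>A\<^esub> y \<in> carrier A" using x y by simp
    have "coeff ?q (x \<otimes>\<^bsub>A\<^esub> y') = coeff ?q (x \<otimes>\<^bsub>A\<^esub> y) \<otimes> (c (l, s) i \<ominus> k)"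
      unfolding y'(2) using yz by (intro factor_diagonal[OF i(1) k(1) xy q]) auto
    moreover have "c (l, s) i \<ominus> k \<noteq> \<zero>" using i k by (simp add: k_def)
    ultimately have nz: "coeff ?q (x \<otimes>\<^bsub>A\<^esub> y') \<noteq> \<zero>"
      using yq R.integral[of "coeff ?q (x \<otimes>\<^bsub>A\<^esub> y)" "c (l, s) i \<ominus> k"] coeff_closed[OF q xy] k by auto
    have "coeff p (x \<otimes>\<^bsub>A\<^esub> y') = \<zero>" if p: "p \<in> I" "index_ge ?q p" "p \<noteq> ?q" for p
    proof -
      obtain m u t where [simp]: "p = (m, u, t)" using prod_cases3 by blast
      have "coeff r (x \<otimes>\<^bsub>A\<^esub> y) = \<zero>" if r: "r \<in> I" "index_ge p r" for r
        using yz[of r] index_ge_trans[OF q p(1) r(1) p(2) r(2)] index_ge_antisym[OF q p(1) p(2)] p r by blast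
      then have "coeff p (x \<otimes>\<^bsub>A\<^esub> y') = coeff p (x \<otimes>\<^bsub>A\<^esub> y) \<otimes> (c (m, t) i \<ominus> k)"
        unfolding y'(2) using p by (simp, intro factor_diagonal[OF i(1) k(1) xy]) auto
      moreover have "c (m, t) i \<in> carrier R" using p c_closed i by (auto simp: I_iff)
      ultimately show ?thesis using yz[OF p] k by simp
    qed
    then show "?P (insert p0 D)" using y' vanish nz by (intro bexI[of _ y']) auto
  qed
  then obtain y where y: "y \<in> carrier A"
    and y0: "\<And>m u t. \<lbrakk>(m, u, t) \<in> I; (m, t) \<in> low\<rbrakk> \<Longrightarrow> coeff (m, u, t) y = \<zero>"
    and yq: "coeff ?q (x \<otimes>\<^bsub>A\<^esub> y) \<noteq> \<zero>" by blast
  \<comment> \<open>What is left of \<open>y\<close> annihilates \<open>x\<close>: the cell \<open>l\<close> because \<open>w\<close> is in the radical, the others by the cell order.\<close>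
  have "coeff ?q (x \<otimes>\<^bsub>A\<^esub> y) = \<zero>"
    using y
  proof (induction rule: cell_induct)
    case zero
    then show ?case using x q by (simp add: coeff_zero)
  next
    case (step r m u v z)
    have ngt: "\<not> gt l m" using y0[of m u v] step by (auto simp: I_iff low_def)
    have am: "a m u v \<in> carrier A" using step a_closed by blast
    have "coeff ?q (x \<otimes>\<^bsub>A\<^esub> a m u v) = \<zero>"
    proof (cases "m = l \<and> v = s")
      case False
      then show ?thesis using x q ngt step by (intro cell_left_zero) auto
    next
      case True
      have "coeff ?q (x \<otimes>\<^bsub>A\<^esub> a m u v) = (\<Oplus>v'\<in>T l. w v' \<otimes> coeff ?q (a l s v' \<otimes>\<^bsub>A\<^esub> a m u v))"
        unfolding x_def using q finite_T l s wc am a_closed by (intro coeff_finsum_mult) auto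
      also have "\<dots> = (\<Oplus>v'\<in>T l. w v' \<otimes> form l v' u)"
        using True step l s q not_gt_refl[OF l] wc form_closed
        by (intro R.finsum_cong') (auto simp: coeff_product)
      finally show ?thesis using ker step True by simp
    qed
    then show ?case
      using step x q am by (simp add: A.r_distr smult_mult_right coeff_add coeff_smult)
  qed
  then show False using yq by contradiction
qed

text \<open>
  For one \<open>x\<close>, a dual vector of \<open>x\<close> gives an element \<open>g\<close> with \<open>g \<otimes> a l s t\<close> congruent to \<open>e \<odot> a l s t\<close> for
  \<open>s = x\<close> and to zero for other \<open>s\<close>.  Since the scalars \<open>e\<close> vary with \<open>x\<close>, the elements are scaled
  to a common multiple before they are added.
\<close>

lemma scaled_left_identity_on:
  assumes l: "l \<in> \<Lambda>" and S: "S \<subseteq> T l"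
  shows "\<exists>d h. d \<in> carrier R \<and> d \<noteq> \<zero> \<and> h \<in> carrier A \<and> (\<forall>p\<in>I. fst p \<noteq> l \<longrightarrow> coeff p h = \<zero>) \<and>
    (\<forall>s\<in>T l. \<forall>t\<in>T l. \<forall>p\<in>I. \<not> gt (fst p) l \<longrightarrow>
      coeff p (h \<otimes>\<^bsub>A\<^esub> a l s t) = (if s \<in> S then d \<otimes> coeff p (a l s t) else \<zero>))"
proof -
  have "finite S" using S finite_T[OF l] finite_subset by blast
  then show ?thesis using S
  proof (induction S rule: finite_induct)
    case empty
    then show ?case using l a_closed
      by (intro exI[of _ "\<one>"] exI[of _ "\<zero>\<^bsub>A\<^esub>"]) (auto simp: coeff_zero)
  next
    case (insert x S)
    then obtain d h where d: "d \<in> carrier R" "d \<noteq> \<zero>" and h: "h \<in> carrier A"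
      and h0: "\<And>p. \<lbrakk>p \<in> I; fst p \<noteq> l\<rbrakk> \<Longrightarrow> coeff p h = \<zero>"
      and hm: "\<And>s t p. \<lbrakk>s \<in> T l; t \<in> T l; p \<in> I; \<not> gt (fst p) l\<rbrakk> \<Longrightarrow>
        coeff p (h \<otimes>\<^bsub>A\<^esub> a l s t) = (if s \<in> S then d \<otimes> coeff p (a l s t) else \<zero>)"
      by auto
    have x: "x \<in> T l" using insert by simp
    obtain w e where w: "w \<in> T l \<rightarrow> carrier R" and e: "e \<in> carrier R" "e \<noteq> \<zero>"
      and we: "\<And>t. t \<in> T l \<Longrightarrow> (\<Oplus>s\<in>T l. w s \<otimes> form l s t) = (if t = x then e else \<zero>)"
    proof (rule R.scaled_dual_vector[OF finite_T[OF l], of "form l" x])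
      show "\<And>s t. \<lbrakk>s \<in> T l; t \<in> T l\<rbrakk> \<Longrightarrow> form l s t \<in> carrier R" by (rule form_closed[OF l])
      show "\<forall>s\<in>T l. w s = \<zero>"
        if "w \<in> T l \<rightarrow> carrier R" "\<And>t. t \<in> T l \<Longrightarrow> (\<Oplus>s\<in>T l. w s \<otimes> form l s t) = \<zero>" for w
        using that by (rule form_nondegenerate[OF l])
    qed (use x that in blast)+
    have wc: "w s \<in> carrier R" if "s \<in> T l" for s using w that by auto
    define g where "g = (\<Oplus>\<^bsub>A\<^esub>u\<in>T l. w u \<odot>\<^bsub>A\<^esub> a l x u)"
    have g: "g \<in> carrier A" unfolding g_def using l x wc by (intro row_closed) auto
    have g0: "coeff p g = \<zero>" if "p \<in> I" "fst p \<noteq> l" for p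
      unfolding g_def using that l x wc coeff_row[of l x "fst p" "fst (snd p)" "snd (snd p)" "T l" w] by simp
    have gm: "coeff p (g \<otimes>\<^bsub>A\<^esub> a l s t) = (if s = x then e \<otimes> coeff p (a l s t) else \<zero>)"
      if st: "s \<in> T l" "t \<in> T l" and p: "p \<in> I" "\<not> gt (fst p) l" for s t p
    proof -
      obtain m w' z where [simp]: "p = (m, w', z)" using prod_cases3 by blast
      have "coeff p (g \<otimes>\<^bsub>A\<^esub> a l s t) = (\<Oplus>u\<in>T l. w u \<otimes> coeff p (a l x u \<otimes>\<^bsub>A\<^esub> a l s t))"
        unfolding g_def using p finite_T[OF l] l x wc st a_closed by (intro coeff_finsum_mult) auto
      also have "\<dots> = (\<Oplus>u\<in>T l. if p = (l, x, t) then w u \<otimes> form l u s else \<zero>)"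
        using p l x wc st form_closed by (intro R.finsum_cong') (auto simp: coeff_product)
      also have "\<dots> = (if p = (l, x, t) then (\<Oplus>u\<in>T l. w u \<otimes> form l u s) else \<zero>)"
        by (cases "p = (l, x, t)") (simp_all only: if_True if_False R.finsum_zero refl)
      finally show ?thesis using we[OF st(1)] p l st e by (auto simp: coeff_a)
    qed
    let ?h = "e \<odot>\<^bsub>A\<^esub> h \<oplus>\<^bsub>A\<^esub> d \<odot>\<^bsub>A\<^esub> g"
    show ?case
    proof (intro exI[of _ "d \<otimes> e"] exI[of _ ?h] conjI ballI impI)
      show "d \<otimes> e \<noteq> \<zero>" using d e R.integral by blast
      show "coeff p ?h = \<zero>" if "p \<in> I" "fst p \<noteq> l" for p
        using that h0 g0 h g d e by (simp add: coeff_add coeff_smult)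
      fix s t p assume st: "s \<in> T l" "t \<in> T l" and p: "p \<in> I" "\<not> gt (fst p) l"
      have al: "a l s t \<in> carrier A" using l st a_closed by blast
      have "coeff p (?h \<otimes>\<^bsub>A\<^esub> a l s t) = e \<otimes> coeff p (h \<otimes>\<^bsub>A\<^esub> a l s t) \<oplus> d \<otimes> coeff p (g \<otimes>\<^bsub>A\<^esub> a l s t)"
        using p h g d e al by (simp add: A.l_distr smult_mult_left coeff_add coeff_smult)
      also have "\<dots> = (if s \<in> insert x S then d \<otimes> e \<otimes> coeff p (a l s t) else \<zero>)"
        using hm[OF st p] gm[OF st p] insert.hyps coeff_closed[OF p(1) al] d e
        by (auto simp: R.m_assoc R.m_lcomm)
      finally show "coeff p (?h \<otimes>\<^bsub>A\<^esub> a l s t) = (if s \<in> insert x S then d \<otimes> e \<otimes> coeff p (a l s t) else \<zero>)" .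
    qed (use h g d e in auto)
  qed
qed

lemma scaled_left_identity:
  assumes l: "l \<in> \<Lambda>"
  obtains d h where "d \<in> carrier R" "d \<noteq> \<zero>" "h \<in> carrier A" "\<And>p. \<lbrakk>p \<in> I; fst p \<noteq> l\<rbrakk> \<Longrightarrow> coeff p h = \<zero>"
    "\<And>s t p. \<lbrakk>s \<in> T l; t \<in> T l; p \<in> I; \<not> gt (fst p) l\<rbrakk>
      \<Longrightarrow> coeff p (h \<otimes>\<^bsub>A\<^esub> a l s t) = d \<otimes> coeff p (a l s t)"
  using scaled_left_identity_on[OF l order_refl] by auto

lemma scaled_right_identity:
  assumes l: "l \<in> \<Lambda>"
  obtains d h where "d \<in> carrier R" "d \<noteq> \<zero>" "h \<in> carrier A" "\<And>p. \<lbrakk>p \<in> I; fst p \<noteq> l\<rbrakk> \<Longrightarrow> coeff p h = \<zero>"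
    "\<And>s t p. \<lbrakk>s \<in> T l; t \<in> T l; p \<in> I; \<not> gt (fst p) l\<rbrakk>
      \<Longrightarrow> coeff p (a l s t \<otimes>\<^bsub>A\<^esub> h) = d \<otimes> coeff p (a l s t)"
proof -
  obtain d h where d: "d \<in> carrier R" "d \<noteq> \<zero>" and h: "h \<in> carrier A"
    and h0: "\<And>p. \<lbrakk>p \<in> I; fst p \<noteq> l\<rbrakk> \<Longrightarrow> coeff p h = \<zero>"
    and hm: "\<And>s t p. \<lbrakk>s \<in> T l; t \<in> T l; p \<in> I; \<not> gt (fst p) l\<rbrakk>
      \<Longrightarrow> coeff p (h \<otimes>\<^bsub>A\<^esub> a l s t) = d \<otimes> coeff p (a l s t)"
    using scaled_left_identity[OF l] by blast
  show thesis
  proof (rule that[of d "star h"])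
    show "coeff p (star h) = \<zero>" if "p \<in> I" "fst p \<noteq> l" for p
      using that h h0 by (cases p) (auto simp: coeff_star I_iff)
    fix s t p assume st: "s \<in> T l" "t \<in> T l" and p: "p \<in> I" "\<not> gt (fst p) l"
    obtain m u v where [simp]: "p = (m, u, v)" using prod_cases3 by blast
    have vu: "(m, v, u) \<in> I" using p by (simp add: I_iff)
    have "coeff p (a l s t \<otimes>\<^bsub>A\<^esub> star h) = coeff (m, v, u) (h \<otimes>\<^bsub>A\<^esub> a l t s)"
      using coeff_mult_star[of h l t s m v u] h l st vu by simp
    also have "\<dots> = d \<otimes> coeff (m, v, u) (a l t s)" using hm[OF st(2,1) vu] p by simp
    also have "\<dots> = d \<otimes> coeff p (a l s t)" using p vu l st by (auto simp: coeff_a)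
    finally show "coeff p (a l s t \<otimes>\<^bsub>A\<^esub> star h) = d \<otimes> coeff p (a l s t)" .
  qed (use d h star_closed in auto)
qed

end

section \<open>Transfer to the field of fractions\<close>

locale jm_scalar_extension = separated_jm_family R A \<Lambda> gt T a star sdom M L c + scalar_extension R K A \<iota>
  for R :: "('r, 'x) ring_scheme" (structure) and A :: "('r, 'a, 'y) module_scheme" (structure)
    and \<Lambda> :: "'l set" and gt and T :: "'l \<Rightarrow> 't set" and a star sdom M L
    and c :: "'l \<times> 't \<Rightarrow> nat \<Rightarrow> 'r"
    and K :: "('k, 'z) ring_scheme" (structure) and \<iota> :: "'r \<Rightarrow> 'k" +
  assumes field_K: "field K" and \<iota>_inj: "inj_on \<iota> (carrier R)"
begin

sublocale K: field K by (rule field_K)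

sublocale B: unital_algebra K B by (rule B_unital_algebra)

abbreviation a_K :: "'l \<Rightarrow> 't \<Rightarrow> 't \<Rightarrow> (('a \<times> 'k) \<Rightarrow>\<^sub>0 int) set"
  where "a_K l s t \<equiv> embed (a l s t)"

abbreviation form_K :: "'l \<Rightarrow> 't \<Rightarrow> 't \<Rightarrow> 'k" where "form_K l s t \<equiv> \<iota> (form l s t)"

lemma \<iota>_nonzero: assumes "d \<in> carrier R" "d \<noteq> \<zero>\<^bsub>R\<^esub>" shows "\<iota> d \<noteq> \<zero>\<^bsub>K\<^esub>"
proof -
  have "\<iota> \<zero>\<^bsub>R\<^esub> = \<zero>\<^bsub>K\<^esub>"
    using ring_hom_zero[OF \<iota>_hom R.ring_axioms K.ring_axioms] .
  then show ?thesis using assms inj_onD[OF \<iota>_inj, of d "\<zero>\<^bsub>R\<^esub>"] by auto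
qed

lemma embed_zero: "embed \<zero>\<^bsub>A\<^esub> = \<zero>\<^bsub>B\<^esub>"
  using embed_add[of "\<zero>\<^bsub>A\<^esub>" "\<zero>\<^bsub>A\<^esub>"] embed_closed[of "\<zero>\<^bsub>A\<^esub>"] by simp

lemma embed_minus:
  assumes "x \<in> carrier A" "y \<in> carrier A"
  shows "embed (x \<ominus>\<^bsub>A\<^esub> y) = embed x \<ominus>\<^bsub>B\<^esub> embed y"
proof -
  have "embed x = embed (x \<ominus>\<^bsub>A\<^esub> y) \<oplus>\<^bsub>B\<^esub> embed y"
    using assms embed_add[of "x \<ominus>\<^bsub>A\<^esub> y" y] by (simp add: a_minus_def M.a_assoc M.l_neg)
  then show ?thesis
    using assms embed_closed[of "x \<ominus>\<^bsub>A\<^esub> y"] embed_closed[of y]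
    by (simp add: a_minus_def B.M.a_assoc B.M.r_neg)
qed

lemma a_K_closed: "\<lbrakk>l \<in> \<Lambda>; s \<in> T l; t \<in> T l\<rbrakk> \<Longrightarrow> a_K l s t \<in> carrier B"
  by (intro embed_closed a_closed)

sublocale C: cell_filtration K B \<Lambda> gt T a_K form_K
  by unfold_locales
    (use finite_poset finite_T a_K_closed form_closed \<iota>_closed in auto)

lemma embed_cells:
  assumes x: "x \<in> carrier A" and U: "U \<subseteq> \<Lambda>" and "\<And>p. \<lbrakk>p \<in> I; fst p \<notin> U\<rbrakk> \<Longrightarrow> coeff p x = \<zero>\<^bsub>R\<^esub>"
  shows "embed x \<in> C.cells U"
  using x
proof (induction rule: cell_induct)
  case zero
  then show ?case unfolding embed_zero C.cells_def by (rule linear_hull.zero)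
next
  case (step r l s t y)
  have "l \<in> U" using step assms(3)[of "(l, s, t)"] by (auto simp: I_iff)
  then have "\<iota> r \<odot>\<^bsub>B\<^esub> a_K l s t \<oplus>\<^bsub>B\<^esub> embed y \<in> C.cells U"
    using step U \<iota>_closed by (intro C.cells_add C.cells_smult C.cells_gen)
  then show ?case using step a_closed by (simp add: embed_add embed_smult)
qed

lemma embed_higher:
  assumes "x \<in> carrier A" "\<And>p. \<lbrakk>p \<in> I; \<not> gt (fst p) l\<rbrakk> \<Longrightarrow> coeff p x = \<zero>\<^bsub>R\<^esub>"
  shows "embed x \<in> C.cells (C.above l)"
proof (rule embed_cells[OF assms(1)])
  fix p assume "p \<in> I" "fst p \<notin> C.above l"
  then have "\<not> gt (fst p) l" by (auto simp: C.above_def cell_index_def)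
  then show "coeff p x = \<zero>\<^bsub>R\<^esub>" using assms(2) \<open>p \<in> I\<close> by blast
qed (auto simp: C.above_def)

lemma embed_at_least:
  assumes "x \<in> carrier A" "l \<in> \<Lambda>" "\<And>p. \<lbrakk>p \<in> I; \<not> gt (fst p) l; fst p \<noteq> l\<rbrakk> \<Longrightarrow> coeff p x = \<zero>\<^bsub>R\<^esub>"
  shows "embed x \<in> C.cells (insert l (C.above l))"
proof (rule embed_cells[OF assms(1)])
  fix p assume "p \<in> I" "fst p \<notin> insert l (C.above l)"
  then have "\<not> gt (fst p) l" "fst p \<noteq> l" by (auto simp: C.above_def cell_index_def)
  then show "coeff p x = \<zero>\<^bsub>R\<^esub>" using assms(3) \<open>p \<in> I\<close> by blast
qed (use assms(2) in \<open>auto simp: C.above_def\<close>)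

lemma at_least_subset: "l \<in> \<Lambda> \<Longrightarrow> insert l (C.above l) \<subseteq> \<Lambda>"
  by (auto simp: C.above_def)

lemma ideal_right_B:
  assumes l: "l \<in> \<Lambda>" "s \<in> T l" "t \<in> T l" and x: "x \<in> carrier B"
  shows "a_K l s t \<otimes>\<^bsub>B\<^esub> x \<in> C.cells (insert l (C.above l))"
  unfolding C.cells_def
proof (rule B.hull_mult_left)
  show "x \<in> linear_hull K B (embed ` carrier A)" using x embed_spans by simp
  fix g assume "g \<in> embed ` carrier A"
  then obtain y where y: "y \<in> carrier A" "g = embed y" by auto
  have "coeff p (a l s t \<otimes>\<^bsub>A\<^esub> y) = \<zero>\<^bsub>R\<^esub>" if "p \<in> I" "\<not> gt (fst p) l" "fst p \<noteq> l" for p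
    using cell_right_zero[OF y(1) l, of "fst p" "fst (snd p)" "snd (snd p)"] that by simp
  then have "embed (a l s t \<otimes>\<^bsub>A\<^esub> y) \<in> C.cells (insert l (C.above l))"
    using l y a_closed by (intro embed_at_least) auto
  then show "a_K l s t \<otimes>\<^bsub>B\<^esub> g \<in> linear_hull K B {a_K k s t |k s t. k \<in> insert l (C.above l) \<and> s \<in> T k \<and> t \<in> T k}"
    using l y a_closed by (simp add: embed_mult C.cells_def)
qed (use l a_K_closed embed_closed C.gens_closed[OF at_least_subset] in auto)

lemma ideal_left_B:
  assumes l: "l \<in> \<Lambda>" "s \<in> T l" "t \<in> T l" and x: "x \<in> carrier B"
  shows "x \<otimes>\<^bsub>B\<^esub> a_K l s t \<in> C.cells (insert l (C.above l))"
  unfolding C.cells_def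
proof (rule B.hull_mult_right)
  show "x \<in> linear_hull K B (embed ` carrier A)" using x embed_spans by simp
  fix g assume "g \<in> embed ` carrier A"
  then obtain y where y: "y \<in> carrier A" "g = embed y" by auto
  have "coeff p (y \<otimes>\<^bsub>A\<^esub> a l s t) = \<zero>\<^bsub>R\<^esub>" if "p \<in> I" "\<not> gt (fst p) l" "fst p \<noteq> l" for p
    using cell_left_zero[OF y(1) l, of "fst p" "fst (snd p)" "snd (snd p)"] that by simp
  then have "embed (y \<otimes>\<^bsub>A\<^esub> a l s t) \<in> C.cells (insert l (C.above l))"
    using l y a_closed by (intro embed_at_least) auto
  then show "g \<otimes>\<^bsub>B\<^esub> a_K l s t \<in> linear_hull K B {a_K k s t |k s t. k \<in> insert l (C.above l) \<and> s \<in> T k \<and> t \<in> T k}"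
    using l y a_closed by (simp add: embed_mult C.cells_def)
qed (use l a_K_closed embed_closed C.gens_closed[OF at_least_subset] in auto)

text \<open>
  Division by \<open>d\<close>, which is what the field \<open>K\<close> is for.
\<close>

lemma unscale:
  assumes d: "d \<in> carrier R" "d \<noteq> \<zero>\<^bsub>R\<^esub>" and x: "x \<in> carrier A" and y: "y \<in> carrier A" and l: "l \<in> \<Lambda>"
    and xy: "\<And>p. \<lbrakk>p \<in> I; \<not> gt (fst p) l\<rbrakk> \<Longrightarrow> coeff p x = d \<otimes>\<^bsub>R\<^esub> coeff p y"
  shows "inv\<^bsub>K\<^esub> (\<iota> d) \<odot>\<^bsub>B\<^esub> embed x \<ominus>\<^bsub>B\<^esub> embed y \<in> C.cells (C.above l)"
proof -
  have inv: "inv\<^bsub>K\<^esub> (\<iota> d) \<in> carrier K" "inv\<^bsub>K\<^esub> (\<iota> d) \<otimes>\<^bsub>K\<^esub> \<iota> d = \<one>\<^bsub>K\<^esub>"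
    using \<iota>_nonzero[OF d] \<iota>_closed[OF d(1)] K.field_Units by auto
  define z where "z = x \<ominus>\<^bsub>A\<^esub> d \<odot>\<^bsub>A\<^esub> y"
  have z: "z \<in> carrier A" using x y d by (simp add: z_def)
  have "coeff p z = \<zero>\<^bsub>R\<^esub>" if "p \<in> I" "\<not> gt (fst p) l" for p
  proof -
    have "coeff p z = d \<otimes>\<^bsub>R\<^esub> coeff p y \<ominus>\<^bsub>R\<^esub> d \<otimes>\<^bsub>R\<^esub> coeff p y"
      using that xy x y d by (simp add: z_def coeff_minus coeff_smult)
    then show ?thesis using that d y coeff_closed by (simp add: a_minus_def R.r_neg)
  qed
  then have "inv\<^bsub>K\<^esub> (\<iota> d) \<odot>\<^bsub>B\<^esub> embed z \<in> C.cells (C.above l)"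
    using z inv by (intro C.cells_smult embed_higher) (auto simp: C.above_def)
  moreover have z_e: "embed z = embed x \<ominus>\<^bsub>B\<^esub> \<iota> d \<odot>\<^bsub>B\<^esub> embed y"
    using x y d by (simp add: z_def embed_minus embed_smult)
  moreover have "inv\<^bsub>K\<^esub> (\<iota> d) \<odot>\<^bsub>B\<^esub> embed z = inv\<^bsub>K\<^esub> (\<iota> d) \<odot>\<^bsub>B\<^esub> embed x \<ominus>\<^bsub>B\<^esub> (inv\<^bsub>K\<^esub> (\<iota> d) \<otimes>\<^bsub>K\<^esub> \<iota> d) \<odot>\<^bsub>B\<^esub> embed y"
    using x y d inv(1) \<iota>_closed[OF d(1)] embed_closed unfolding z_e
    by (simp add: a_minus_def B.smult_r_distr B.smult_r_minus B.smult_assoc1)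
  ultimately show ?thesis using inv y embed_closed by simp
qed

lemma left_identity_B:
  assumes l: "l \<in> \<Lambda>"
  shows "\<exists>h\<in>C.cells (insert l (C.above l)). \<forall>s\<in>T l. \<forall>t\<in>T l.
    h \<otimes>\<^bsub>B\<^esub> a_K l s t \<ominus>\<^bsub>B\<^esub> a_K l s t \<in> C.cells (C.above l)"
proof -
  obtain d h where d: "d \<in> carrier R" "d \<noteq> \<zero>\<^bsub>R\<^esub>" and h: "h \<in> carrier A"
    and h0: "\<And>p. \<lbrakk>p \<in> I; fst p \<noteq> l\<rbrakk> \<Longrightarrow> coeff p h = \<zero>\<^bsub>R\<^esub>"
    and hm: "\<And>s t p. \<lbrakk>s \<in> T l; t \<in> T l; p \<in> I; \<not> gt (fst p) l\<rbrakk>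
      \<Longrightarrow> coeff p (h \<otimes>\<^bsub>A\<^esub> a l s t) = d \<otimes>\<^bsub>R\<^esub> coeff p (a l s t)"
    using scaled_left_identity[OF l] by blast
  have inv: "inv\<^bsub>K\<^esub> (\<iota> d) \<in> carrier K"
    using \<iota>_nonzero[OF d] \<iota>_closed[OF d(1)] K.field_Units by auto
  show ?thesis
  proof (intro bexI ballI)
    show "inv\<^bsub>K\<^esub> (\<iota> d) \<odot>\<^bsub>B\<^esub> embed h \<in> C.cells (insert l (C.above l))"
      using h h0 l inv at_least_subset by (intro C.cells_smult embed_at_least) auto
    fix s t assume st: "s \<in> T l" "t \<in> T l"
    have "inv\<^bsub>K\<^esub> (\<iota> d) \<odot>\<^bsub>B\<^esub> embed (h \<otimes>\<^bsub>A\<^esub> a l s t) \<ominus>\<^bsub>B\<^esub> a_K l s t \<in> C.cells (C.above l)"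
      using d h l st a_closed hm by (intro unscale) auto
    then show "inv\<^bsub>K\<^esub> (\<iota> d) \<odot>\<^bsub>B\<^esub> embed h \<otimes>\<^bsub>B\<^esub> a_K l s t \<ominus>\<^bsub>B\<^esub> a_K l s t \<in> C.cells (C.above l)"
      using h l st inv a_closed embed_closed by (simp add: B.smult_mult_left embed_mult)
  qed
qed

lemma right_identity_B:
  assumes l: "l \<in> \<Lambda>"
  shows "\<exists>h\<in>C.cells (insert l (C.above l)). \<forall>s\<in>T l. \<forall>t\<in>T l.
    a_K l s t \<otimes>\<^bsub>B\<^esub> h \<ominus>\<^bsub>B\<^esub> a_K l s t \<in> C.cells (C.above l)"
proof -
  obtain d h where d: "d \<in> carrier R" "d \<noteq> \<zero>\<^bsub>R\<^esub>" and h: "h \<in> carrier A"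
    and h0: "\<And>p. \<lbrakk>p \<in> I; fst p \<noteq> l\<rbrakk> \<Longrightarrow> coeff p h = \<zero>\<^bsub>R\<^esub>"
    and hm: "\<And>s t p. \<lbrakk>s \<in> T l; t \<in> T l; p \<in> I; \<not> gt (fst p) l\<rbrakk>
      \<Longrightarrow> coeff p (a l s t \<otimes>\<^bsub>A\<^esub> h) = d \<otimes>\<^bsub>R\<^esub> coeff p (a l s t)"
    using scaled_right_identity[OF l] by blast
  have inv: "inv\<^bsub>K\<^esub> (\<iota> d) \<in> carrier K"
    using \<iota>_nonzero[OF d] \<iota>_closed[OF d(1)] K.field_Units by auto
  show ?thesis
  proof (intro bexI ballI)
    show "inv\<^bsub>K\<^esub> (\<iota> d) \<odot>\<^bsub>B\<^esub> embed h \<in> C.cells (insert l (C.above l))"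
      using h h0 l inv at_least_subset by (intro C.cells_smult embed_at_least) auto
    fix s t assume st: "s \<in> T l" "t \<in> T l"
    have "inv\<^bsub>K\<^esub> (\<iota> d) \<odot>\<^bsub>B\<^esub> embed (a l s t \<otimes>\<^bsub>A\<^esub> h) \<ominus>\<^bsub>B\<^esub> a_K l s t \<in> C.cells (C.above l)"
      using d h l st a_closed hm by (intro unscale) auto
    then show "a_K l s t \<otimes>\<^bsub>B\<^esub> (inv\<^bsub>K\<^esub> (\<iota> d) \<odot>\<^bsub>B\<^esub> embed h) \<ominus>\<^bsub>B\<^esub> a_K l s t \<in> C.cells (C.above l)"
      using h l st inv a_closed embed_closed by (simp add: B.smult_mult_right embed_mult)
  qed
qed

text \<open>
  Each condition is the image under \<open>embed\<close> of a statement about coefficients in \<open>A\<close>.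
\<close>

lemma base_change_nondegenerate: "nondegenerate_cell_filtration K B \<Lambda> gt T a_K form_K"
proof unfold_locales
  have "embed ` carrier A \<subseteq> C.cells \<Lambda>"
    using embed_cells[OF _ order_refl] by (auto simp: cell_index_def)
  then have "linear_hull K B (embed ` carrier A) \<subseteq> C.cells \<Lambda>"
    unfolding C.cells_def by (rule B.hull_least[OF _ C.gens_closed[OF order_refl]])
  then show "carrier B = C.cells \<Lambda>"
    using embed_spans C.cells_closed[OF _ order_refl] by blast
next
  fix l s t x assume "l \<in> \<Lambda>" "s \<in> T l" "t \<in> T l" "x \<in> carrier B"
  then show "a_K l s t \<otimes>\<^bsub>B\<^esub> x \<in> C.cells (insert l (C.above l))"
    "x \<otimes>\<^bsub>B\<^esub> a_K l s t \<in> C.cells (insert l (C.above l))"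
    by (rule ideal_right_B, rule ideal_left_B)
next
  fix l s t u v assume l: "l \<in> \<Lambda>" "s \<in> T l" "t \<in> T l" "u \<in> T l" "v \<in> T l"
  let ?x = "a l s t \<otimes>\<^bsub>A\<^esub> a l u v \<ominus>\<^bsub>A\<^esub> form l t u \<odot>\<^bsub>A\<^esub> a l s v"
  have cl: "a l s t \<in> carrier A" "a l u v \<in> carrier A" "a l s v \<in> carrier A" "form l t u \<in> carrier R"
    using l a_closed form_closed by auto
  have "coeff p ?x = \<zero>\<^bsub>R\<^esub>" if "p \<in> I" "\<not> gt (fst p) l" for p
  proof -
    have "coeff p (a l s t \<otimes>\<^bsub>A\<^esub> a l u v) = (if p = (l, s, v) then form l t u else \<zero>\<^bsub>R\<^esub>)"
      using coeff_product[OF l, of "fst p" "fst (snd p)" "snd (snd p)"] that by simp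
    then have "coeff p ?x = (if p = (l, s, v) then form l t u \<ominus>\<^bsub>R\<^esub> form l t u else \<zero>\<^bsub>R\<^esub>)"
      using that cl l by (simp add: coeff_minus coeff_smult coeff_a)
    then show ?thesis using cl by (simp add: a_minus_def R.r_neg)
  qed
  then have "embed ?x \<in> C.cells (C.above l)" using cl by (intro embed_higher) auto
  then show "a_K l s t \<otimes>\<^bsub>B\<^esub> a_K l u v \<ominus>\<^bsub>B\<^esub> form_K l t u \<odot>\<^bsub>B\<^esub> a_K l s v \<in> C.cells (C.above l)"
    using cl by (simp add: embed_minus embed_mult embed_smult)
next
  fix l s t m u v assume *: "l \<in> \<Lambda>" "s \<in> T l" "t \<in> T l" "m \<in> \<Lambda>" "u \<in> T m" "v \<in> T m" "l \<noteq> m" "\<not> gt l m"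
  have "coeff p (a l s t \<otimes>\<^bsub>A\<^esub> a m u v) = \<zero>\<^bsub>R\<^esub>" if "p \<in> I" "\<not> gt (fst p) l" for p
    using coeff_product_distinct[OF *, of "fst p" "fst (snd p)" "snd (snd p)"] that by simp
  then have "embed (a l s t \<otimes>\<^bsub>A\<^esub> a m u v) \<in> C.cells (C.above l)"
    using * a_closed by (intro embed_higher) auto
  then show "a_K l s t \<otimes>\<^bsub>B\<^esub> a_K m u v \<in> C.cells (C.above l)"
    using * a_closed by (simp add: embed_mult)
qed (rule left_identity_B right_identity_B; assumption)+

theorem base_change_split_semisimple: "split_semisimple_algebra K B TYPE('v)"
  using orthogonal_cells.split_semisimple[OF nondegenerate_cell_filtration.orthogonal[OF base_change_nondegenerate]] .

end

theorem corollary2p9: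
  fixes R :: "('r, 'x) ring_scheme" and K :: "('k, 'y) ring_scheme"
    and A :: "('r, 'a, 'z) module_scheme" and \<iota> :: "'r \<Rightarrow> 'k"
    and \<Lambda> :: "'l set" and gt :: "'l \<Rightarrow> 'l \<Rightarrow> bool" and T :: "'l \<Rightarrow> 't set"
    and a :: "'l \<Rightarrow> 't \<Rightarrow> 't \<Rightarrow> 'a" and star :: "'a \<Rightarrow> 'a"
    and sdom :: "'l \<Rightarrow> 't \<Rightarrow> 't \<Rightarrow> bool"
    and M :: nat and L :: "nat \<Rightarrow> 'a" and c :: "'l \<times> 't \<Rightarrow> nat \<Rightarrow> 'r"
  assumes "field_of_fractions R K \<iota>"
    and "cellular_algebra R A \<Lambda> gt T a star"
    and "jm_family R A \<Lambda> gt T a star sdom M L c"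
    and "jm_separates \<Lambda> gt T sdom M c"
  shows "split_semisimple_algebra K (base_change R \<iota> K A) TYPE('v)"
proof -
  interpret jm_family R A \<Lambda> gt T a star sdom M L c by fact
  have dom: "domain R" "field K" "\<iota> \<in> ring_hom R K" "inj_on \<iota> (carrier R)"
    using assms(1) by (auto simp: field_of_fractions_def)
  have "cring K" using dom(2) by (simp add: field_def domain_def)
  with dom assms(4) interpret jm_scalar_extension R A \<Lambda> gt T a star sdom M L c K \<iota>
    by (intro jm_scalar_extension.intro separated_jm_family.intro scalar_extension.intro
        scalar_extension_axioms.intro jm_scalar_extension_axioms.intro separated_jm_family_axioms.intro
        jm_family_axioms unital_algebra_axioms)
  show ?thesis by (rule base_change_split_semisimple)
qed

end
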